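(* Fix $p>1$ and positive weights $(\lambda_k)_{k\ge0}$ with $\lambda_k\to\infty$ such that $\lambda_k=o(k^q)$ as $k\to\infty$ for every $q>1$. Let $M\in\mathbb N$ and let $F:\mathcal T^{(p)}_{\mathbf 1}(\mathbb R^m)\to L(\mathbb R^d,\mathfrak t^M(\mathbb R^m))$, with $F^j:\mathcal T^{(p)}_{\mathbf 1}(\mathbb R^m)\to\mathfrak t^M(\mathbb R^m)$ its $j$-th column. For each $j\in\{1,\dots,d\}$ assume: (i) $F^j$ is locally Lipschitz: for every $\mathbf a\in\mathcal T^{(p)}_{\mathbf 1}(\mathbb R^m)$ there are a neighborhood $U_{\mathbf a}$ of $\mathbf a$ and $L_{\mathbf a}>0$ with $|F^j(\mathbf a_1)-F^j(\mathbf a_2)|\le L_{\mathbf a}\|\mathbf a_1-\mathbf a_2\|_{(p)}$ for all $\mathbf a_1,\mathbf a_2\in U_{\mathbf a}$; (ii) for every $R>0$ there is $C_F>0$ such that for all $\mathbf a\in T(\mathbb R^m)$ with $\mathbf a^{(0)}=1$ and $\|\mathbf a-\mathbf 1\|_{(p)}\le R$, $$\|\delta_{\alpha(1+\lambda)^{-1}}F^j(\delta_\lambda\mathbf a)\|_1\le C_F\,\alpha\qquad\text{for all }\alpha,\lambda\ge0 .$$ Then for every $T>0$, every Lipschitz control $x:[0,T]\to\mathbb R^d$ and every $S_0\in\mathbf T_{\mathbf 1}(\mathbb R^m)$, the equation $$S_t=S_0+\sum_{j=1}^d\int_0^tS_u\otimes F^j(S_u)\,\mathrm dx^j_u,\qquad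 t\in[0,T],$$ admits a unique global solution $S$ with $S\in C^0([0,T],\mathcal T^{(l)}_{\mathbf 1}(\mathbb R^m))$ for every $l>1$. Moreover, $S_t\in\mathbf T_{\mathbf 1}(\mathbb R^m)$ for all $t\in[0,T]$, and the associated flow map $\mathbf T_{\mathbf 1}(\mathbb R^m)\times[0,T]\ni(S_0,t)\mapsto S_t\in\mathbf T_{\mathbf 1}(\mathbb R^m)$ is continuous.
   Context: $T((\mathbb R^m))=\prod_{n\ge0}(\mathbb R^m)^{\otimes n}$ with elements $\mathbf a=(\mathbf a^{(n)})_{n\ge0}$, levels carrying Euclidean norms $|\cdot|$, and the concatenation tensor product $\otimes$ (Cauchy product over levels); $T(\mathbb R^m)=\bigoplus_{n\ge0}(\mathbb R^m)^{\otimes n}$; $T^M(\mathbb R^m)=\bigoplus_{n=0}^M(\mathbb R^m)^{\otimes n}$; $\mathbf 1=(1,0,0,\dots)$. $\mathfrak t^M(\mathbb R^m)=\{\mathbf a\in T^M(\mathbb R^m):\mathbf a^{(0)}=0\}$, regarded as a subspace of $T(\mathbb R^m)$ by zero padding, with Euclidean norm $|\cdot|$. Dilations: $(\delta_\lambda\mathbf a)^{(n)}=\lambda^n\mathbf a^{(n)}$. $\|\mathbf a\|_1=\sum_n|\mathbf a^{(n)}|$ and $\|\mathbf a\|_{1,\lambda}=\sum_n\lambda^n|\mathbf a^{(n)}|$. For $l>1$, $$\mathcal T^{(l)}(\mathbb R^m)=\Big\{\mathbf a\in T((\mathbb R^m)):\|\mathbf a\|_{(l)}:=\frac1{Z_l}\sum_{k\ge0}e^{-k^l}\|\mathbf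 a\|_{1,\lambda_k}<\infty\Big\},\quad Z_l=\sum_{k\ge0}e^{-k^l},$$ a Banach space, always with the same fixed weights $(\lambda_k)$. $\mathcal T^{(l)}_{\mathbf 1}(\mathbb R^m)=\{\mathbf a\in\mathcal T^{(l)}(\mathbb R^m):\mathbf a^{(0)}=1\}$. $\mathbf T(\mathbb R^m)=\bigcap_{k\ge1}\mathcal T^{(1+1/k)}(\mathbb R^m)$ with the initial topology of the inclusions into the spaces $\mathcal T^{(1+1/k)}(\mathbb R^m)$, and $\mathbf T_{\mathbf 1}(\mathbb R^m)=\{\mathbf a\in\mathbf T(\mathbb R^m):\mathbf a^{(0)}=1\}$. For $l<l'$ one has $\mathcal T^{(l)}\subset\mathcal T^{(l')}$ continuously, and $\otimes:\mathcal T^{(l)}\times\mathcal T^{(l)}\to\mathcal T^{(l')}$ is continuous, so the integral equation makes sense (Riemann–Stieltjes integrals, equivalently level by level). *)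

theory Defs
  imports "HOL-Analysis.Analysis"
begin

text \<open>
  A tensor series is given by its coordinates in the standard basis of words over the
  index type of $\mathbb{R}^m$: the level-$n$ part consists of the values on words of length
  $n$, and the empty word carries level $0$. Every real family indexed by words is an element of
  $T((\mathbb{R}^m))$. Subtraction of tensor series is the pointwise one on functions.
\<close>

type_synonym 'm tseries = "'m list \<Rightarrow> real"

definition level_norm :: "'m::finite tseries \<Rightarrow> nat \<Rightarrow> real" where
  "level_norm a n = sqrt (\<Sum>w | length w = n. (a w)\<^sup>2)"

definition tone :: "'m tseries" where
  "tone w = (if w = [] then 1 else 0)"

definition tprod :: "'m tseries \<Rightarrow> 'm tseries \<Rightarrow> 'm tseries"  (infixl "\<otimes>\<^sub>t" 70) where
  "(a \<otimes>\<^sub>t b) w = (\<Sum>i\<le>length w. a (take i w) * b (drop i w))"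

definition dil :: "real \<Rightarrow> 'm tseries \<Rightarrow> 'm tseries" where
  "dil r a w = r ^ length w * a w"

definition tpolys :: "'m tseries set" where
  "tpolys = {a. \<exists>N. \<forall>w. length w > N \<longrightarrow> a w = 0}"

definition tM :: "nat \<Rightarrow> 'm tseries set" where
  "tM M = {a. a [] = 0 \<and> (\<forall>w. length w > M \<longrightarrow> a w = 0)}"

definition tM_norm :: "nat \<Rightarrow> 'm::finite tseries \<Rightarrow> real" where
  "tM_norm M a = sqrt (\<Sum>w | length w \<le> M. (a w)\<^sup>2)"

definition lin_tM :: "nat \<Rightarrow> (real ^ 'd \<Rightarrow> 'm tseries) set" where
  "lin_tM M = {A. (\<forall>v. A v \<in> tM M) \<and> (\<forall>w. linear (\<lambda>v. A v w))}"


text \<open>The norms take values in the extended nonnegative reals; finiteness is membership.\<close>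

definition norm1w :: "real \<Rightarrow> 'm::finite tseries \<Rightarrow> ennreal" where
  "norm1w r a = (\<Sum>n. ennreal (r ^ n * level_norm a n))"

definition norm1 :: "'m::finite tseries \<Rightarrow> ennreal" where
  "norm1 a = (\<Sum>n. ennreal (level_norm a n))"

definition Zl :: "real \<Rightarrow> ennreal" where
  "Zl l = (\<Sum>k. ennreal (exp (- (real k powr l))))"

definition tnorm :: "(nat \<Rightarrow> real) \<Rightarrow> real \<Rightarrow> 'm::finite tseries \<Rightarrow> ennreal" where
  "tnorm lam l a = (\<Sum>k. ennreal (exp (- (real k powr l))) * norm1w (lam k) a) / Zl l"

definition Tl :: "(nat \<Rightarrow> real) \<Rightarrow> real \<Rightarrow> 'm::finite tseries set" where
  "Tl lam l = {a. tnorm lam l a < \<infinity>}"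

definition Tl1 :: "(nat \<Rightarrow> real) \<Rightarrow> real \<Rightarrow> 'm::finite tseries set" where
  "Tl1 lam l = {a \<in> Tl lam l. a [] = 1}"

definition tdist :: "(nat \<Rightarrow> real) \<Rightarrow> real \<Rightarrow> 'm::finite tseries \<Rightarrow> 'm tseries \<Rightarrow> real" where
  "tdist lam l a b = enn2real (tnorm lam l (a - b))"

definition Tl_top :: "(nat \<Rightarrow> real) \<Rightarrow> real \<Rightarrow> 'm::finite tseries topology" where
  "Tl_top lam l = Metric_space.mtopology (Tl lam l) (tdist lam l)"

definition Tl1_top :: "(nat \<Rightarrow> real) \<Rightarrow> real \<Rightarrow> 'm::finite tseries topology" where
  "Tl1_top lam l = subtopology (Tl_top lam l) (Tl1 lam l)"

definition Tinf :: "(nat \<Rightarrow> real) \<Rightarrow> 'm::finite tseries set" where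
  "Tinf lam = (\<Inter>k\<in>{1::nat..}. Tl lam (1 + 1 / real k))"

definition Tinf1 :: "(nat \<Rightarrow> real) \<Rightarrow> 'm::finite tseries set" where
  "Tinf1 lam = {a \<in> Tinf lam. a [] = 1}"

text \<open>The initial topology: generated by the preimages of open sets under the inclusions.\<close>

definition Tinf_top :: "(nat \<Rightarrow> real) \<Rightarrow> 'm::finite tseries topology" where
  "Tinf_top lam = topology_generated_by
     {Tinf lam \<inter> U | k U. k \<ge> 1 \<and> openin (Tl_top lam (1 + 1 / real (k::nat))) U}"

definition Tinf1_top :: "(nat \<Rightarrow> real) \<Rightarrow> 'm::finite tseries topology" where
  "Tinf1_top lam = subtopology (Tinf_top lam) (Tinf1 lam)"


definition has_RS_integral ::
    "(real \<Rightarrow> real) \<Rightarrow> (real \<Rightarrow> real) \<Rightarrow> real \<Rightarrow> real \<Rightarrow> real \<Rightarrow> bool" where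
  "has_RS_integral f g a b I \<longleftrightarrow>
     (\<forall>e>0. \<exists>\<delta>>0. \<forall>p. p tagged_division_of {a..b} \<and> (\<forall>(u, K)\<in>p. Sup K - Inf K < \<delta>) \<longrightarrow>
        \<bar>(\<Sum>(u, K)\<in>p. f u * (g (Sup K) - g (Inf K))) - I\<bar> < e)"

text \<open>
  The integral equation is read level by level; as each level is finite dimensional this means
  coordinate by coordinate. The \<open>j\<close>-th column of \<open>F a\<close> is \<open>F a (axis j 1)\<close>.
\<close>

definition solves_eq ::
    "('m tseries \<Rightarrow> real ^ 'd \<Rightarrow> 'm tseries) \<Rightarrow> (real \<Rightarrow> real ^ 'd::finite) \<Rightarrow> real
      \<Rightarrow> 'm::finite tseries \<Rightarrow> (real \<Rightarrow> 'm tseries) \<Rightarrow> bool" where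
  "solves_eq F x T S0 S \<longleftrightarrow>
     (\<forall>t\<in>{0..T}. \<exists>I.
        (\<forall>j w. has_RS_integral (\<lambda>u. (S u \<otimes>\<^sub>t F (S u) (axis j 1)) w) (\<lambda>u. x u $ j) 0 t (I j w)) \<and>
        (\<forall>w. S t w = S0 w + (\<Sum>j\<in>UNIV. I j w)))"

definition C0_all :: "(nat \<Rightarrow> real) \<Rightarrow> real \<Rightarrow> (real \<Rightarrow> 'm::finite tseries) \<Rightarrow> bool" where
  "C0_all lam T S \<longleftrightarrow> (\<forall>l>1. continuous_map (top_of_set {0..T}) (Tl1_top lam l) S)"


text \<open>The norms do define a metric, so that \<^term>\<open>Tl_top\<close> is a genuine metric topology.\<close>

lemma level_norm_L2: "level_norm a n = L2_set a {w. length w = n}"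
  by (simp add: level_norm_def L2_set_def)

lemma finite_words: "finite {w :: 'm::finite list. length w = n}"
  using finite_lists_length_eq[of "UNIV :: 'm set" n] by simp

lemma Zl_pos: "Zl l \<noteq> 0"
proof -
  have "(\<Sum>k\<in>{0}. ennreal (exp (- (real k powr l)))) \<le> Zl l"
    unfolding Zl_def by (rule sum_le_suminf) auto
  then show ?thesis by auto
qed

lemma Zl_finite:
  assumes "l > 1"
  shows "Zl l < \<infinity>"
proof -
  have le: "exp (- (real k powr l)) \<le> exp (- 1) ^ k" for k
  proof (cases "k = 0")
    case False
    then have "real k powr 1 \<le> real k powr l"
      using assms by (intro powr_mono) auto
    then show ?thesis
      using False by (simp flip: exp_of_nat_mult)
  qed simp
  have "summable (\<lambda>k. exp (- 1 :: real) ^ k)"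
    by (rule summable_geometric) simp
  then have "summable (\<lambda>k. exp (- (real k powr l)))"
    by (rule summable_comparison_test') (use le in simp)
  then have "Zl l = ennreal (\<Sum>k. exp (- (real k powr l)))"
    unfolding Zl_def by (intro suminf_ennreal_eq) (auto simp: summable_sums)
  then show ?thesis by simp
qed

lemma tnorm_add:
  assumes "\<And>k. lam k \<ge> 0"
  shows "tnorm lam l (\<lambda>w. a w + b w) \<le> tnorm lam l a + tnorm lam l b"
proof -
  have lev: "level_norm (\<lambda>w. a w + b w) n \<le> level_norm a n + level_norm b n" for n
    unfolding level_norm_L2 by (rule L2_set_triangle_ineq)
  have nn: "level_norm c n \<ge> 0" for c :: "'a tseries" and n
    by (simp add: level_norm_def sum_nonneg)
  have n1: "norm1w (lam k) (\<lambda>w. a w + b w) \<le> norm1w (lam k) a + norm1w (lam k) b" for k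
  proof -
    have "norm1w (lam k) (\<lambda>w. a w + b w) \<le>
        (\<Sum>n. ennreal (lam k ^ n * level_norm a n) + ennreal (lam k ^ n * level_norm b n))"
      unfolding norm1w_def
    proof (intro suminf_le)
      fix n
      have "lam k ^ n * level_norm (\<lambda>w. a w + b w) n
          \<le> lam k ^ n * level_norm a n + lam k ^ n * level_norm b n"
        using mult_left_mono[OF lev, of "lam k ^ n"] assms by (simp add: distrib_left)
      then show "ennreal (lam k ^ n * level_norm (\<lambda>w. a w + b w) n)
          \<le> ennreal (lam k ^ n * level_norm a n) + ennreal (lam k ^ n * level_norm b n)"
        using assms nn by (subst ennreal_plus[symmetric]) (auto simp del: ennreal_plus intro!: ennreal_leI)
    qed auto
    also have "\<dots> = norm1w (lam k) a + norm1w (lam k) b"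
      unfolding norm1w_def by (intro suminf_add[symmetric]) auto
    finally show ?thesis .
  qed
  have "(\<Sum>k. ennreal (exp (- (real k powr l))) * norm1w (lam k) (\<lambda>w. a w + b w))
     \<le> (\<Sum>k. ennreal (exp (- (real k powr l))) * norm1w (lam k) a
          + ennreal (exp (- (real k powr l))) * norm1w (lam k) b)"
    using mult_left_mono[OF n1] by (intro suminf_le) (auto simp flip: distrib_left)
  also have "\<dots> = (\<Sum>k. ennreal (exp (- (real k powr l))) * norm1w (lam k) a)
          + (\<Sum>k. ennreal (exp (- (real k powr l))) * norm1w (lam k) b)"
    by (intro suminf_add[symmetric]) auto
  finally show ?thesis
    unfolding tnorm_def by (simp add: divide_right_mono_ennreal flip: add_divide_distrib_ennreal)
qed

lemma level_norm_sym: "level_norm (a - b) n = level_norm (b - a) n"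
  by (simp add: level_norm_def power2_commute)

lemma tnorm_sym: "tnorm lam l (a - b) = tnorm lam l (b - a)"
  by (simp add: tnorm_def norm1w_def level_norm_sym[of a b])

lemma tnorm_zero: "tnorm lam l (a - a) = 0"
  by (simp add: tnorm_def norm1w_def level_norm_def)

lemma tnorm_eq_0:
  assumes "\<And>k. lam k > 0" "l > 1" "tnorm lam l a = 0"
  shows "a w = 0"
proof -
  have "(\<Sum>k. ennreal (exp (- (real k powr l))) * norm1w (lam k) a) = 0"
    using assms(3) Zl_finite[OF assms(2)] by (auto simp: tnorm_def ennreal_divide_eq_0_iff)
  then have "norm1w (lam 0) a = 0"
    by (subst (asm) suminf_eq_zero_iff) (auto dest: spec[of _ 0])
  then have "lam 0 ^ length w * level_norm a (length w) \<le> 0"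
    unfolding norm1w_def by (subst (asm) suminf_eq_zero_iff) (auto simp: ennreal_eq_0_iff)
  then have "level_norm a (length w) \<le> 0"
    using zero_less_power[OF assms(1)[of 0], of "length w"] by (auto simp: mult_le_0_iff)
  then have "(\<Sum>v | length v = length w. (a v)\<^sup>2) = 0"
    by (simp add: level_norm_def antisym sum_nonneg)
  then show ?thesis
    using finite_words[of "length w"] by (subst (asm) sum_nonneg_eq_0_iff) auto
qed

lemma Metric_space_Tl:
  assumes "\<And>k. lam k > 0" "l > 1"
  shows "Metric_space (Tl lam l) (tdist lam l)"
proof
  have nn: "\<And>k. lam k \<ge> 0" using assms(1) less_imp_le by blast
  have tri: "tnorm lam l (a - c) \<le> tnorm lam l (a - b) + tnorm lam l (b - c)"
    for a b c :: "'a tseries"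
  proof -
    have "(\<lambda>w. (a - b) w + (b - c) w) = a - c" by (auto simp: fun_eq_iff)
    with tnorm_add[where lam = lam and l = l and a = "a - b" and b = "b - c", OF nn] show ?thesis by simp
  qed
  have fin: "tnorm lam l (a - b) < \<infinity>" if "a \<in> Tl lam l" "b \<in> Tl lam l" for a b :: "'a tseries"
  proof -
    have 0: "c - (\<lambda>w. 0) = c" for c :: "'a tseries" by (auto simp: fun_eq_iff)
    have "tnorm lam l (a - b) \<le> tnorm lam l a + tnorm lam l b"
      using tri[where a = a and b = "\<lambda>w. 0" and c = b] by (simp add: 0 tnorm_sym[of lam l "\<lambda>w. 0" b])
    also have "\<dots> < \<infinity>" using that by (simp add: Tl_def)
    finally show ?thesis .
  qed
  show "0 \<le> tdist lam l a b" for a b :: "'a tseries" by (simp add: tdist_def)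
  show "tdist lam l a b = tdist lam l b a" for a b :: "'a tseries"
    by (simp add: tdist_def tnorm_sym[of lam l a b])
  show "tdist lam l a b = 0 \<longleftrightarrow> a = b" if "a \<in> Tl lam l" "b \<in> Tl lam l" for a b :: "'a tseries"
  proof
    assume "tdist lam l a b = 0"
    then have "tnorm lam l (a - b) = 0"
      using fin[OF that] by (auto simp: tdist_def enn2real_eq_0_iff)
    from tnorm_eq_0[OF assms this] show "a = b" by (auto simp: fun_eq_iff)
  qed (simp add: tdist_def tnorm_zero)
  show "tdist lam l a c \<le> tdist lam l a b + tdist lam l b c"
    if "a \<in> Tl lam l" "b \<in> Tl lam l" "c \<in> Tl lam l" for a b c :: "'a tseries"
  proof -
    have "enn2real (tnorm lam l (a - c)) \<le> enn2real (tnorm lam l (a - b) + tnorm lam l (b - c))"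
      using tri fin that by (intro enn2real_mono) auto
    then show ?thesis
      using fin that by (simp add: tdist_def enn2real_plus)
  qed
qed

end

theory Submission
  imports Defs
begin

text \<open>
  For fixed $\lambda$, letting $\alpha\to\infty$ in (ii) shows that $F^j$ takes values in level one
  and that $|F^j(\delta_r\mathbf b)|\le C(1+r)$ whenever $\|\mathbf b-\mathbf 1\|_{(p)}\le R$.
  Hence a solution is $S_t=S_0\otimes G_t$, where $G$ is the signature of the
  $\mathbb R^m$-valued path with velocity $v_j=F^j(S)$ relative to $x^j$, and the equation becomes
  the fixed point problem $v=F(S_0\otimes G^v)$ for continuous $v$.  The factorial decay of $G$
  costs a factor $e^{B\lambda_k}$ in $\|\cdot\|_{1,\lambda_k}$, which $\lambda_k=o(k^q)$ allows to
  absorb by an arbitrarily small increase of $l$.  The linear growth bound leaves a set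
  $\{|v(t)|\le Ce^{\kappa t}\}$ invariant; the corresponding $S_t$ lie in a set
  $\{|\mathbf a^{(n)}|\le b_n\}$ with $\sum_n b_n\mathbf e_n$ of finite norm, which is compact in
  $\mathcal T^{(p)}$, so that $F$ is globally Lipschitz on it.  Picard iteration in the norm
  $\sup_t e^{-\beta t}|v(t)|$ then gives existence, and the same contraction gives uniqueness and
  stability in $S_0$.
\<close>

section \<open>Riemann--Stieltjes integrals against Lipschitz paths\<close>

text \<open>The main obstacle is the loss of exponent: \<open>\<otimes>\<^sub>t\<close> sends a pair
  from one weighted space only into a space with larger \<open>l\<close>, so an iteration on
  \<open>S\<close> itself would lose a little at every step. The velocity is a finite family of real
  functions on [0,T], and each flow is rebuilt from the same initial datum; the loss therefore
  occurs once per evaluation and does not accumulate. This is why the estimates relate two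
  exponents, an input \<open>l\<close> strictly below \<open>p\<close> and an output
  \<open>p\<close> (or any larger \<open>l'\<close>), and why initial data lie in the intersection
  of all the spaces. The second obstacle is that local Lipschitz constants are not uniform on balls
  of an infinite dimensional space. Estimates are therefore stated for series majorized level by
  level by one fixed sequence \<open>s\<close>, with constants chosen from \<open>s\<close> and a
  velocity bound \<open>K\<close> before the series and velocities are named. Balls have no such
  majorant, so continuity in the initial datum has to be tested along sequences.\<close>

lemma stieltjes_primitive:
  fixes F g :: "real \<Rightarrow> real"
  assumes mono: "\<And>x y. x \<le> y \<Longrightarrow> F x \<le> F y" and F: "continuous_on UNIV F"
    and g: "continuous_on {a..b} g"
  obtains H where
    "\<And>s t c \<omega>. \<lbrakk>a \<le> s; s \<le> t; t \<le> b; \<And>r. r \<in> {s..t} \<Longrightarrow> \<bar>g r - c\<bar> \<le> \<omega>\<rbrakk>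
      \<Longrightarrow> \<bar>H t - H s - c * (F t - F s)\<bar> \<le> \<omega> * (F t - F s)"
proof -
  define M where "M = interval_measure F"
  have rc: "continuous (at_right x) F" for x
    using F by (auto simp: continuous_on_eq_continuous_within intro: continuous_within_subset)
  have em: "emeasure M {s<..t} = ennreal (F t - F s)" if "s \<le> t" for s t
    unfolding M_def by (rule emeasure_interval_measure_Ioc[OF that mono rc])
  have ms: "measure M {s<..t} = F t - F s" if "s \<le> t" for s t
    using em[OF that] mono[OF that] by (simp add: measure_def)
  have sets: "{s<..t} \<in> sets M" for s t by (simp add: M_def)
  \<comment> \<open>Extension by zero keeps \<open>h\<close> equal to \<open>g\<close> on [a,b] and
    makes it measurable on the whole line, where the measure lives.\<close>
  define h where "h = (\<lambda>r. if r \<in> {a..b} then g r else 0)"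
  have hm: "h \<in> borel_measurable M"
    unfolding h_def M_def using borel_measurable_continuous_on_if[OF _ g, of "\<lambda>_. 0"] by simp
  obtain B where B: "\<And>r. r \<in> {a..b} \<Longrightarrow> \<bar>g r\<bar> \<le> B"
    using compact_imp_bounded[OF compact_continuous_image[OF g compact_Icc]]
    by (metis bounded_iff imageI real_norm_def)
  have int: "set_integrable M {s<..t} h" if "a \<le> s" "t \<le> b" for s t
  proof (cases "s \<le> t")
    case True
    show ?thesis unfolding set_integrable_def
    proof (rule integrableI_bounded_set[where A = "{s<..t}" and B = B])
      show "AE x in M. x \<in> {s<..t} \<longrightarrow> norm (indicator {s<..t} x *\<^sub>R h x) \<le> B"
        using B that by (intro AE_I2) (auto simp: h_def)
    qed (use sets hm em[OF True] in auto)
  qed (simp add: set_integrable_def)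
  \<comment> \<open>Half-open intervals make the increments of \<open>H\<close> integrals over
    (s,t], a set of measure \<open>F t - F s\<close>. With c a value of \<open>g\<close>, the
    conclusion is the error of one Riemann-Stieltjes term.\<close>
  define H where "H t = (LINT r:{a<..t}|M. h r)" for t
  show thesis
  proof (rule that[of H])
    fix s t c \<omega>
    assume st: "a \<le> s" "s \<le> t" "t \<le> b" and c: "\<And>r. r \<in> {s..t} \<Longrightarrow> \<bar>g r - c\<bar> \<le> \<omega>"
    have "{a<..t} = {a<..s} \<union> {s<..t}" using st by auto
    then have "H t = H s + (LINT r:{s<..t}|M. h r)"
      unfolding H_def using st by (simp only:) (subst set_integral_Un, auto intro!: int)
    moreover have ci: "set_integrable M {s<..t} (\<lambda>r. k)" for k :: real
      using em[OF st(2)] sets by (simp add: set_integrable_def)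
    have "(LINT r:{s<..t}|M. c) = c * (F t - F s)" for c
      using ms[OF st(2)] em[OF st(2)] sets by (simp add: set_lebesgue_integral_def)
    note cst = this
    ultimately have "H t - H s - c * (F t - F s) = (LINT r:{s<..t}|M. h r - c)"
      using int ci st by (subst set_integral_diff) auto
    also have "\<bar>\<dots>\<bar> \<le> (LINT r:{s<..t}|M. \<omega>)"
    proof -
      have "norm (LINT r:{s<..t}|M. h r - c) \<le> (LINT r:{s<..t}|M. norm (h r - c))"
        by (rule set_integral_norm_bound) (use int ci st in \<open>auto intro!: set_integral_diff\<close>)
      also have "\<dots> \<le> (LINT r:{s<..t}|M. \<omega>)"
        using c st int ci
        by (intro set_integral_mono set_integrable_norm set_integral_diff) (auto simp: h_def)
      finally show ?thesis by simp
    qed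
    also have "\<dots> = \<omega> * (F t - F s)" by (rule cst)
    finally show "\<bar>H t - H s - c * (F t - F s)\<bar> \<le> \<omega> * (F t - F s)" .
  qed
qed

text \<open>A Lipschitz function is the difference of the nondecreasing functions y(t) + L t and L
  t, so the monotone case applies twice. The two errors are at most \<omega> times 2 L (t - s) and
  \<omega> times L (t - s), hence the factor 3.\<close>

lemma lipschitz_stieltjes_primitive:
  fixes y g :: "real \<Rightarrow> real"
  assumes y: "L-lipschitz_on {a..b} y" and g: "continuous_on {a..b} g"
  obtains H where
    "\<And>s t c \<omega>. \<lbrakk>a \<le> s; s \<le> t; t \<le> b; \<And>r. r \<in> {s..t} \<Longrightarrow> \<bar>g r - c\<bar> \<le> \<omega>\<rbrakk>
      \<Longrightarrow> \<bar>H t - H s - c * (y t - y s)\<bar> \<le> \<omega> * (3 * L * (t - s))"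
proof (cases "a \<le> b")
  case True
  \<comment> \<open>Clamping the argument gives a function that is Lipschitz on the whole line, as
    the monotone case demands.\<close>
  define z where "z t = y (max a (min b t))" for t
  have L: "L \<ge> 0" using y by (rule lipschitz_on_nonneg)
  have zl: "\<bar>z t - z s\<bar> \<le> L * \<bar>t - s\<bar>" for s t
  proof -
    have "\<bar>z t - z s\<bar> \<le> L * \<bar>max a (min b t) - max a (min b s)\<bar>"
      using lipschitz_onD[OF y, of "max a (min b t)" "max a (min b s)"] True
      by (auto simp: z_def dist_real_def)
    also have "\<dots> \<le> L * \<bar>t - s\<bar>"
      by (intro mult_left_mono L) linarith
    finally show ?thesis .
  qed
  have "L-lipschitz_on UNIV z"
    using zl L by (intro lipschitz_onI) (auto simp: dist_real_def)
  then have zc: "continuous_on UNIV z"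
    by (rule lipschitz_on_continuous_on)
  have mono1: "z s + L * s \<le> z t + L * t" if "s \<le> t" for s t
    using zl[of s t] that by (simp add: abs_le_iff algebra_simps)
  have mono2: "L * s \<le> L * t" if "s \<le> t" for s t
    using that L by (rule mult_left_mono)
  obtain H1 where H1: "\<And>s t c \<omega>. \<lbrakk>a \<le> s; s \<le> t; t \<le> b; \<And>r. r \<in> {s..t} \<Longrightarrow> \<bar>g r - c\<bar> \<le> \<omega>\<rbrakk>
      \<Longrightarrow> \<bar>H1 t - H1 s - c * ((z t + L * t) - (z s + L * s))\<bar> \<le> \<omega> * ((z t + L * t) - (z s + L * s))"
    by (rule stieltjes_primitive[of "\<lambda>t. z t + L * t" a b g, OF mono1 _ g])
      (auto intro!: continuous_intros zc)
  obtain H2 where H2: "\<And>s t c \<omega>. \<lbrakk>a \<le> s; s \<le> t; t \<le> b; \<And>r. r \<in> {s..t} \<Longrightarrow> \<bar>g r - c\<bar> \<le> \<omega>\<rbrakk>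
      \<Longrightarrow> \<bar>H2 t - H2 s - c * (L * t - L * s)\<bar> \<le> \<omega> * (L * t - L * s)"
    by (rule stieltjes_primitive[of "\<lambda>t. L * t" a b g, OF mono2 _ g])
      (auto intro!: continuous_intros)
  show thesis
  proof (rule that[of "\<lambda>t. H1 t - H2 t"])
    fix s t c \<omega>
    assume st: "a \<le> s" "s \<le> t" "t \<le> b" and c: "\<And>r. r \<in> {s..t} \<Longrightarrow> \<bar>g r - c\<bar> \<le> \<omega>"
    have zy: "z t = y t" "z s = y s" using st by (auto simp: z_def)
    have "0 \<le> \<omega>" using c[of s] st by auto
    have "z t - z s \<le> L * (t - s)" using zl[of t s] st by (simp add: abs_le_iff)
    then have "\<omega> * (z t - z s) \<le> \<omega> * (L * (t - s))" using \<open>0 \<le> \<omega>\<close> by (rule mult_left_mono)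
    then show "\<bar>(H1 t - H2 t) - (H1 s - H2 s) - c * (y t - y s)\<bar> \<le> \<omega> * (3 * L * (t - s))"
      using H1[OF st c] H2[OF st c] unfolding zy by (simp add: algebra_simps abs_le_iff)
  qed
qed (use that in auto)

section \<open>Existence, uniqueness and linearity of the Riemann-Stieltjes integral\<close>

lemma has_RS_integralE:
  assumes "has_RS_integral f y a b I" "e > 0"
  obtains d where "d > 0"
    "\<And>p. \<lbrakk>p tagged_division_of {a..b}; \<And>u K. (u, K) \<in> p \<Longrightarrow> Sup K - Inf K < d\<rbrakk> \<Longrightarrow>
        \<bar>(\<Sum>(u, K)\<in>p. f u * (y (Sup K) - y (Inf K))) - I\<bar> < e"
proof -
  from assms obtain d where "d > 0" and
    d: "\<forall>p. p tagged_division_of {a..b} \<and> (\<forall>(u, K)\<in>p. Sup K - Inf K < d) \<longrightarrow>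
        \<bar>(\<Sum>(u, K)\<in>p. f u * (y (Sup K) - y (Inf K))) - I\<bar> < e"
    unfolding has_RS_integral_def by blast
  show thesis
    by (rule that[OF \<open>d > 0\<close>], rule d[rule_format]) auto
qed

lemma has_RS_integralI:
  assumes "\<And>e. e > 0 \<Longrightarrow> \<exists>d>0. \<forall>p. p tagged_division_of {a..b} \<longrightarrow>
      (\<forall>u K. (u, K) \<in> p \<longrightarrow> Sup K - Inf K < d) \<longrightarrow>
      \<bar>(\<Sum>(u, K)\<in>p. f u * (y (Sup K) - y (Inf K))) - I\<bar> < e"
  shows "has_RS_integral f y a b I"
  unfolding has_RS_integral_def
proof (intro allI impI)
  fix e :: real assume "e > 0"
  from assms[OF this] obtain d where "d > 0" and d: "\<forall>p. p tagged_division_of {a..b} \<longrightarrow>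
      (\<forall>u K. (u, K) \<in> p \<longrightarrow> Sup K - Inf K < d) \<longrightarrow>
      \<bar>(\<Sum>(u, K)\<in>p. f u * (y (Sup K) - y (Inf K))) - I\<bar> < e" by blast
  then show "\<exists>\<delta>>0. \<forall>p. p tagged_division_of {a..b} \<and> (\<forall>(u, K)\<in>p. Sup K - Inf K < \<delta>) \<longrightarrow>
      \<bar>(\<Sum>(u, K)\<in>p. f u * (y (Sup K) - y (Inf K))) - I\<bar> < e"
    by (intro exI[of _ d]) auto
qed

text \<open>Over a tagged division the increments of \<open>H\<close> telescope, and once the mesh
  is below the modulus of continuity of \<open>g\<close> each term differs from its increment by at
  most 3 L \<omega> times the interval length. One \<open>H\<close> serves all subintervals, so
  additivity in the interval is built in.\<close>

lemma lipschitz_RS_primitive: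
  fixes y g :: "real \<Rightarrow> real"
  assumes y: "L-lipschitz_on {a..b} y" and g: "continuous_on {a..b} g"
  obtains H where "\<And>s t. \<lbrakk>a \<le> s; s \<le> t; t \<le> b\<rbrakk> \<Longrightarrow> has_RS_integral g y s t (H t - H s)"
proof -
  obtain H where H:
    "\<And>s t c \<omega>. \<lbrakk>a \<le> s; s \<le> t; t \<le> b; \<And>r. r \<in> {s..t} \<Longrightarrow> \<bar>g r - c\<bar> \<le> \<omega>\<rbrakk>
      \<Longrightarrow> \<bar>H t - H s - c * (y t - y s)\<bar> \<le> \<omega> * (3 * L * (t - s))"
    using lipschitz_stieltjes_primitive[OF assms] by blast
  have L: "L \<ge> 0" using y by (rule lipschitz_on_nonneg)
  show thesis
  proof (rule that[of H])
    fix s t assume st: "a \<le> s" "s \<le> t" "t \<le> b"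
    show "has_RS_integral g y s t (H t - H s)"
    proof (rule has_RS_integralI)
      fix e :: real assume e: "e > 0"
      \<comment> \<open>\<omega> K will be the total error; the summand 1 in the choice of \<omega>
        avoids a zero denominator and makes the final bound strict.\<close>
      define K where "K = 3 * L * (t - s)"
      have K: "K \<ge> 0" using L st by (simp add: K_def)
      define \<omega> where "\<omega> = e / (K + 1)"
      have \<omega>: "\<omega> > 0" "\<omega> * K < e" using e K by (auto simp: \<omega>_def field_simps)
      obtain \<delta> where \<delta>: "\<delta> > 0"
        "\<And>r u. r \<in> {a..b} \<Longrightarrow> u \<in> {a..b} \<Longrightarrow> dist u r < \<delta> \<Longrightarrow> dist (g u) (g r) < \<omega>"
        using compact_uniformly_continuous[OF g compact_Icc] \<omega>(1)
        unfolding uniformly_continuous_on_def by metis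
      show "\<exists>\<delta>>0. \<forall>p. p tagged_division_of {s..t} \<longrightarrow>
          (\<forall>u K. (u, K) \<in> p \<longrightarrow> Sup K - Inf K < \<delta>) \<longrightarrow>
          \<bar>(\<Sum>(u, K)\<in>p. g u * (y (Sup K) - y (Inf K))) - (H t - H s)\<bar> < e"
      proof (intro exI[of _ \<delta>] conjI allI impI \<delta>(1))
        fix p assume p: "p tagged_division_of {s..t}" "\<forall>u K. (u, K) \<in> p \<longrightarrow> Sup K - Inf K < \<delta>"
        have fin: "finite p" using p by auto
        have each: "\<bar>g u * (y (Sup k) - y (Inf k)) - (H (Sup k) - H (Inf k))\<bar>
            \<le> \<omega> * (3 * L) * (Sup k - Inf k)" if uk: "(u, k) \<in> p" for u k
        proof -
          obtain c d where k: "k = cbox c d" and "u \<in> k" "k \<subseteq> {s..t}"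
            using tagged_division_ofD(2,3,4)[OF p(1) uk] by blast
          then have cd: "c \<le> u" "u \<le> d" "s \<le> c" "d \<le> t" by auto
          then have SI: "Sup k = d" "Inf k = c" by (auto simp: k)
          have "d - c < \<delta>" using p uk SI by auto
          then have "\<bar>g r - g u\<bar> \<le> \<omega>" if "r \<in> {c..d}" for r
            using that \<delta>(2)[of u r] cd st by (force simp: dist_real_def)
          then have "\<bar>H d - H c - g u * (y d - y c)\<bar> \<le> \<omega> * (3 * L * (d - c))"
            using cd st by (intro H) auto
          then show ?thesis by (simp add: SI algebra_simps abs_minus_commute)
        qed
        have "(\<Sum>(u, k)\<in>p. H (Sup k) - H (Inf k)) = H t - H s"
          using p st by (intro additive_tagged_division_1) auto
        then have "\<bar>(\<Sum>(u, k)\<in>p. g u * (y (Sup k) - y (Inf k))) - (H t - H s)\<bar>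
            = \<bar>\<Sum>(u, k)\<in>p. g u * (y (Sup k) - y (Inf k)) - (H (Sup k) - H (Inf k))\<bar>"
          by (simp add: sum_subtractf case_prod_unfold)
        also have "\<dots> \<le> (\<Sum>(u, k)\<in>p. \<omega> * (3 * L) * (Sup k - Inf k))"
          using each by (intro order_trans[OF sum_abs] sum_mono) auto
        also have "\<dots> = \<omega> * (3 * L) * (\<Sum>(u, k)\<in>p. Sup k - Inf k)"
          by (simp add: sum_distrib_left case_prod_unfold)
        also have "(\<Sum>(u, k)\<in>p. Sup k - Inf k) = t - s"
          using p st additive_tagged_division_1[of s t p "\<lambda>x. x"] by auto
        also have "\<omega> * (3 * L) * (t - s) = \<omega> * K" by (simp add: K_def)
        finally show "\<bar>(\<Sum>(u, k)\<in>p. g u * (y (Sup k) - y (Inf k))) - (H t - H s)\<bar> < e"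
          using \<omega> by linarith
      qed
    qed
  qed
qed

text \<open>Intersecting the gauge with balls of radius \<delta>/3 keeps every interval shorter than
  \<delta>. The double fineness lets a Riemann-Stieltjes sum and a gauge integral sum be compared on
  one division, and it shows that the quantifier over divisions in \<open>has_RS_integral\<close> is
  not vacuous, which uniqueness needs.\<close>

lemma tagged_division_mesh_exists:
  fixes a b \<delta> :: real
  assumes "\<delta> > 0" "gauge G"
  obtains p where "p tagged_division_of {a..b}" "G fine p" "\<And>u k. (u, k) \<in> p \<Longrightarrow> Sup k - Inf k < \<delta>"
proof -
  have "gauge (\<lambda>x. G x \<inter> ball x (\<delta> / 3))"
    using assms by (intro gauge_Int) (auto simp: gauge_def)
  from fine_division_exists_real[OF this] obtain p where
    p: "p tagged_division_of {a..b}" "(\<lambda>x. G x \<inter> ball x (\<delta> / 3)) fine p" by blast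
  show thesis
  proof (rule that[OF p(1)])
    show "G fine p" using p(2) by (auto simp: fine_def)
    fix u k assume uk: "(u, k) \<in> p"
    obtain c d where k: "k = cbox c d" and "u \<in> k"
      using tagged_division_ofD(2,4)[OF p(1) uk] by blast
    moreover have "k \<subseteq> ball u (\<delta> / 3)" using p(2) uk by (auto simp: fine_def)
    ultimately have "c \<le> d" "c \<in> ball u (\<delta> / 3)" "d \<in> ball u (\<delta> / 3)"
      by (auto simp del: mem_ball)
    then show "Sup k - Inf k < \<delta>"
      by (auto simp: k dist_real_def abs_if split: if_splits)
  qed
qed

lemma has_RS_integral_unique:
  assumes I: "has_RS_integral f y a b I" and J: "has_RS_integral f y a b J"
  shows "I = J"
proof (rule ccontr)
  assume "I \<noteq> J"
  then have e: "\<bar>I - J\<bar> / 2 > 0" by simp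
  obtain d1 where d1: "d1 > 0" "\<And>p. \<lbrakk>p tagged_division_of {a..b}; \<And>u K. (u, K) \<in> p \<Longrightarrow> Sup K - Inf K < d1\<rbrakk> \<Longrightarrow>
        \<bar>(\<Sum>(u, K)\<in>p. f u * (y (Sup K) - y (Inf K))) - I\<bar> < \<bar>I - J\<bar> / 2"
    using has_RS_integralE[OF I e] by blast
  obtain d2 where d2: "d2 > 0" "\<And>p. \<lbrakk>p tagged_division_of {a..b}; \<And>u K. (u, K) \<in> p \<Longrightarrow> Sup K - Inf K < d2\<rbrakk> \<Longrightarrow>
        \<bar>(\<Sum>(u, K)\<in>p. f u * (y (Sup K) - y (Inf K))) - J\<bar> < \<bar>I - J\<bar> / 2"
    using has_RS_integralE[OF J e] by blast
  have "min d1 d2 > 0" using d1(1) d2(1) by simp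
  then obtain p where p: "p tagged_division_of {a..b}" "\<And>u k. (u, k) \<in> p \<Longrightarrow> Sup k - Inf k < min d1 d2"
    using tagged_division_mesh_exists[OF _ gauge_ball[of 1]] by (metis zero_less_one)
  have "\<bar>(\<Sum>(u, K)\<in>p. f u * (y (Sup K) - y (Inf K))) - I\<bar> < \<bar>I - J\<bar> / 2"
    by (rule d1(2)[OF p(1)]) (use p(2) in force)
  moreover have "\<bar>(\<Sum>(u, K)\<in>p. f u * (y (Sup K) - y (Inf K))) - J\<bar> < \<bar>I - J\<bar> / 2"
    by (rule d2(2)[OF p(1)]) (use p(2) in force)
  moreover have False if "\<bar>X - I\<bar> < \<bar>I - J\<bar> / 2" "\<bar>X - J\<bar> < \<bar>I - J\<bar> / 2" for X
    using that by (auto simp: abs_if split: if_splits)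
  ultimately show False by blast
qed

lemma has_RS_integral_cong:
  assumes I: "has_RS_integral f y a b I" and fg: "\<And>u. u \<in> {a..b} \<Longrightarrow> f u = g u"
  shows "has_RS_integral g y a b I"
proof (rule has_RS_integralI)
  fix e :: real assume "e > 0"
  obtain d where d: "d > 0" "\<And>p. \<lbrakk>p tagged_division_of {a..b}; \<And>u K. (u, K) \<in> p \<Longrightarrow> Sup K - Inf K < d\<rbrakk> \<Longrightarrow>
        \<bar>(\<Sum>(u, K)\<in>p. f u * (y (Sup K) - y (Inf K))) - I\<bar> < e"
    using has_RS_integralE[OF I \<open>e > 0\<close>] by blast
  have eq: "(\<Sum>(u, K)\<in>p. f u * (y (Sup K) - y (Inf K))) = (\<Sum>(u, K)\<in>p. g u * (y (Sup K) - y (Inf K)))"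
    if p: "p tagged_division_of {a..b}" for p
  proof (intro sum.cong refl, clarify)
    fix u k assume "(u, k) \<in> p"
    then have "u \<in> {a..b}" using tagged_division_ofD(2,3)[OF p] by blast
    then show "f u * (y (Sup k) - y (Inf k)) = g u * (y (Sup k) - y (Inf k))"
      using fg by simp
  qed
  show "\<exists>d>0. \<forall>p. p tagged_division_of {a..b} \<longrightarrow>
      (\<forall>u K. (u, K) \<in> p \<longrightarrow> Sup K - Inf K < d) \<longrightarrow>
      \<bar>(\<Sum>(u, K)\<in>p. g u * (y (Sup K) - y (Inf K))) - I\<bar> < e"
    using d by (intro exI[of _ d]) (simp add: eq[symmetric])
qed

lemma has_RS_integral_add:
  assumes I: "has_RS_integral f y a b I" and J: "has_RS_integral g y a b J"
  shows "has_RS_integral (\<lambda>u. f u + g u) y a b (I + J)"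
proof (rule has_RS_integralI)
  fix e :: real assume "e > 0"
  then have e: "e / 2 > 0" by simp
  obtain d1 where d1: "d1 > 0" "\<And>p. \<lbrakk>p tagged_division_of {a..b}; \<And>u K. (u, K) \<in> p \<Longrightarrow> Sup K - Inf K < d1\<rbrakk> \<Longrightarrow>
        \<bar>(\<Sum>(u, K)\<in>p. f u * (y (Sup K) - y (Inf K))) - I\<bar> < e / 2"
    using has_RS_integralE[OF I e] by blast
  obtain d2 where d2: "d2 > 0" "\<And>p. \<lbrakk>p tagged_division_of {a..b}; \<And>u K. (u, K) \<in> p \<Longrightarrow> Sup K - Inf K < d2\<rbrakk> \<Longrightarrow>
        \<bar>(\<Sum>(u, K)\<in>p. g u * (y (Sup K) - y (Inf K))) - J\<bar> < e / 2"
    using has_RS_integralE[OF J e] by blast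
  show "\<exists>d>0. \<forall>p. p tagged_division_of {a..b} \<longrightarrow>
      (\<forall>u K. (u, K) \<in> p \<longrightarrow> Sup K - Inf K < d) \<longrightarrow>
      \<bar>(\<Sum>(u, K)\<in>p. (f u + g u) * (y (Sup K) - y (Inf K))) - (I + J)\<bar> < e"
  proof (intro exI[of _ "min d1 d2"] conjI allI impI)
    fix p assume p: "p tagged_division_of {a..b}" "\<forall>u K. (u, K) \<in> p \<longrightarrow> Sup K - Inf K < min d1 d2"
    have "\<bar>(\<Sum>(u, K)\<in>p. f u * (y (Sup K) - y (Inf K))) - I\<bar> < e / 2"
      by (rule d1(2)[OF p(1)]) (use p(2) in force)
    moreover have "\<bar>(\<Sum>(u, K)\<in>p. g u * (y (Sup K) - y (Inf K))) - J\<bar> < e / 2"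
      by (rule d2(2)[OF p(1)]) (use p(2) in force)
    moreover have "(\<Sum>(u, K)\<in>p. (f u + g u) * (y (Sup K) - y (Inf K))) =
       (\<Sum>(u, K)\<in>p. f u * (y (Sup K) - y (Inf K))) + (\<Sum>(u, K)\<in>p. g u * (y (Sup K) - y (Inf K)))"
      by (simp add: distrib_right sum.distrib case_prod_unfold)
    ultimately show "\<bar>(\<Sum>(u, K)\<in>p. (f u + g u) * (y (Sup K) - y (Inf K))) - (I + J)\<bar> < e"
      by linarith
  qed (use d1 d2 in auto)
qed

lemma has_RS_integral_zero: "has_RS_integral (\<lambda>_. 0) y a b 0"
  by (rule has_RS_integralI) (auto simp: case_prod_unfold intro: exI[of _ 1])

lemma has_RS_integral_cmult:
  assumes I: "has_RS_integral f y a b I"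
  shows "has_RS_integral (\<lambda>u. c * f u) y a b (c * I)"
proof (cases "c = 0")
  case False
  show ?thesis
  proof (rule has_RS_integralI)
    fix e :: real assume "e > 0"
    then have e: "e / \<bar>c\<bar> > 0" using False by simp
    obtain d where d: "d > 0" "\<And>p. \<lbrakk>p tagged_division_of {a..b}; \<And>u K. (u, K) \<in> p \<Longrightarrow> Sup K - Inf K < d\<rbrakk> \<Longrightarrow>
        \<bar>(\<Sum>(u, K)\<in>p. f u * (y (Sup K) - y (Inf K))) - I\<bar> < e / \<bar>c\<bar>"
      using has_RS_integralE[OF I e] by blast
    show "\<exists>d>0. \<forall>p. p tagged_division_of {a..b} \<longrightarrow>
      (\<forall>u K. (u, K) \<in> p \<longrightarrow> Sup K - Inf K < d) \<longrightarrow>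
      \<bar>(\<Sum>(u, K)\<in>p. c * f u * (y (Sup K) - y (Inf K))) - c * I\<bar> < e"
    proof (intro exI[of _ d] conjI allI impI d(1))
      fix p assume p: "p tagged_division_of {a..b}" "\<forall>u K. (u, K) \<in> p \<longrightarrow> Sup K - Inf K < d"
      have "(\<Sum>(u, K)\<in>p. c * f u * (y (Sup K) - y (Inf K))) - c * I =
         c * ((\<Sum>(u, K)\<in>p. f u * (y (Sup K) - y (Inf K))) - I)"
        by (simp add: right_diff_distrib sum_distrib_left case_prod_unfold mult.assoc)
      moreover have "\<bar>(\<Sum>(u, K)\<in>p. f u * (y (Sup K) - y (Inf K))) - I\<bar> < e / \<bar>c\<bar>"
        by (rule d(2)[OF p(1)]) (use p(2) in blast)
      ultimately show "\<bar>(\<Sum>(u, K)\<in>p. c * f u * (y (Sup K) - y (Inf K))) - c * I\<bar> < e"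
        using False by (simp only:) (simp add: abs_mult pos_less_divide_eq mult.commute)
    qed
  qed
qed (simp add: has_RS_integral_zero)

lemma has_RS_integral_sum:
  assumes "finite A" "\<And>i. i \<in> A \<Longrightarrow> has_RS_integral (f i) y a b (I i)"
  shows "has_RS_integral (\<lambda>u. \<Sum>i\<in>A. f i u) y a b (\<Sum>i\<in>A. I i)"
  using assms by (induction A rule: finite_induct) (auto intro: has_RS_integral_zero has_RS_integral_add)

text \<open>On a division that is fine for both integrals, |y(e) - y(c)| <= L (e - c) compares the
  sums term by term. The majorant is an ordinary integral, so explicit antiderivatives can bound
  Riemann-Stieltjes integrals.\<close>

lemma has_RS_integral_bound:
  assumes "has_RS_integral f y a b I" and y: "L-lipschitz_on {a..b} y"
    and h: "(h has_integral J) {a..b}" and fh: "\<And>u. u \<in> {a..b} \<Longrightarrow> L * \<bar>f u\<bar> \<le> h u"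
  shows "\<bar>I\<bar> \<le> J"
proof (rule field_le_epsilon)
  fix e :: real assume "e > 0"
  then have e: "e / 2 > 0" by simp
  obtain d where d: "d > 0" "\<And>p. \<lbrakk>p tagged_division_of {a..b}; \<And>u K. (u, K) \<in> p \<Longrightarrow> Sup K - Inf K < d\<rbrakk> \<Longrightarrow>
        \<bar>(\<Sum>(u, K)\<in>p. f u * (y (Sup K) - y (Inf K))) - I\<bar> < e / 2"
    using has_RS_integralE[OF assms(1) e] by blast
  obtain G where G: "gauge G" "\<And>p. p tagged_division_of {a..b} \<and> G fine p \<Longrightarrow>
        norm ((\<Sum>(x, k)\<in>p. measure lborel k *\<^sub>R h x) - J) < e / 2"
    using has_integral_real[THEN iffD1, OF h, rule_format, OF e] by blast
  obtain p where p: "p tagged_division_of {a..b}" "G fine p" "\<And>u k. (u, k) \<in> p \<Longrightarrow> Sup k - Inf k < d"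
    using tagged_division_mesh_exists[OF d(1) G(1), of a b] by blast
  have "\<bar>\<Sum>(u, K)\<in>p. f u * (y (Sup K) - y (Inf K))\<bar> \<le> (\<Sum>(u, k)\<in>p. measure lborel k *\<^sub>R h u)"
  proof (intro order_trans[OF sum_abs] sum_mono, clarsimp)
    fix u k assume uk: "(u, k) \<in> p"
    obtain c e where k: "k = cbox c e" and "u \<in> k" "k \<subseteq> {a..b}"
      using tagged_division_ofD(2,3,4)[OF p(1) uk] by blast
    then have ce: "c \<le> u" "u \<le> e" "a \<le> c" "e \<le> b" by auto
    then have "\<bar>y e - y c\<bar> \<le> L * (e - c)"
      using lipschitz_onD[OF y, of e c] by (simp add: dist_real_def)
    then have "\<bar>f u\<bar> * \<bar>y e - y c\<bar> \<le> \<bar>f u\<bar> * (L * (e - c))" by (rule mult_left_mono) simp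
    also have "\<dots> \<le> h u * (e - c)"
      using mult_right_mono[OF fh[of u], of "e - c"] ce by (simp add: algebra_simps)
    finally show "\<bar>f u * (y (Sup k) - y (Inf k))\<bar> \<le> measure lborel k * h u"
      using ce by (simp add: k abs_mult mult.commute)
  qed
  moreover have "\<bar>(\<Sum>(u, K)\<in>p. f u * (y (Sup K) - y (Inf K))) - I\<bar> < e / 2"
    by (rule d(2)[OF p(1)]) (use p(3) in blast)
  moreover have "\<bar>(\<Sum>(x, k)\<in>p. measure lborel k *\<^sub>R h x) - J\<bar> < e / 2"
    using G(2)[of p] p(1,2) by simp
  moreover have "\<bar>I\<bar> \<le> J + e" if "\<bar>X\<bar> \<le> Y" "\<bar>X - I\<bar> < e / 2" "\<bar>Y - J\<bar> < e / 2" for X Y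
    using that by (auto simp: abs_if split: if_splits)
  ultimately show "\<bar>I\<bar> \<le> J + e" by blast
qed

section \<open>Weighted level norms and tensor products\<close>

text \<open>The norm \<open>tnorm\<close> sees only the sequence of level norms. Stating it for real
  sequences allows majorants, which need not come from a series, to be measured in the same
  way.\<close>

definition seqnorm :: "(nat \<Rightarrow> real) \<Rightarrow> real \<Rightarrow> (nat \<Rightarrow> real) \<Rightarrow> ennreal" where
  "seqnorm lam l s =
     (\<Sum>k. ennreal (exp (- (real k powr l))) * (\<Sum>n. ennreal (lam k ^ n * s n))) / Zl l"

lemma tnorm_eq_seqnorm: "tnorm lam l a = seqnorm lam l (level_norm a)"
  by (simp add: tnorm_def seqnorm_def norm1w_def)

lemma level_norm_nonneg [simp]: "0 \<le> level_norm a n"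
  by (simp add: level_norm_def sum_nonneg)

lemma level_norm_ge_coord: "\<bar>a w\<bar> \<le> level_norm a (length w)"
proof -
  have "(a w)\<^sup>2 \<le> (\<Sum>v | length v = length w. (a v)\<^sup>2)"
    by (rule member_le_sum) (auto simp: finite_words)
  then show ?thesis
    unfolding level_norm_def by (metis real_sqrt_abs real_sqrt_le_iff)
qed

lemma seqnorm_mono:
  assumes "\<And>k. 0 \<le> lam k" "\<And>n. s n \<le> t n"
  shows "seqnorm lam l s \<le> seqnorm lam l t"
  unfolding seqnorm_def using assms
  by (intro divide_right_mono_ennreal suminf_le mult_left_mono ennreal_leI) auto

lemma tnorm_mono:
  assumes "\<And>k. 0 \<le> lam k" "\<And>n. level_norm a n \<le> level_norm b n"
  shows "tnorm lam l a \<le> tnorm lam l b"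
  unfolding tnorm_eq_seqnorm by (rule seqnorm_mono[OF assms])

lemma Zl_times_seqnorm:
  assumes "l > 1"
  shows "Zl l * seqnorm lam l s = (\<Sum>k. ennreal (exp (- (real k powr l))) * (\<Sum>n. ennreal (lam k ^ n * s n)))"
  using Zl_pos[of l] Zl_finite[OF assms]
  by (simp add: seqnorm_def ennreal_times_divide mult_divide_eq_ennreal[of "Zl l"] mult.commute[of "Zl l"])

lemma seqnorm_coord:
  assumes "l > 1"
  shows "ennreal (lam 0 ^ n * s n) \<le> Zl l * seqnorm lam l s"
proof -
  have "ennreal (lam 0 ^ n * s n) \<le> (\<Sum>n. ennreal (lam 0 ^ n * s n))"
    using sum_le_suminf[of "\<lambda>n. ennreal (lam 0 ^ n * s n)" "{n}"] by simp
  also have "\<dots> \<le> (\<Sum>k. ennreal (exp (- (real k powr l))) * (\<Sum>n. ennreal (lam k ^ n * s n)))"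
    using sum_le_suminf[of "\<lambda>k. ennreal (exp (- (real k powr l))) * (\<Sum>n. ennreal (lam k ^ n * s n))" "{0}"]
    by simp
  finally show ?thesis by (simp add: Zl_times_seqnorm[OF assms])
qed

definition conv :: "(nat \<Rightarrow> real) \<Rightarrow> (nat \<Rightarrow> real) \<Rightarrow> nat \<Rightarrow> real" where
  "conv s t n = (\<Sum>i\<le>n. s i * t (n - i))"

lemma conv_mono:
  assumes "\<And>n. 0 \<le> s n" "\<And>n. 0 \<le> t n" "\<And>n. s n \<le> s' n" "\<And>n. t n \<le> t' n"
  shows "conv s t n \<le> conv s' t' n"
  unfolding conv_def by (intro sum_mono mult_mono assms order_trans[OF assms(1,3)])

text \<open>The partial sums on the left run over the triangle i + j < N, which lies inside the
  square of side N; all terms are nonnegative.\<close>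

lemma suminf_conv_le:
  assumes s: "\<And>n. 0 \<le> s n" and t: "\<And>n. 0 \<le> t n" and r: "0 \<le> r"
  shows "(\<Sum>n. ennreal (r ^ n * conv s t n)) \<le> (\<Sum>n. ennreal (r ^ n * s n)) * (\<Sum>n. ennreal (r ^ n * t n))"
proof (rule suminf_le_const)
  fix N
  define f where "f n = r ^ n * s n" for n
  define g where "g n = r ^ n * t n" for n
  have f: "0 \<le> f n" and g: "0 \<le> g n" for n using s t r by (auto simp: f_def g_def)
  have fg: "r ^ n * conv s t n = (\<Sum>i\<le>n. f i * g (n - i))" for n
    unfolding conv_def sum_distrib_left
  proof (intro sum.cong refl)
    fix i assume "i \<in> {..n}"
    then have "r ^ n = r ^ i * r ^ (n - i)" by (simp flip: power_add)
    then show "r ^ n * (s i * t (n - i)) = f i * g (n - i)" by (simp add: f_def g_def)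
  qed
  have "(\<Sum>n<N. ennreal (r ^ n * conv s t n)) = ennreal (\<Sum>n<N. \<Sum>i\<le>n. f i * g (n - i))"
    unfolding fg by (intro sum_ennreal sum_nonneg mult_nonneg_nonneg f g)
  also have "(\<Sum>n<N. \<Sum>i\<le>n. f i * g (n - i)) = (\<Sum>(i, j)\<in>{(i, j). i + j < N}. f i * g j)"
    by (rule sum.triangle_reindex[symmetric])
  also have "\<dots> \<le> (\<Sum>(i, j)\<in>{..<N} \<times> {..<N}. f i * g j)"
    using f g by (intro sum_mono2) auto
  also have "\<dots> = (\<Sum>i<N. f i) * (\<Sum>j<N. g j)"
    by (simp add: sum_product sum.cartesian_product)
  also have "ennreal \<dots> = (\<Sum>i<N. ennreal (f i)) * (\<Sum>j<N. ennreal (g j))"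
    using f g by (simp add: ennreal_mult sum_nonneg)
  also have "\<dots> \<le> (\<Sum>n. ennreal (f n)) * (\<Sum>n. ennreal (g n))"
    by (intro mult_mono sum_le_suminf) auto
  finally show "(\<Sum>n<N. ennreal (r ^ n * conv s t n))
      \<le> (\<Sum>n. ennreal (r ^ n * s n)) * (\<Sum>n. ennreal (r ^ n * t n))"
    by (simp add: f_def g_def ennreal_leI)
qed simp

lemma sum_words_split:
  fixes f g :: "'m::finite list \<Rightarrow> real"
  assumes "i \<le> n"
  shows "(\<Sum>w | length w = n. f (take i w) * g (drop i w)) =
    (\<Sum>u | length u = i. f u) * (\<Sum>v | length v = n - i. g v)"
  unfolding sum_product sum.cartesian_product
  by (rule sum.reindex_bij_witness[where i = "\<lambda>(u, v). u @ v" and j = "\<lambda>w. (take i w, drop i w)"])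
    (use assms in auto)

lemma L2_set_sum_le:
  assumes "finite I"
  shows "L2_set (\<lambda>x. \<Sum>i\<in>I. f i x) A \<le> (\<Sum>i\<in>I. L2_set (f i) A)"
  using assms
proof (induction I rule: finite_induct)
  case (insert i I)
  then show ?case
    using L2_set_triangle_ineq[of "f i" "\<lambda>x. \<Sum>i\<in>I. f i x" A] by simp
qed (simp add: L2_set_def)

text \<open>Cutting a word at position i is a bijection, so the Euclidean norm is multiplicative on
  a product of levels i and n - i; the triangle inequality over i gives the Cauchy product.\<close>

lemma level_norm_tprod:
  "level_norm (a \<otimes>\<^sub>t b) n \<le> conv (level_norm a) (level_norm b) n"
proof -
  let ?W = "{w :: 'a list. length w = n}"
  have "level_norm (a \<otimes>\<^sub>t b) n = L2_set (\<lambda>w. \<Sum>i\<le>n. a (take i w) * b (drop i w)) ?W"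
    unfolding level_norm_L2 by (intro L2_set_cong) (auto simp: tprod_def)
  also have "\<dots> \<le> (\<Sum>i\<le>n. L2_set (\<lambda>w. a (take i w) * b (drop i w)) ?W)"
    by (rule L2_set_sum_le) simp
  also have "\<dots> = conv (level_norm a) (level_norm b) n"
    unfolding conv_def
  proof (intro sum.cong refl)
    fix i assume "i \<in> {..n}"
    then have "(\<Sum>w\<in>?W. (a (take i w))\<^sup>2 * (b (drop i w))\<^sup>2) =
        (\<Sum>u | length u = i. (a u)\<^sup>2) * (\<Sum>v | length v = n - i. (b v)\<^sup>2)"
      using sum_words_split[of i n "\<lambda>u. (a u)\<^sup>2" "\<lambda>v. (b v)\<^sup>2"] by simp
    then show "L2_set (\<lambda>w. a (take i w) * b (drop i w)) ?W = level_norm a i * level_norm b (n - i)"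
      by (simp add: L2_set_def level_norm_def power_mult_distrib real_sqrt_mult)
  qed
  finally show ?thesis .
qed

text \<open>Taylor coefficients of c exp(Q z), the shape of all signature bounds: a word of length n
  stands for an iterated integral over a simplex, which brings the factor 1/n!.\<close>

definition expseq :: "real \<Rightarrow> real \<Rightarrow> nat \<Rightarrow> real" where
  "expseq c Q n = c * (Q ^ n / fact n)"

lemma expseq_nonneg: "0 \<le> c \<Longrightarrow> 0 \<le> Q \<Longrightarrow> 0 \<le> expseq c Q n"
  by (simp add: expseq_def)

lemma suminf_expseq:
  assumes "0 \<le> c" "0 \<le> Q" "0 \<le> r"
  shows "(\<Sum>n. ennreal (r ^ n * expseq c Q n)) = ennreal (c * exp (Q * r))"
proof (rule suminf_ennreal_eq)
  have "(\<lambda>n. c * ((Q * r) ^ n /\<^sub>R fact n)) sums (c * exp (Q * r))"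
    by (intro sums_mult exp_converges)
  moreover have "c * ((Q * r) ^ n /\<^sub>R fact n) = r ^ n * expseq c Q n" for n
    by (simp add: expseq_def divide_inverse power_mult_distrib)
  ultimately show "(\<lambda>n. r ^ n * expseq c Q n) sums (c * exp (Q * r))" by simp
qed (use assms in \<open>simp add: expseq_def\<close>)

text \<open>Bounding the Euclidean norm by the sum of absolute values costs the number of words of
  length n, which is a power and only rescales \<open>Q\<close>.\<close>

lemma level_norm_le_expseq:
  fixes b :: "'m::finite tseries"
  assumes "\<And>w. length w = n \<Longrightarrow> \<bar>b w\<bar> \<le> expseq c Q n"
  shows "level_norm b n \<le> expseq c (real CARD('m) * Q) n"
proof -
  have "level_norm b n \<le> (\<Sum>w | length w = n. \<bar>b w\<bar>)"
    unfolding level_norm_L2 by (rule L2_set_le_sum_abs)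
  also have "\<dots> \<le> (\<Sum>w::'m list | length w = n. expseq c Q n)"
    using assms by (intro sum_mono) auto
  also have "\<dots> = real (CARD('m)) ^ n * expseq c Q n"
    using card_lists_length_eq[of "UNIV :: 'm set" n] by simp
  finally show ?thesis by (simp add: expseq_def power_mult_distrib ac_simps)
qed

lemma level_norm_tprod_expseq:
  fixes a b :: "'m::finite tseries"
  assumes s: "\<And>n. level_norm a n \<le> s n"
    and b: "\<And>w. \<bar>b w\<bar> \<le> expseq c Q (length w)"
  shows "level_norm (a \<otimes>\<^sub>t b) n \<le> conv s (expseq c (real CARD('m) * Q)) n"
  using b by (intro order_trans[OF level_norm_tprod] conv_mono s level_norm_le_expseq) auto

text \<open>Factors $e^{B\lambda_k}$ are absorbed by $e^{-k^{l'}}$ at the price of passing from $l$ to $l'>l$.\<close>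

locale weights =
  fixes lam :: "nat \<Rightarrow> real"
  assumes lam_pos: "\<And>k. lam k > 0"
    and lam_growth: "\<And>q. q > 1 \<Longrightarrow> lam \<in> o(\<lambda>k. real k powr q)"
begin

lemma lam_nonneg: "0 \<le> lam k"
  using lam_pos[of k] by simp

lemma exp_weight_bounded:
  assumes l: "1 < l" "l < l'" and B: "0 \<le> B"
  obtains C where "0 \<le> C"
    "\<And>k. exp (- (real k powr l')) * exp (B * lam k) \<le> C * exp (- (real k powr l))"
proof -
  \<comment> \<open>The growth assumption is used at q = l and gives \<open>lam k\<close> <= k^l
    eventually, so that B \<open>lam k\<close> + k^l <= (B + 1) k^l; the factor B + 1 is eventually
    below k^(l' - l).\<close>
  have "eventually (\<lambda>k. norm (lam k) \<le> 1 * norm (real k powr l)) sequentially"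
    using lam_growth[OF l(1)] by (rule landau_o.smallD) simp
  moreover have "eventually (\<lambda>k. B + 1 \<le> real k powr (l' - l)) sequentially"
    using l by real_asymp
  ultimately have "eventually (\<lambda>k. exp (- (real k powr l')) * exp (B * lam k) \<le> 1 * exp (- (real k powr l))) sequentially"
  proof eventually_elim
    case (elim k)
    have "B * lam k + real k powr l \<le> (B + 1) * real k powr l"
      using elim(1) lam_nonneg[of k] B by (simp add: algebra_simps mult_left_mono)
    also have "\<dots> \<le> real k powr (l' - l) * real k powr l"
      using elim(2) by (rule mult_right_mono) simp
    also have "\<dots> = real k powr l'" by (simp flip: powr_add)
    finally show ?case by (simp flip: exp_add)
  qed
  then obtain N where N: "\<And>k. k \<ge> N \<Longrightarrow>
      exp (- (real k powr l')) * exp (B * lam k) \<le> 1 * exp (- (real k powr l))"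
    by (auto simp: eventually_sequentially)
  define D where "D k = exp (- (real k powr l')) * exp (B * lam k) / exp (- (real k powr l))" for k
  \<comment> \<open>The finitely many k below \<open>N\<close> are covered by adding their ratios to
    the eventual constant 1.\<close>
  define C where "C = 1 + (\<Sum>k<N. D k)"
  have D: "0 \<le> D k" for k by (simp add: D_def)
  show thesis
  proof (rule that[of C])
    show "0 \<le> C" using D by (simp add: C_def sum_nonneg)
    fix k
    have "D k \<le> C"
    proof (cases "k < N")
      case True
      then have "D k \<le> (\<Sum>k<N. D k)" by (intro member_le_sum) (use D in auto)
      then show ?thesis by (simp add: C_def)
    next
      case False
      then have "D k \<le> 1" using N[of k] by (simp add: D_def divide_le_eq)
      also have "1 \<le> C" using D by (simp add: C_def sum_nonneg)
      finally show ?thesis .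
    qed
    then show "exp (- (real k powr l')) * exp (B * lam k) \<le> C * exp (- (real k powr l))"
      by (simp add: D_def divide_le_eq)
  qed
qed

text \<open>Every loss of exponent goes through this estimate. With weight \<open>lam k\<close> the
  factorial majorant sums to c exp(Q \<open>lam k\<close>), which \<open>exp_weight_bounded\<close>
  absorbs. The constant is independent of \<open>s\<close> and the bound is linear in
  \<open>c\<close>; Lipschitz estimates need both.\<close>

lemma seqnorm_conv_expseq:
  assumes l: "1 < l" "l < l'" and Q: "0 \<le> Q"
  obtains C where "0 \<le> C"
    "\<And>s c. (\<And>n. 0 \<le> s n) \<Longrightarrow> 0 \<le> c \<Longrightarrow>
       seqnorm lam l' (conv s (expseq c Q)) \<le> ennreal (C * c) * seqnorm lam l s"
proof -
  obtain C0 where C0: "0 \<le> C0"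
    "\<And>k. exp (- (real k powr l')) * exp (Q * lam k) \<le> C0 * exp (- (real k powr l))"
    using exp_weight_bounded[OF l Q] by blast
  have l': "1 < l'" using l by simp
  obtain z where z: "Zl l = ennreal z" "0 < z"
    using Zl_pos[of l] Zl_finite[OF l(1)] by (cases "Zl l") (auto simp: less_le)
  obtain z' where z': "Zl l' = ennreal z'" "0 < z'"
    using Zl_pos[of l'] Zl_finite[OF l'] by (cases "Zl l'") (auto simp: less_le)
  show thesis
  proof (rule that[of "C0 * z / z'"])
    show "0 \<le> C0 * z / z'" using C0 z z' by simp
    fix s :: "nat \<Rightarrow> real" and c :: real
    assume s: "\<And>n. 0 \<le> s n" and c: "0 \<le> c"
    have "(\<Sum>k. ennreal (exp (- (real k powr l'))) * (\<Sum>n. ennreal (lam k ^ n * conv s (expseq c Q) n)))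
       \<le> (\<Sum>k. ennreal (C0 * c) * (ennreal (exp (- (real k powr l))) * (\<Sum>n. ennreal (lam k ^ n * s n))))"
    proof (intro suminf_le allI)
      fix k
      have "ennreal (exp (- (real k powr l'))) * (\<Sum>n. ennreal (lam k ^ n * conv s (expseq c Q) n))
        \<le> ennreal (exp (- (real k powr l'))) * ((\<Sum>n. ennreal (lam k ^ n * s n)) * ennreal (c * exp (Q * lam k)))"
        unfolding suminf_expseq[OF c Q lam_nonneg, symmetric]
        by (intro mult_left_mono suminf_conv_le s expseq_nonneg c Q lam_nonneg) simp
      also have "\<dots> = ennreal (exp (- (real k powr l')) * exp (Q * lam k) * c) * (\<Sum>n. ennreal (lam k ^ n * s n))"
        using c by (simp add: ennreal_mult ac_simps)
      also have "\<dots> \<le> ennreal (C0 * exp (- (real k powr l)) * c) * (\<Sum>n. ennreal (lam k ^ n * s n))"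
        using C0(2)[of k] c by (intro mult_right_mono ennreal_leI) auto
      also have "\<dots> = ennreal (C0 * c) * (ennreal (exp (- (real k powr l))) * (\<Sum>n. ennreal (lam k ^ n * s n)))"
        using c C0(1) by (simp add: ennreal_mult ac_simps)
      finally show "ennreal (exp (- (real k powr l'))) * (\<Sum>n. ennreal (lam k ^ n * conv s (expseq c Q) n))
        \<le> ennreal (C0 * c) * (ennreal (exp (- (real k powr l))) * (\<Sum>n. ennreal (lam k ^ n * s n)))" .
    qed auto
    also have "\<dots> = ennreal (C0 * c) * (ennreal z * seqnorm lam l s)"
      using Zl_times_seqnorm[OF l(1), of lam s] by (simp add: z)
    finally have "seqnorm lam l' (conv s (expseq c Q)) \<le> (ennreal (C0 * c) * (ennreal z * seqnorm lam l s)) / ennreal z'"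
      unfolding seqnorm_def[of _ l'] z' by (rule divide_right_mono_ennreal)
    also have "\<dots> = ennreal (C0 * z / z' * c) * seqnorm lam l s"
    proof -
      have "ennreal (C0 * z / z' * c) = ennreal (C0 * c) * ennreal z / ennreal z'"
        using c C0(1) z(2) z'(2) by (simp add: divide_ennreal ac_simps flip: ennreal_mult)
      then show ?thesis by (simp add: ennreal_divide_times ac_simps ennreal_times_divide)
    qed
    finally show "seqnorm lam l' (conv s (expseq c Q)) \<le> ennreal (C0 * z / z' * c) * seqnorm lam l s" .
  qed
qed

end

section \<open>The metric of the weighted spaces\<close>

text \<open>Written as one integral over the pairs (k, n), the double series becomes accessible to
  additivity, exchange with countable sums and dominated convergence.\<close>

lemma seqnorm_eq_nn_integral:
  assumes "\<And>k. 0 \<le> lam k" "\<And>n. 0 \<le> s n"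
  shows "seqnorm lam l s =
    (\<integral>\<^sup>+(k, n). ennreal (exp (- (real k powr l)) * lam k ^ n * s n) \<partial>count_space UNIV) / Zl l"
proof -
  let ?f = "\<lambda>(k, n). ennreal (exp (- (real k powr l)) * lam k ^ n * s n)"
  have "(\<integral>\<^sup>+x. ?f x \<partial>count_space UNIV) = (\<Sum>k. \<Sum>n. ?f (k, n))"
    by (simp add: nn_integral_fst_count_space[symmetric] nn_integral_count_space_nat)
  also have "\<dots> = (\<Sum>k. ennreal (exp (- (real k powr l))) * (\<Sum>n. ennreal (lam k ^ n * s n)))"
    using assms by (intro suminf_cong) (simp add: mult.assoc ennreal_mult flip: ennreal_suminf_cmult)
  finally show ?thesis by (simp add: seqnorm_def)
qed

lemma seqnorm_add:
  assumes lam: "\<And>k. 0 \<le> lam k" and s: "\<And>n. 0 \<le> s n" and t: "\<And>n. 0 \<le> t n"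
  shows "seqnorm lam l (\<lambda>n. s n + t n) = seqnorm lam l s + seqnorm lam l t"
proof -
  let ?W = "\<lambda>k n. exp (- (real k powr l)) * lam k ^ n"
  have "(\<integral>\<^sup>+(k, n). ennreal (?W k n * (s n + t n)) \<partial>count_space UNIV) =
      (\<integral>\<^sup>+x. (case x of (k, n) \<Rightarrow> ennreal (?W k n * s n)) + (case x of (k, n) \<Rightarrow> ennreal (?W k n * t n)) \<partial>count_space UNIV)"
    using lam s t by (intro nn_integral_cong) (auto simp: distrib_left)
  also have "\<dots> = (\<integral>\<^sup>+(k, n). ennreal (?W k n * s n) \<partial>count_space UNIV)
      + (\<integral>\<^sup>+(k, n). ennreal (?W k n * t n) \<partial>count_space UNIV)"
    by (rule nn_integral_add) auto
  finally show ?thesis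
    using seqnorm_eq_nn_integral[of lam "\<lambda>n. s n + t n" l] seqnorm_eq_nn_integral[of lam s l]
      seqnorm_eq_nn_integral[of lam t l] lam s t
    by (simp add: add_divide_distrib_ennreal)
qed

lemma seqnorm_suminf:
  assumes lam: "\<And>k. 0 \<le> lam k" and s: "\<And>i n. 0 \<le> s i n"
    and t: "\<And>n. (\<lambda>i. s i n) sums t n"
  shows "seqnorm lam l t = (\<Sum>i. seqnorm lam l (s i))"
proof -
  let ?W = "\<lambda>k n. exp (- (real k powr l)) * lam k ^ n"
  have t0: "0 \<le> t n" for n by (rule sums_le[OF s sums_zero t])
  have eq: "ennreal (?W k n * t n) = (\<Sum>i. ennreal (?W k n * s i n))" for k n
    using s lam by (intro suminf_ennreal_eq[symmetric] sums_mult t) simp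
  have "(\<integral>\<^sup>+(k, n). ennreal (?W k n * t n) \<partial>count_space UNIV)
      = (\<integral>\<^sup>+x. (\<Sum>i. case x of (k, n) \<Rightarrow> ennreal (?W k n * s i n)) \<partial>count_space UNIV)"
    by (intro nn_integral_cong) (auto simp: eq)
  also have "\<dots> = (\<Sum>i. \<integral>\<^sup>+(k, n). ennreal (?W k n * s i n) \<partial>count_space UNIV)"
    by (rule nn_integral_suminf) auto
  finally have "seqnorm lam l t = (\<Sum>i. \<integral>\<^sup>+(k, n). ennreal (?W k n * s i n) \<partial>count_space UNIV) / Zl l"
    using seqnorm_eq_nn_integral[of lam t l] lam t0 by simp
  also have "\<dots> = (\<Sum>i. seqnorm lam l (s i))"
    using seqnorm_eq_nn_integral[of lam "s i" l for i] lam s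
    by (simp add: divide_ennreal_def ennreal_suminf_multc)
  finally show ?thesis .
qed

section \<open>Compactness and convergence for series with a common majorant\<close>

lemma level_norm_triangle: "level_norm (a - b) n \<le> level_norm a n + level_norm b n"
  using L2_set_triangle_ineq[of a "\<lambda>w. - b w" "{w. length w = n}"]
  unfolding level_norm_L2 by (simp add: L2_set_def)

lemma level_norm_triangle': "level_norm a n \<le> level_norm b n + level_norm (a - b) n"
  using L2_set_triangle_ineq[of b "a - b" "{w. length w = n}"]
  unfolding level_norm_L2 by simp

text \<open>Tychonoff's theorem for the product of the intervals [-B w, B w]; as there are only
  countably many words, compactness yields convergent subsequences.\<close>

lemma bounded_coords_subseq:
  fixes a :: "nat \<Rightarrow> 'm::finite tseries"
  assumes "\<And>i w. \<bar>a i w\<bar> \<le> B w"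
  obtains r b where "strict_mono r" "\<And>w. (\<lambda>i. a (r i) w) \<longlonglongrightarrow> b w"
proof -
  have "compactin (product_topology (\<lambda>_. euclidean) UNIV) (PiE UNIV (\<lambda>w::'m list. {- B w .. B w}))"
    by (subst compactin_PiE) auto
  then have "compact (PiE UNIV (\<lambda>w::'m list. {- B w .. B w}))"
    by (metis compactin_euclidean_iff euclidean_product_topology)
  then have "seq_compact (PiE UNIV (\<lambda>w::'m list. {- B w .. B w}))"
    by (rule compact_imp_seq_compact)
  moreover have "\<forall>i. a i \<in> PiE UNIV (\<lambda>w::'m list. {- B w .. B w})"
    using assms by (auto simp: abs_le_iff minus_le_iff)
  ultimately obtain b r where r: "strict_mono r" "(a \<circ> r) \<longlonglongrightarrow> b"
    by (meson seq_compactE)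
  have "(\<lambda>i. (a \<circ> r) i w) \<longlonglongrightarrow> b w" for w
    using continuous_on_tendsto_compose[OF continuous_on_product_coordinates[of w] r(2)] by simp
  then show thesis using r(1) that by auto
qed

lemma level_norm_diff_tendsto:
  assumes "\<And>w. (\<lambda>i. a i w) \<longlonglongrightarrow> b w"
  shows "(\<lambda>i. level_norm (a i - b) n) \<longlonglongrightarrow> 0"
proof -
  have "(\<lambda>i. sqrt (\<Sum>w | length w = n. (a i w - b w)\<^sup>2)) \<longlonglongrightarrow> sqrt (\<Sum>w | length w = n. (b w - b w)\<^sup>2)"
    by (intro tendsto_intros assms)
  then show ?thesis by (simp add: level_norm_def)
qed

lemma level_norm_tendsto:
  assumes "\<And>w. (\<lambda>i. a i w) \<longlonglongrightarrow> b w"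
  shows "(\<lambda>i. level_norm (a i) n) \<longlonglongrightarrow> level_norm b n"
  unfolding level_norm_def by (intro tendsto_intros assms)

context weights
begin

lemma Tl_iff: "a \<in> Tl lam l \<longleftrightarrow> tnorm lam l a < \<infinity>"
  by (simp add: Tl_def)

lemma tnorm_diff_le: "tnorm lam l (a - b) \<le> tnorm lam l a + tnorm lam l b"
  using seqnorm_mono[of lam "level_norm (a - b)" "\<lambda>n. level_norm a n + level_norm b n" l]
    seqnorm_add[of lam "level_norm a" "level_norm b" l]
  by (simp add: tnorm_eq_seqnorm lam_nonneg level_norm_triangle)

lemma tnorm_triangle': "tnorm lam l a \<le> tnorm lam l b + tnorm lam l (a - b)"
  using seqnorm_mono[of lam "level_norm a" "\<lambda>n. level_norm b n + level_norm (a - b) n" l]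
    seqnorm_add[of lam "level_norm b" "level_norm (a - b)" l]
  by (simp add: tnorm_eq_seqnorm lam_nonneg level_norm_triangle')

lemma tnorm_diff_finite:
  assumes "a \<in> Tl lam l" "b \<in> Tl lam l"
  shows "tnorm lam l (a - b) < \<infinity>"
proof -
  have "tnorm lam l a + tnorm lam l b < \<infinity>" using assms by (simp add: Tl_iff)
  with tnorm_diff_le show ?thesis by (rule le_less_trans)
qed

lemma ennreal_tdist:
  assumes "a \<in> Tl lam l" "b \<in> Tl lam l"
  shows "ennreal (tdist lam l a b) = tnorm lam l (a - b)"
  using tnorm_diff_finite[OF assms] by (simp add: tdist_def)

lemma tdist_nonneg [simp]: "0 \<le> tdist lam l a b"
  by (simp add: tdist_def)

lemma tdist_self [simp]: "tdist lam l a a = 0"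
  by (simp add: tdist_def tnorm_zero)

lemma tdist_commute: "tdist lam l a b = tdist lam l b a"
  by (simp add: tdist_def tnorm_sym[of lam l a b])

lemma tdist_le:
  assumes "tnorm lam l (a - b) \<le> ennreal c" "0 \<le> c"
  shows "tdist lam l a b \<le> c"
  unfolding tdist_def using assms by (intro enn2real_leI) auto

lemma Tl_of_majorant:
  assumes "seqnorm lam l s < \<infinity>" "\<And>n. level_norm a n \<le> s n"
  shows "a \<in> Tl lam l"
  unfolding Tl_iff tnorm_eq_seqnorm
  by (rule order.strict_trans1[OF seqnorm_mono assms(1)]) (rule lam_nonneg assms(2))+

text \<open>Together with \<open>bounded_coords_subseq\<close> this is the compactness of majorized
  sets. The limit inherits the majorant, so 2 s dominates the differences and dominated convergence
  over the pairs (k, n) applies.\<close>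

lemma tdist_dominated_convergence:
  assumes l: "1 < l" and s: "seqnorm lam l s < \<infinity>" and a: "\<And>i n. level_norm (a i) n \<le> s n"
    and ab: "\<And>w. (\<lambda>i. a i w) \<longlonglongrightarrow> b w"
  shows "\<And>n. level_norm b n \<le> s n" "(\<lambda>i. tdist lam l (a i) b) \<longlonglongrightarrow> 0"
proof -
  show b: "level_norm b n \<le> s n" for n
    using LIMSEQ_le_const2[OF level_norm_tendsto[of a b n, OF ab], of "s n"] a by auto
  have s0: "0 \<le> s n" for n using a[of 0 n] level_norm_nonneg[of "a 0" n] by linarith
  let ?W = "\<lambda>(k, n). exp (- (real k powr l)) * lam k ^ n"
  define u where "u i x = ennreal (?W x * level_norm (a i - b) (snd x))" for i x
  have "(\<lambda>i. \<integral>\<^sup>+x. u i x \<partial>count_space UNIV) \<longlonglongrightarrow> (\<integral>\<^sup>+x. 0 \<partial>count_space (UNIV :: (nat \<times> nat) set))"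
  proof (rule nn_integral_dominated_convergence)
    have "level_norm (a i - b) n \<le> s n + s n" for i n
      using level_norm_triangle[of "a i" b n] a[of i n] b[of n] by linarith
    then show "AE x in count_space UNIV. u i x \<le> ennreal (?W x * (s (snd x) + s (snd x)))" for i
      using lam_nonneg
      by (intro AE_I2) (simp add: u_def case_prod_unfold ennreal_leI mult_left_mono)
    have eq: "(\<integral>\<^sup>+x. ennreal (?W x * (s (snd x) + s (snd x))) \<partial>count_space UNIV) / Zl l
        = seqnorm lam l s + seqnorm lam l s"
      using seqnorm_eq_nn_integral[of lam "\<lambda>n. s n + s n" l] seqnorm_add[of lam s s l] s0 lam_nonneg
      by (simp add: case_prod_unfold)
    show "(\<integral>\<^sup>+x. ennreal (?W x * (s (snd x) + s (snd x))) \<partial>count_space UNIV) < \<infinity>"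
    proof -
      \<comment> \<open>Dividing infinity by the finite number \<open>Zl l\<close> would again give
        infinity, against the finiteness of the norm of \<open>s\<close>.\<close>
      have "(\<integral>\<^sup>+x. ennreal (?W x * (s (snd x) + s (snd x))) \<partial>count_space UNIV) \<noteq> top"
      proof
        assume "(\<integral>\<^sup>+x. ennreal (?W x * (s (snd x) + s (snd x))) \<partial>count_space UNIV) = top"
        with eq have "top / Zl l = seqnorm lam l s + seqnorm lam l s" by (simp only:)
        moreover have "top / Zl l = (top :: ennreal)"
          using Zl_finite[OF l] by (auto simp: ennreal_top_divide)
        ultimately have "seqnorm lam l s + seqnorm lam l s = top" by simp
        then show False using s unfolding ennreal_add_eq_top by simp
      qed
      then show ?thesis by (simp only: less_top infinity_ennreal_def)
    qed
    show "AE x in count_space UNIV. (\<lambda>i. u i x) \<longlonglongrightarrow> 0"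
    proof (rule AE_I2)
      fix x :: "nat \<times> nat"
      have "(\<lambda>i. ennreal (?W x * level_norm (a i - b) (snd x))) \<longlonglongrightarrow> ennreal (?W x * 0)"
        by (intro tendsto_ennrealI tendsto_mult_left level_norm_diff_tendsto ab)
      then show "(\<lambda>i. u i x) \<longlonglongrightarrow> 0"
        by (simp add: u_def)
    qed
  qed auto
  moreover have "inverse (Zl l) < top"
    using Zl_pos[of l] by (simp only: less_top[symmetric] ennreal_inverse_eq_top_iff not_False_eq_True)
  ultimately have "(\<lambda>i. inverse (Zl l) * (\<integral>\<^sup>+x. u i x \<partial>count_space UNIV))
      \<longlonglongrightarrow> inverse (Zl l) * (\<integral>\<^sup>+x. 0 \<partial>count_space (UNIV :: (nat \<times> nat) set))"
    by (intro ennreal_tendsto_cmult)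
  moreover have "inverse (Zl l) * (\<integral>\<^sup>+x. u i x \<partial>count_space UNIV) = tnorm lam l (a i - b)" for i
  proof -
    have "(\<integral>\<^sup>+x. u i x \<partial>count_space UNIV) = (\<integral>\<^sup>+(k, n). ennreal (exp (- (real k powr l)) * lam k ^ n
        * level_norm (a i - b) n) \<partial>count_space UNIV)"
      by (intro nn_integral_cong) (auto simp: u_def)
    then show ?thesis
      unfolding tnorm_eq_seqnorm by (subst seqnorm_eq_nn_integral)
        (simp_all add: lam_nonneg divide_ennreal_def mult.commute[of "inverse (Zl l)"])
  qed
  ultimately have "(\<lambda>i. tnorm lam l (a i - b)) \<longlonglongrightarrow> ennreal 0" by simp
  then show "(\<lambda>i. tdist lam l (a i) b) \<longlonglongrightarrow> 0"
    unfolding tdist_def by (intro tendsto_enn2real) auto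
qed

lemma metric_Tl: "1 < l \<Longrightarrow> Metric_space (Tl lam l) (tdist lam l)"
  by (rule Metric_space_Tl[OF lam_pos])

lemma tdist_eq_0:
  assumes "1 < l" "a \<in> Tl lam l" "b \<in> Tl lam l" "tdist lam l a b = 0"
  shows "a = b"
  using Metric_space.zero[OF metric_Tl[OF assms(1)] assms(2,3)] assms(4) by simp

lemma tdist_triangle:
  assumes "1 < l" "a \<in> Tl lam l" "b \<in> Tl lam l" "c \<in> Tl lam l"
  shows "tdist lam l a c \<le> tdist lam l a b + tdist lam l b c"
  using Metric_space.triangle[OF metric_Tl[OF assms(1)] assms(2,3,4)] .

lemma openin_Tl_top_ball:
  assumes "1 < l" "openin (Tl_top lam l) U" "a \<in> U"
  obtains r where "r > 0" "\<And>b. b \<in> Tl lam l \<Longrightarrow> tdist lam l a b < r \<Longrightarrow> b \<in> U"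
proof -
  interpret Metric_space "Tl lam l :: 'a tseries set" "tdist lam l" by (rule metric_Tl[OF assms(1)])
  have "U \<subseteq> Tl lam l" "\<exists>r>0. mball a r \<subseteq> U"
    using assms(2,3) unfolding Tl_top_def by (auto simp: openin_mtopology)
  then show thesis using assms(3) that by (auto simp: subset_iff)
qed

lemma openin_Tl1_top_ball:
  assumes "1 < l" "openin (Tl1_top lam l) U" "a \<in> U"
  obtains r where "r > 0" "\<And>b. b \<in> Tl1 lam l \<Longrightarrow> tdist lam l a b < r \<Longrightarrow> b \<in> U"
proof -
  obtain V where V: "openin (Tl_top lam l) V" "U = V \<inter> Tl1 lam l"
    using assms(2) unfolding Tl1_top_def by (auto simp: openin_subtopology)
  obtain r where "r > 0" "\<And>b. b \<in> Tl lam l \<Longrightarrow> tdist lam l a b < r \<Longrightarrow> b \<in> V"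
    using openin_Tl_top_ball[OF assms(1) V(1)] assms(3) V(2) by blast
  then show thesis using that[of r] V(2) by (auto simp: Tl1_def)
qed

end

text \<open>
  Only the first level of \<open>F\<close> matters: for fixed \<open>r\<close>, growth condition (ii) with
  $\alpha\to\infty$ forces all higher levels to vanish.
\<close>

locale tensor_rde = weights lam for lam +
  fixes p :: real and M :: nat and F :: "'m::finite tseries \<Rightarrow> real ^ 'd::finite \<Rightarrow> 'm tseries"
  assumes p: "p > 1"
    and F_lin: "\<And>a. a \<in> Tl1 lam p \<Longrightarrow> F a \<in> lin_tM M"
    and F_lip: "\<And>j a. a \<in> Tl1 lam p \<Longrightarrow>
        \<exists>U L. openin (Tl1_top lam p) U \<and> a \<in> U \<and> L > 0 \<and>
          (\<forall>a1\<in>U. \<forall>a2\<in>U.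
             tM_norm M (F a1 (axis j 1) - F a2 (axis j 1)) \<le> L * tdist lam p a1 a2)"
    and F_growth: "\<And>j R. R > 0 \<Longrightarrow>
        \<exists>C>0. \<forall>a\<in>tpolys. a [] = 1 \<and> tnorm lam p (a - tone) \<le> ennreal R \<longrightarrow>
          (\<forall>\<alpha>\<ge>0. \<forall>r\<ge>0.
             norm1 (dil (\<alpha> / (1 + r)) (F (dil r a) (axis j 1))) \<le> ennreal (C * \<alpha>))"
begin

lemma F_lip_coord:
  assumes a: "a \<in> Tl1 lam p"
  obtains r L where "r > 0" "L > 0"
    "\<And>b c w. \<lbrakk>b \<in> Tl1 lam p; c \<in> Tl1 lam p; tdist lam p a b < r; tdist lam p a c < r\<rbrakk> \<Longrightarrow>
       \<bar>F b (axis j 1) w - F c (axis j 1) w\<bar> \<le> L * tdist lam p b c"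
proof -
  obtain U L where U: "openin (Tl1_top lam p) U" "a \<in> U" "L > 0"
    and lip: "\<And>b c. b \<in> U \<Longrightarrow> c \<in> U \<Longrightarrow> tM_norm M (F b (axis j 1) - F c (axis j 1)) \<le> L * tdist lam p b c"
    using F_lip[OF a] by meson
  obtain r where r: "r > 0" "\<And>b. b \<in> Tl1 lam p \<Longrightarrow> tdist lam p a b < r \<Longrightarrow> b \<in> U"
    using openin_Tl1_top_ball[OF p U(1,2)] by blast
  show thesis
  proof (rule that[OF r(1) U(3)])
    fix b c w assume b: "b \<in> Tl1 lam p" "tdist lam p a b < r" and c: "c \<in> Tl1 lam p" "tdist lam p a c < r"
    show "\<bar>F b (axis j 1) w - F c (axis j 1) w\<bar> \<le> L * tdist lam p b c"
    proof (cases "length w \<le> M")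
      case True
      have fin: "finite {w :: 'm list. length w \<le> M}"
        using finite_lists_length_le[of "UNIV :: 'm set" M] by simp
      have "((F b (axis j 1) - F c (axis j 1)) w)\<^sup>2 \<le> (\<Sum>w | length w \<le> M. ((F b (axis j 1) - F c (axis j 1)) w)\<^sup>2)"
        using True fin by (intro member_le_sum) auto
      then have "\<bar>(F b (axis j 1) - F c (axis j 1)) w\<bar> \<le> tM_norm M (F b (axis j 1) - F c (axis j 1))"
        unfolding tM_norm_def by (metis real_sqrt_abs real_sqrt_le_iff)
      also have "\<dots> \<le> L * tdist lam p b c" using lip r(2) b c by blast
      finally show ?thesis by simp
    next
      case False
      then have "F b (axis j 1) w = 0" "F c (axis j 1) w = 0"
        using F_lin[OF b(1)] F_lin[OF c(1)] by (auto simp: lin_tM_def tM_def)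
      then show ?thesis using U(3) by simp
    qed
  qed
qed

lemma Tl1_Tl: "a \<in> Tl1 lam l \<Longrightarrow> a \<in> Tl lam l"
  by (simp add: Tl1_def)

lemma F_tendsto:
  assumes a: "a \<in> Tl1 lam p" and b: "\<And>i. b i \<in> Tl1 lam p"
    and lim: "(\<lambda>i. tdist lam p (b i) a) \<longlonglongrightarrow> 0"
  shows "(\<lambda>i. F (b i) (axis j 1) w) \<longlonglongrightarrow> F a (axis j 1) w"
proof -
  obtain r L where rL: "r > 0" "L > 0"
    "\<And>b c w. \<lbrakk>b \<in> Tl1 lam p; c \<in> Tl1 lam p; tdist lam p a b < r; tdist lam p a c < r\<rbrakk> \<Longrightarrow>
       \<bar>F b (axis j 1) w - F c (axis j 1) w\<bar> \<le> L * tdist lam p b c"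
    using F_lip_coord[OF a, where j = j] by metis
  have "eventually (\<lambda>i. tdist lam p (b i) a < r) sequentially"
    using lim rL(1) by (rule order_tendstoD)
  then have "eventually (\<lambda>i. norm (F (b i) (axis j 1) w - F a (axis j 1) w) \<le> L * tdist lam p (b i) a) sequentially"
    by eventually_elim (use rL(1) rL(3)[OF b a] in \<open>simp add: tdist_commute[of _ a]\<close>)
  moreover have "(\<lambda>i. L * tdist lam p (b i) a) \<longlonglongrightarrow> 0"
    using tendsto_mult_left[OF lim, of L] by simp
  ultimately have "(\<lambda>i. F (b i) (axis j 1) w - F a (axis j 1) w) \<longlonglongrightarrow> 0"
    by (rule Lim_null_comparison)
  then show ?thesis by (simp add: LIM_zero_iff)
qed

text \<open>Compactness argument: pairs that violate the constant 1 + i converge along a subsequence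
  to a' and b'. The values of \<open>F\<close> converge and so stay bounded, hence the distances
  within the pairs tend to zero and a' = b'. The local Lipschitz constant at this common point
  contradicts the violation.\<close>

lemma F_lipschitz_on_majorized:
  assumes s: "seqnorm lam p s < \<infinity>"
  obtains L where "L > 0"
    "\<And>a b. \<lbrakk>a [] = 1; b [] = 1; \<And>n. level_norm a n \<le> s n; \<And>n. level_norm b n \<le> s n\<rbrakk> \<Longrightarrow>
      \<bar>F a (axis j 1) w - F b (axis j 1) w\<bar> \<le> L * tdist lam p a b"
proof (rule ccontr)
  assume no: "\<not> thesis"
  have "\<exists>a b. (a [] = 1 \<and> b [] = 1 \<and> (\<forall>n. level_norm a n \<le> s n) \<and> (\<forall>n. level_norm b n \<le> s n)) \<and>
      \<bar>F a (axis j 1) w - F b (axis j 1) w\<bar> > (1 + real i) * tdist lam p a b" for i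
  proof (rule ccontr)
    assume "\<not> ?thesis"
    then show False
      using no that[of "1 + real i"] by (smt (verit) of_nat_0_le_iff)
  qed
  then obtain a b where a1: "\<And>i. a i [] = 1" and b1: "\<And>i. b i [] = 1"
    and as: "\<And>i n. level_norm (a i) n \<le> s n" and bs: "\<And>i n. level_norm (b i) n \<le> s n"
    and far: "\<And>i. \<bar>F (a i) (axis j 1) w - F (b i) (axis j 1) w\<bar> > (1 + real i) * tdist lam p (a i) (b i)"
    by metis
  have "\<bar>a i v\<bar> \<le> s (length v)" "\<bar>b i v\<bar> \<le> s (length v)" for i v
    using level_norm_ge_coord[of "a i" v] level_norm_ge_coord[of "b i" v] as[of i] bs[of i]
    by (meson order_trans)+
  note coord = this
  obtain r a' where r: "strict_mono r" "\<And>w. (\<lambda>i. a (r i) w) \<longlonglongrightarrow> a' w"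
    using bounded_coords_subseq[of a, OF coord(1)] by blast
  \<comment> \<open>The second extraction runs along the first, so that a single subsequence serves
    both sequences.\<close>
  obtain q b' where q: "strict_mono q" "\<And>w. (\<lambda>i. b (r (q i)) w) \<longlonglongrightarrow> b' w"
    using bounded_coords_subseq[of "\<lambda>i. b (r i)", OF coord(2)] by blast
  have ra: "(\<lambda>i. a (r (q i)) w) \<longlonglongrightarrow> a' w" for w
    using LIMSEQ_subseq_LIMSEQ[OF r(2) q(1)] by (simp add: o_def)
  define \<sigma> where "\<sigma> = r \<circ> q"
  have \<sigma>: "strict_mono \<sigma>" using r q by (simp add: \<sigma>_def strict_mono_o)
  have a's: "level_norm a' n \<le> s n" and a'lim: "(\<lambda>i. tdist lam p (a (\<sigma> i)) a') \<longlonglongrightarrow> 0" for n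
    using tdist_dominated_convergence[OF p s as, of "\<sigma>" a'] ra by (simp_all add: \<sigma>_def)
  have b's: "level_norm b' n \<le> s n" and b'lim: "(\<lambda>i. tdist lam p (b (\<sigma> i)) b') \<longlonglongrightarrow> 0" for n
    using tdist_dominated_convergence[OF p s bs, of "\<sigma>" b'] q by (simp_all add: \<sigma>_def)
  have "a' [] = 1" "b' [] = 1"
    using ra[of "[]"] q(2)[of "[]"] by (simp_all add: a1 b1 LIMSEQ_const_iff)
  then have T: "a' \<in> Tl1 lam p" "b' \<in> Tl1 lam p" "a i \<in> Tl1 lam p" "b i \<in> Tl1 lam p" for i
    using Tl_of_majorant[OF s, of a'] Tl_of_majorant[OF s, of b'] Tl_of_majorant[OF s, of "a i"]
      Tl_of_majorant[OF s, of "b i"] a's b's as bs a1 b1 by (auto simp: Tl1_def)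
  have Fa: "(\<lambda>i. F (a (\<sigma> i)) (axis j 1) w) \<longlonglongrightarrow> F a' (axis j 1) w"
    by (rule F_tendsto) (use T a'lim in auto)
  have Fb: "(\<lambda>i. F (b (\<sigma> i)) (axis j 1) w) \<longlonglongrightarrow> F b' (axis j 1) w"
    by (rule F_tendsto) (use T b'lim in auto)
  have bdd: "Bseq (\<lambda>i. F (a (\<sigma> i)) (axis j 1) w - F (b (\<sigma> i)) (axis j 1) w)"
    using convergent_imp_Bseq convergentI[OF tendsto_diff[OF Fa Fb]] by blast
  then obtain K where K: "\<And>i. \<bar>F (a (\<sigma> i)) (axis j 1) w - F (b (\<sigma> i)) (axis j 1) w\<bar> \<le> K"
    by (auto simp: Bseq_def)
  \<comment> \<open>The violated inequality bounds (1 + \<sigma> i) times the distance by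
    \<open>K\<close>, and \<sigma> i >= i, so the distances are of order 1/i.\<close>
  have dab: "(\<lambda>i. tdist lam p (a (\<sigma> i)) (b (\<sigma> i))) \<longlonglongrightarrow> 0"
  proof (rule Lim_null_comparison)
    show "eventually (\<lambda>i. norm (tdist lam p (a (\<sigma> i)) (b (\<sigma> i))) \<le> K * inverse (real (Suc i))) sequentially"
    proof (intro always_eventually allI)
      fix i
      have "real (Suc i) * tdist lam p (a (\<sigma> i)) (b (\<sigma> i)) \<le> (1 + real (\<sigma> i)) * tdist lam p (a (\<sigma> i)) (b (\<sigma> i))"
        using seq_suble[OF \<sigma>, of i] by (intro mult_right_mono) auto
      also have "\<dots> \<le> K" using far[of "\<sigma> i"] K[of i] by linarith
      finally show "norm (tdist lam p (a (\<sigma> i)) (b (\<sigma> i))) \<le> K * inverse (real (Suc i))"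
        by (simp add: field_simps)
    qed
    show "(\<lambda>i. K * inverse (real (Suc i))) \<longlonglongrightarrow> 0"
      using tendsto_mult_left[OF LIMSEQ_inverse_real_of_nat, of K] by simp
  qed
  have "tdist lam p a' b' \<le> tdist lam p (a (\<sigma> i)) a' + tdist lam p (a (\<sigma> i)) (b (\<sigma> i)) + tdist lam p (b (\<sigma> i)) b'" for i
    using tdist_triangle[OF p, of a' "a (\<sigma> i)" b'] tdist_triangle[OF p, of "a (\<sigma> i)" "b (\<sigma> i)" b']
      tdist_commute[of p a' "a (\<sigma> i)"] T Tl1_Tl by (smt (verit))
  moreover have "(\<lambda>i. tdist lam p (a (\<sigma> i)) a' + tdist lam p (a (\<sigma> i)) (b (\<sigma> i)) + tdist lam p (b (\<sigma> i)) b') \<longlonglongrightarrow> 0 + 0 + 0"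
    by (intro tendsto_add a'lim b'lim dab)
  ultimately have "tdist lam p a' b' \<le> 0 + 0 + 0"
    using LIMSEQ_le_const by blast
  then have "tdist lam p a' b' = 0" using tdist_nonneg[of p a' b'] by linarith
  then have "a' = b'" using tdist_eq_0[OF p] T Tl1_Tl by blast
  obtain \<rho> L where rL: "\<rho> > 0" "L > 0"
    "\<And>b c w. \<lbrakk>b \<in> Tl1 lam p; c \<in> Tl1 lam p; tdist lam p a' b < \<rho>; tdist lam p a' c < \<rho>\<rbrakk> \<Longrightarrow>
       \<bar>F b (axis j 1) w - F c (axis j 1) w\<bar> \<le> L * tdist lam p b c"
    using F_lip_coord[OF T(1), where j = j] by metis
  have "eventually (\<lambda>i. tdist lam p (a (\<sigma> i)) a' < \<rho>) sequentially" "eventually (\<lambda>i. tdist lam p (b (\<sigma> i)) b' < \<rho>) sequentially"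
    using a'lim b'lim rL(1) by (auto intro: order_tendstoD)
  moreover have "eventually (\<lambda>i. L \<le> real i) sequentially"
    by (rule eventually_sequentiallyI[of "nat \<lceil>L\<rceil>"]) linarith
  ultimately have "eventually (\<lambda>i. False) sequentially"
  proof eventually_elim
    case (elim i)
    have "\<bar>F (a (\<sigma> i)) (axis j 1) w - F (b (\<sigma> i)) (axis j 1) w\<bar> \<le> L * tdist lam p (a (\<sigma> i)) (b (\<sigma> i))"
      using elim(1,2) T by (intro rL(3)) (auto simp: \<open>a' = b'\<close> tdist_commute[of _ b'])
    also have "\<dots> \<le> (1 + real (\<sigma> i)) * tdist lam p (a (\<sigma> i)) (b (\<sigma> i))"
      using elim(3) seq_suble[OF \<sigma>, of i] by (intro mult_right_mono) auto
    finally show False using far[of "\<sigma> i"] by linarith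
  qed
  then show False by simp
qed

end

section \<open>Consequences of the growth condition\<close>

text \<open>Truncations lie in \<open>tpolys\<close>, where the growth condition is assumed, and
  they approximate every series of a weighted space.\<close>

definition trunc :: "nat \<Rightarrow> 'm tseries \<Rightarrow> 'm tseries" where
  "trunc N a w = (if length w \<le> N then a w else 0)"

lemma level_norm_trunc: "level_norm (trunc N a) n = (if n \<le> N then level_norm a n else 0)"
proof -
  have "(\<Sum>w | length w = n. (trunc N a w)\<^sup>2) = (\<Sum>w | length w = n. if n \<le> N then (a w)\<^sup>2 else 0)"
    by (intro sum.cong) (auto simp: trunc_def)
  then show ?thesis by (simp add: level_norm_def)
qed

lemma trunc_tpolys: "trunc N a \<in> tpolys"
  unfolding tpolys_def by (auto simp: trunc_def intro: exI[of _ N])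

lemma trunc_dil: "trunc N (dil r a) = dil r (trunc N a)"
  by (auto simp: trunc_def dil_def fun_eq_iff)

lemma trunc_diff_tone: "trunc N a - tone = trunc N (a - tone)"
  by (auto simp: trunc_def tone_def fun_eq_iff)

lemma trunc_tendsto: "(\<lambda>N. trunc N a w) \<longlonglongrightarrow> a w"
  by (rule tendsto_eventually, rule eventually_sequentiallyI[of "length w"]) (simp add: trunc_def)

lemma norm1_ge_coord: "ennreal \<bar>a w\<bar> \<le> norm1 a"
proof -
  have "ennreal \<bar>a w\<bar> \<le> (\<Sum>n\<in>{length w}. ennreal (level_norm a n))"
    using level_norm_ge_coord[of a w] by (simp add: ennreal_leI)
  also have "\<dots> \<le> norm1 a"
    unfolding norm1_def by (rule sum_le_suminf) auto
  finally show ?thesis .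
qed

lemma eq_0_of_superlinear_bound:
  fixes q K :: real
  assumes q: "0 \<le> q" and n: "2 \<le> n" and bound: "\<And>\<beta>. 0 \<le> \<beta> \<Longrightarrow> \<beta> ^ n * q \<le> K * \<beta>"
  shows "q = 0"
proof (rule ccontr)
  assume "q \<noteq> 0"
  then have q0: "q > 0" using q by simp
  have K: "K \<ge> q" using bound[of 1] by simp
  \<comment> \<open>\<beta> q = K + q exceeds K, while \<beta> >= 1 permits lowering the exponent
    from n to 2.\<close>
  define \<beta> where "\<beta> = K / q + 1"
  have \<beta>: "\<beta> \<ge> 1" using K q0 by (simp add: \<beta>_def)
  have "\<beta> ^ 2 * q \<le> \<beta> ^ n * q"
    using \<beta> n q by (intro mult_right_mono power_increasing) auto
  also have "\<dots> \<le> K * \<beta>" using bound \<beta> by simp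
  finally have "\<beta> * q \<le> K" using \<beta> by (simp add: power2_eq_square)
  moreover have "\<beta> * q = K + q" using q0 by (simp add: \<beta>_def distrib_right)
  ultimately show False using q0 by simp
qed

context weights
begin

lemma trunc_Tl: "a \<in> Tl lam l \<Longrightarrow> trunc N a \<in> Tl lam l"
  by (rule Tl_of_majorant[of l "level_norm a"]) (auto simp: level_norm_trunc Tl_iff tnorm_eq_seqnorm)

lemma tdist_trunc_tendsto:
  assumes "1 < l" "a \<in> Tl lam l"
  shows "(\<lambda>N. tdist lam l (trunc N a) a) \<longlonglongrightarrow> 0"
  by (rule tdist_dominated_convergence[of l "level_norm a"])
    (use assms in \<open>auto simp: level_norm_trunc Tl_iff tnorm_eq_seqnorm trunc_tendsto\<close>)

lemma tnorm_trunc_le: "tnorm lam l (trunc N a) \<le> tnorm lam l a"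
  by (rule tnorm_mono) (auto simp: lam_nonneg level_norm_trunc)

end

context tensor_rde
begin

text \<open>The growth condition is applied to truncations of \<open>b\<close> with \<alpha> = (1 +
  r) \<beta>, which turns the outer dilation into \<beta>. Truncation commutes with dilation and the
  truncations of \<open>dil r b\<close> converge, so continuity of \<open>F\<close> carries the
  bound for one coordinate to the limit.\<close>

lemma F_growth_Tl1:
  assumes R: "R > 0"
  obtains C where "C > 0"
    "\<And>b r w \<beta>. \<lbrakk>0 \<le> r; dil r b \<in> Tl1 lam p; b [] = 1; tnorm lam p (b - tone) \<le> ennreal R; 0 \<le> \<beta>\<rbrakk>
      \<Longrightarrow> \<beta> ^ length w * \<bar>F (dil r b) (axis j 1) w\<bar> \<le> C * (1 + r) * \<beta>"
proof -
  obtain C where C: "C > 0"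
    "\<And>a \<alpha> r. \<lbrakk>a \<in> tpolys; a [] = 1; tnorm lam p (a - tone) \<le> ennreal R; 0 \<le> \<alpha>; 0 \<le> r\<rbrakk> \<Longrightarrow>
      norm1 (dil (\<alpha> / (1 + r)) (F (dil r a) (axis j 1))) \<le> ennreal (C * \<alpha>)"
    using F_growth[OF R, of j] by blast
  show thesis
  proof (rule that[OF C(1)])
    fix b :: "'m tseries" and r \<beta> :: real and w
    assume r: "0 \<le> r" and a: "dil r b \<in> Tl1 lam p" and b: "b [] = 1"
      and bR: "tnorm lam p (b - tone) \<le> ennreal R" and \<beta>: "0 \<le> \<beta>"
    have "\<beta> ^ length w * \<bar>F (trunc N (dil r b)) (axis j 1) w\<bar> \<le> C * (1 + r) * \<beta>" for N
    proof -
      have "tnorm lam p (trunc N b - tone) \<le> ennreal R"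
        unfolding trunc_diff_tone using tnorm_trunc_le bR by (rule order_trans)
      then have "norm1 (dil ((1 + r) * \<beta> / (1 + r)) (F (dil r (trunc N b)) (axis j 1))) \<le> ennreal (C * ((1 + r) * \<beta>))"
        using r \<beta> b by (intro C(2)) (auto simp: trunc_tpolys trunc_def)
      with norm1_ge_coord[of "dil \<beta> (F (dil r (trunc N b)) (axis j 1))" w]
      have "ennreal \<bar>dil \<beta> (F (dil r (trunc N b)) (axis j 1)) w\<bar> \<le> ennreal (C * ((1 + r) * \<beta>))"
        using r by (simp add: order_trans)
      then have "\<bar>dil \<beta> (F (dil r (trunc N b)) (axis j 1)) w\<bar> \<le> C * ((1 + r) * \<beta>)"
        using C(1) r \<beta> by (subst (asm) ennreal_le_iff) auto
      then show ?thesis using \<beta> by (simp add: dil_def abs_mult trunc_dil mult.assoc)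
    qed
    moreover have "(\<lambda>N. \<beta> ^ length w * \<bar>F (trunc N (dil r b)) (axis j 1) w\<bar>)
        \<longlonglongrightarrow> \<beta> ^ length w * \<bar>F (dil r b) (axis j 1) w\<bar>"
      using a by (intro tendsto_intros F_tendsto tdist_trunc_tendsto p)
        (auto simp: Tl1_def trunc_Tl trunc_def)
    ultimately show "\<beta> ^ length w * \<bar>F (dil r b) (axis j 1) w\<bar> \<le> C * (1 + r) * \<beta>"
      by (intro LIMSEQ_le_const2) auto
  qed
qed

lemma F_first_level:
  assumes a: "a \<in> Tl1 lam p" and w: "length w \<noteq> 1"
  shows "F a (axis j 1) w = 0"
proof (cases "w = []")
  case True
  then show ?thesis using F_lin[OF a] by (auto simp: lin_tM_def tM_def)
next
  case False
  then have n: "2 \<le> length w" using w by (cases w rule: remdups_adj.cases) auto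
  \<comment> \<open>\<open>tone\<close> is majorized level by level by \<open>a\<close> itself,
    whose level zero has norm 1, so no estimate of the weights is needed.\<close>
  have "(tone :: 'm tseries) \<in> Tl lam p"
  proof (rule Tl_of_majorant[of p "level_norm a"])
    show "level_norm (tone :: 'm tseries) n \<le> level_norm a n" for n
    proof (cases n)
      case 0
      then show ?thesis using a by (simp add: level_norm_def tone_def Tl1_def)
    next
      case (Suc m)
      then have "(\<Sum>w::'m list | length w = n. (tone w)\<^sup>2) = 0" by (intro sum.neutral) (auto simp: tone_def)
      then show ?thesis unfolding level_norm_def by (simp add: sum_nonneg)
    qed
  qed (use a in \<open>simp add: Tl1_def Tl_iff tnorm_eq_seqnorm\<close>)
  then have fin: "tnorm lam p (a - tone) < \<infinity>"
    using tnorm_diff_finite a by (auto simp: Tl1_def)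
  define R where "R = enn2real (tnorm lam p (a - tone)) + 1"
  have R: "R > 0" "tnorm lam p (a - tone) \<le> ennreal R"
    using fin by (auto simp: R_def ennreal_enn2real_if intro: add_nonneg_pos)
  obtain C where C: "C > 0"
    "\<And>b r w \<beta>. \<lbrakk>0 \<le> r; dil r b \<in> Tl1 lam p; b [] = 1; tnorm lam p (b - tone) \<le> ennreal R; 0 \<le> \<beta>\<rbrakk>
      \<Longrightarrow> \<beta> ^ length w * \<bar>F (dil r b) (axis j 1) w\<bar> \<le> C * (1 + r) * \<beta>"
    using F_growth_Tl1[OF R(1), where j = j] by metis
  have "dil 1 a = a" by (simp add: dil_def fun_eq_iff)
  \<comment> \<open>With b = a and r = 1 the bound is linear in \<beta> on the right but of order at
    least two on the left.\<close>
  then have "\<beta> ^ length w * \<bar>F a (axis j 1) w\<bar> \<le> (C * 2) * \<beta>" if "0 \<le> \<beta>" for \<beta>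
    using C(2)[of 1 a \<beta> w] a R(2) that by (simp add: Tl1_def)
  then have "\<bar>F a (axis j 1) w\<bar> = 0"
    using n by (intro eq_0_of_superlinear_bound[of _ "length w" "C * 2"]) auto
  then show ?thesis by simp
qed

text \<open>On words of length one both sides are linear in \<beta>, so \<beta> = 1 loses nothing;
  summing the constants over the columns makes the bound uniform in j.\<close>

lemma F_linear_growth:
  assumes R: "R > 0"
  obtains C where "C > 0"
    "\<And>b r j c. \<lbrakk>0 \<le> r; dil r b \<in> Tl1 lam p; b [] = 1; tnorm lam p (b - tone) \<le> ennreal R\<rbrakk>
      \<Longrightarrow> \<bar>F (dil r b) (axis j 1) [c]\<bar> \<le> C * (1 + r)"
proof -
  have "\<exists>C>0. \<forall>b r c. 0 \<le> r \<longrightarrow> dil r b \<in> Tl1 lam p \<longrightarrow> b [] = 1 \<longrightarrow> tnorm lam p (b - tone) \<le> ennreal R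
      \<longrightarrow> \<bar>F (dil r b) (axis j 1) [c]\<bar> \<le> C * (1 + r)" for j
  proof -
    obtain C where C: "C > 0"
      "\<And>b r w \<beta>. \<lbrakk>0 \<le> r; dil r b \<in> Tl1 lam p; b [] = 1; tnorm lam p (b - tone) \<le> ennreal R; 0 \<le> \<beta>\<rbrakk>
        \<Longrightarrow> \<beta> ^ length w * \<bar>F (dil r b) (axis j 1) w\<bar> \<le> C * (1 + r) * \<beta>"
      using F_growth_Tl1[OF R, where j = j] by metis
    show ?thesis
      using C(1) C(2)[where \<beta> = 1 and w = "[c]" for c] by (intro exI[of _ C]) simp
  qed
  then obtain C where C: "\<And>j. C j > 0" and
    bound: "\<And>j b r c. 0 \<le> r \<Longrightarrow> dil r b \<in> Tl1 lam p \<Longrightarrow> b [] = 1 \<Longrightarrow> tnorm lam p (b - tone) \<le> ennreal R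
      \<Longrightarrow> \<bar>F (dil r b) (axis j 1) [c]\<bar> \<le> C j * (1 + r)" by metis
  show thesis
  proof (rule that[of "\<Sum>j\<in>UNIV. C j"])
    show "(\<Sum>j\<in>UNIV. C j) > 0" using C by (intro sum_pos) auto
    fix b :: "'m tseries" and r :: real and j c
    assume *: "0 \<le> r" "dil r b \<in> Tl1 lam p" "b [] = 1" "tnorm lam p (b - tone) \<le> ennreal R"
    have "\<bar>F (dil r b) (axis j 1) [c]\<bar> \<le> C j * (1 + r)" by (rule bound[OF *])
    also have "\<dots> \<le> (\<Sum>j\<in>UNIV. C j) * (1 + r)"
      using C *(1) by (intro mult_right_mono member_le_sum) (auto simp: less_imp_le)
    finally show "\<bar>F (dil r b) (axis j 1) [c]\<bar> \<le> (\<Sum>j\<in>UNIV. C j) * (1 + r)" .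
  qed
qed

text \<open>As \<open>F\<close> lives on level one, only the cut before the last letter survives.
  The integrand at \<open>w @ [c]\<close> then involves \<open>a\<close> itself as a factor only at
  the shorter word \<open>w\<close>; this makes the equation triangular in the word length once the
  velocity is fixed.\<close>

lemma tprod_F:
  assumes "a \<in> Tl1 lam p"
  shows "(a \<otimes>\<^sub>t F a (axis j 1)) [] = 0"
    and "(a \<otimes>\<^sub>t F a (axis j 1)) (w @ [c]) = a w * F a (axis j 1) [c]"
proof -
  show "(a \<otimes>\<^sub>t F a (axis j 1)) [] = 0"
    using F_first_level[OF assms, of "[]" j] by (simp add: tprod_def)
  have "(a \<otimes>\<^sub>t F a (axis j 1)) (w @ [c]) =
      (\<Sum>i\<in>{length w}. a (take i (w @ [c])) * F a (axis j 1) (drop i (w @ [c])))"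
    unfolding tprod_def
  proof (rule sum.mono_neutral_right)
    show "\<forall>i\<in>{..length (w @ [c])} - {length w}. a (take i (w @ [c])) * F a (axis j 1) (drop i (w @ [c])) = 0"
      using F_first_level[OF assms] by auto
  qed auto
  then show "(a \<otimes>\<^sub>t F a (axis j 1)) (w @ [c]) = a w * F a (axis j 1) [c]" by simp
qed

end

section \<open>Signatures of Lipschitz-driven paths\<close>

text \<open>Meaningful where the integral exists; uniqueness then identifies the chosen
  value.\<close>

definition rsint :: "(real \<Rightarrow> real) \<Rightarrow> (real \<Rightarrow> real) \<Rightarrow> real \<Rightarrow> real" where
  "rsint g y t = (SOME I. has_RS_integral g y 0 t I)"

lemma rsint_eq: "has_RS_integral g y 0 t I \<Longrightarrow> rsint g y t = I"
  unfolding rsint_def by (metis has_RS_integral_unique someI)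

text \<open>Primitive recursion consumes the head of a list, whereas the outermost integration
  belongs to the last letter of a word; hence words enter reversed.\<close>

primrec sigrev :: "(real \<Rightarrow> real ^ 'd) \<Rightarrow> (real \<Rightarrow> 'd::finite \<Rightarrow> 'm \<Rightarrow> real) \<Rightarrow> 'm list \<Rightarrow> real \<Rightarrow> real" where
  "sigrev x v [] = (\<lambda>t. 1)"
| "sigrev x v (c # w) = (\<lambda>t. \<Sum>j\<in>UNIV. rsint (\<lambda>u. sigrev x v w u * v u j c) (\<lambda>u. x u $ j) t)"

text \<open>The signature of the path with $\mathrm{d}h^c=\sum_j v_{jc}\,\mathrm{d}x^j$; a word records the innermost integration first.\<close>

definition sig :: "(real \<Rightarrow> real ^ 'd) \<Rightarrow> (real \<Rightarrow> 'd::finite \<Rightarrow> 'm \<Rightarrow> real) \<Rightarrow> real \<Rightarrow> 'm tseries" where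
  "sig x v t w = sigrev x v (rev w) t"

lemma sig_Nil [simp]: "sig x v t [] = 1"
  by (simp add: sig_def)

lemma sig_snoc: "sig x v t (w @ [c]) = (\<Sum>j\<in>UNIV. rsint (\<lambda>u. sig x v u w * v u j c) (\<lambda>u. x u $ j) t)"
  by (simp add: sig_def)

lemma tprod_snoc:
  "(a \<otimes>\<^sub>t b) (w @ [c]) = a (w @ [c]) * b [] + (\<Sum>i\<le>length w. a (take i w) * b (drop i w @ [c]))"
proof -
  have "(a \<otimes>\<^sub>t b) (w @ [c]) =
      (\<Sum>i\<le>length w. a (take i (w @ [c])) * b (drop i (w @ [c]))) + a (w @ [c]) * b []"
    by (simp add: tprod_def)
  also have "(\<Sum>i\<le>length w. a (take i (w @ [c])) * b (drop i (w @ [c])))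
      = (\<Sum>i\<le>length w. a (take i w) * b (drop i w @ [c]))"
    by (intro sum.cong) auto
  finally show ?thesis by simp
qed

lemma tprod_diff_left: "(a - a') \<otimes>\<^sub>t b = a \<otimes>\<^sub>t b - a' \<otimes>\<^sub>t b"
  by (auto simp: tprod_def fun_eq_iff left_diff_distrib sum_subtractf)

lemma tprod_diff_right: "a \<otimes>\<^sub>t (b - b') = a \<otimes>\<^sub>t b - a \<otimes>\<^sub>t b'"
  by (auto simp: tprod_def fun_eq_iff right_diff_distrib sum_subtractf)

lemma dil_tprod:
  fixes a b :: "'a tseries"
  shows "dil r (a \<otimes>\<^sub>t b) = dil r a \<otimes>\<^sub>t dil r b"
proof
  fix w :: "'a list"
  have "r ^ length w = r ^ length (take i w) * r ^ length (drop i w)" if "i \<le> length w" for i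
    using that by (simp flip: power_add)
  then show "dil r (a \<otimes>\<^sub>t b) w = (dil r a \<otimes>\<^sub>t dil r b) w"
    unfolding dil_def tprod_def sum_distrib_left by (intro sum.cong) auto
qed

text \<open>The inequality n + 1 <= 2^(n+1) pays for the missing factor of the factorial by doubling
  the base. It raises a bound of order n to order n + 1 after multiplication by one more
  factor.\<close>

lemma mult_power_fact_le:
  fixes a b q :: real
  assumes "0 \<le> a" "a \<le> q" "0 \<le> b" "b \<le> q"
  shows "a * (b ^ n / fact n) \<le> (2 * q) ^ Suc n / fact (Suc n)"
proof -
  have "Suc n \<le> 2 ^ Suc n" by (rule less_imp_le[OF less_exp])
  then have "real (Suc n) \<le> real (2 ^ Suc n)" by (rule of_nat_mono)
  then have 1: "real (Suc n) \<le> 2 ^ Suc n" by simp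
  have 2: "a * b ^ n \<le> q * q ^ n"
    using assms by (intro mult_mono power_mono) auto
  have "real (Suc n) * (a * b ^ n) \<le> 2 ^ Suc n * (q * q ^ n)"
    by (rule mult_mono[OF 1 2]) (use assms in auto)
  then have "real (Suc n) * (a * b ^ n) / fact (Suc n) \<le> (2 * q) ^ Suc n / fact (Suc n)"
    unfolding power_mult_distrib power_Suc[of q] by (rule divide_right_mono) simp
  then show ?thesis by simp
qed

locale lipschitz_control =
  fixes x :: "real \<Rightarrow> real ^ 'd::finite" and T L :: real
  assumes T: "0 < T" and x: "L-lipschitz_on {0..T} x"
begin

lemma L_nonneg: "0 \<le> L"
  using x by (rule lipschitz_on_nonneg)

lemma x_coord: "L-lipschitz_on {0..T} (\<lambda>u. x u $ j)"
proof (rule lipschitz_onI[OF _ L_nonneg])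
  fix s t assume "s \<in> {0..T}" "t \<in> {0..T}"
  then have "dist (x s) (x t) \<le> L * dist s t" by (rule lipschitz_onD[OF x])
  then show "dist (x s $ j) (x t $ j) \<le> L * dist s t"
    using dist_vec_nth_le[of "x s" j "x t"] by linarith
qed

text \<open>Both values of \<open>rsint\<close> come from one primitive \<open>H\<close>, whose
  increments are the integrals over all subintervals.\<close>

lemma rsint_increment:
  assumes "continuous_on {0..T} g" "0 \<le> s" "s \<le> t" "t \<le> T"
  shows "has_RS_integral g (\<lambda>u. x u $ j) s t (rsint g (\<lambda>u. x u $ j) t - rsint g (\<lambda>u. x u $ j) s)"
proof -
  obtain H where H: "\<And>s t. \<lbrakk>0 \<le> s; s \<le> t; t \<le> T\<rbrakk> \<Longrightarrow> has_RS_integral g (\<lambda>u. x u $ j) s t (H t - H s)"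
    using lipschitz_RS_primitive[OF x_coord assms(1)] by blast
  have "rsint g (\<lambda>u. x u $ j) r = H r - H 0" if "0 \<le> r" "r \<le> T" for r
    using that by (intro rsint_eq H) auto
  then show ?thesis using H[of s t] assms by simp
qed

lemma rsint_0: "continuous_on {0..T} g \<Longrightarrow> rsint g (\<lambda>u. x u $ j) 0 = 0"
  using lipschitz_RS_primitive[OF x_coord, of g j] T
  by (metis diff_self order_refl order_less_imp_le rsint_eq)

lemma rsint:
  assumes "continuous_on {0..T} g" "t \<in> {0..T}"
  shows "has_RS_integral g (\<lambda>u. x u $ j) 0 t (rsint g (\<lambda>u. x u $ j) t)"
  using rsint_increment[OF assms(1), of 0 t j] rsint_0[OF assms(1)] assms(2) by simp

text \<open>This replaces integral estimates by the check of a derivative. If h = P' dominates L d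
  |g_j| for each of the d components, every single integral is at most (P t - P s)/d, and the sum is
  at most P t - P s.\<close>

lemma sum_rsint_bound:
  assumes g: "\<And>j. continuous_on {0..T} (g j)" and st: "0 \<le> s" "s \<le> t" "t \<le> T"
    and P: "\<And>u. u \<in> {0..T} \<Longrightarrow> (P has_real_derivative h u) (at u within {0..T})"
    and gh: "\<And>u j. u \<in> {s..t} \<Longrightarrow> L * real CARD('d) * \<bar>g j u\<bar> \<le> h u"
  shows "\<bar>\<Sum>j\<in>UNIV. rsint (g j) (\<lambda>u. x u $ j) t - rsint (g j) (\<lambda>u. x u $ j) s\<bar> \<le> P t - P s"
proof -
  have "(h has_integral (P t - P s)) {s..t}"
  proof (rule fundamental_theorem_of_calculus)
    fix u assume "u \<in> {s..t}"
    then show "(P has_vector_derivative h u) (at u within {s..t})"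
      using P[of u] st unfolding has_real_derivative_iff_has_vector_derivative
      by (auto elim!: has_vector_derivative_within_subset)
  qed (use st in auto)
  then have hi: "((\<lambda>u. h u / real CARD('d)) has_integral ((P t - P s) / real CARD('d))) {s..t}"
    using has_integral_divide by blast
  have "\<bar>rsint (g j) (\<lambda>u. x u $ j) t - rsint (g j) (\<lambda>u. x u $ j) s\<bar> \<le> (P t - P s) / real CARD('d)" for j
  proof (rule has_RS_integral_bound[OF rsint_increment[OF g st] _ hi])
    show "L-lipschitz_on {s..t} (\<lambda>u. x u $ j)"
      using x_coord by (rule lipschitz_on_subset) (use st in auto)
    show "L * \<bar>g j u\<bar> \<le> h u / real CARD('d)" if "u \<in> {s..t}" for u
      using gh[OF that, of j] by (simp add: field_simps)
  qed
  then have "(\<Sum>j\<in>UNIV. \<bar>rsint (g j) (\<lambda>u. x u $ j) t - rsint (g j) (\<lambda>u. x u $ j) s\<bar>)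
      \<le> (\<Sum>j\<in>(UNIV::'d set). (P t - P s) / real CARD('d))"
    by (intro sum_mono)
  then show ?thesis by (intro order_trans[OF sum_abs]) simp
qed

lemma rsint_continuous:
  assumes g: "continuous_on {0..T} g"
  shows "continuous_on {0..T} (rsint g (\<lambda>u. x u $ j))"
proof -
  obtain B where B: "\<And>r. r \<in> {0..T} \<Longrightarrow> \<bar>g r\<bar> \<le> B"
    using compact_imp_bounded[OF compact_continuous_image[OF g compact_Icc]]
    by (metis bounded_iff imageI real_norm_def)
  have B0: "0 \<le> B" using B[of 0] T by auto
  have *: "\<bar>rsint g (\<lambda>u. x u $ j) t - rsint g (\<lambda>u. x u $ j) s\<bar> \<le> (L * B) * (t - s)"
    if "0 \<le> s" "s \<le> t" "t \<le> T" for s t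
  proof (rule has_RS_integral_bound[OF rsint_increment[OF g that]])
    show "L-lipschitz_on {s..t} (\<lambda>u. x u $ j)"
      using x_coord by (rule lipschitz_on_subset) (use that in auto)
    show "((\<lambda>u. L * B) has_integral L * B * (t - s)) {s..t}"
      using has_integral_const_real[of "L * B" s t] that by (simp add: mult.commute)
    show "L * \<bar>g u\<bar> \<le> L * B" if "u \<in> {s..t}" for u
      using B that \<open>0 \<le> s\<close> \<open>t \<le> T\<close> L_nonneg by (intro mult_left_mono) auto
  qed
  have "(L * B)-lipschitz_on {0..T} (rsint g (\<lambda>u. x u $ j))"
  proof (rule lipschitz_onI)
    fix s t assume st: "s \<in> {0..T}" "t \<in> {0..T}"
    then show "dist (rsint g (\<lambda>u. x u $ j) s) (rsint g (\<lambda>u. x u $ j) t) \<le> L * B * dist s t"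
      using *[of s t] *[of t s] by (cases "s \<le> t") (auto simp: dist_real_def abs_minus_commute)
  qed (use L_nonneg B0 in simp)
  then show ?thesis by (rule lipschitz_on_continuous_on)
qed

definition cont :: "(real \<Rightarrow> 'd \<Rightarrow> 'm \<Rightarrow> real) \<Rightarrow> bool" where
  "cont v \<longleftrightarrow> (\<forall>j c. continuous_on {0..T} (\<lambda>u. v u j c))"

lemma sig_continuous:
  assumes "cont v"
  shows "continuous_on {0..T} (\<lambda>u. sig x v u w)"
proof (induction w rule: rev_induct)
  case (snoc c w)
  have "continuous_on {0..T} (\<lambda>u. sig x v u w * v u j c)" for j
    using assms snoc.IH by (auto simp: cont_def intro: continuous_on_mult)
  then show ?case
    unfolding sig_snoc by (intro continuous_on_sum rsint_continuous)
qed simp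

lemma sig_integrand_continuous:
  assumes "cont v"
  shows "continuous_on {0..T} (\<lambda>u. sig x v u w * v u j c)"
  using sig_continuous[OF assms, of w] assms by (auto simp: cont_def intro: continuous_on_mult)

text \<open>If |sig| <= P^n/n! at a word of length n and P' dominates the speed, the next integrand
  is dominated by P' P^n/n!, the derivative of P^(n+1)/(n+1)!. A general \<open>P\<close> is kept
  because uniform bounds use a linear one and the a priori estimate an exponential one.\<close>

lemma sig_bound:
  assumes v: "cont v" and P: "\<And>u. u \<in> {0..T} \<Longrightarrow> (P has_real_derivative h u) (at u within {0..T})"
    and P0: "\<And>u. u \<in> {0..T} \<Longrightarrow> 0 \<le> P u"
    and vh: "\<And>u j c. u \<in> {0..T} \<Longrightarrow> L * real CARD('d) * \<bar>v u j c\<bar> \<le> h u"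
    and t: "t \<in> {0..T}"
  shows "\<bar>sig x v t w\<bar> \<le> P t ^ length w / fact (length w)"
  using t
proof (induction w arbitrary: t rule: rev_induct)
  case (snoc c w)
  let ?n = "length w"
  let ?Q = "\<lambda>u. P u ^ Suc ?n / fact (Suc ?n)"
  have c: "continuous_on {0..T} (\<lambda>u. sig x v u w * v u j c)" for j
    by (rule sig_integrand_continuous[OF v])
  have "\<bar>\<Sum>j\<in>UNIV. rsint (\<lambda>u. sig x v u w * v u j c) (\<lambda>u. x u $ j) t
      - rsint (\<lambda>u. sig x v u w * v u j c) (\<lambda>u. x u $ j) 0\<bar> \<le> ?Q t - ?Q 0"
  proof (rule sum_rsint_bound[OF c])
    show "(?Q has_real_derivative (P u ^ ?n / fact ?n * h u)) (at u within {0..T})" if "u \<in> {0..T}" for u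
      by (rule derivative_eq_intros P that refl | simp)+
    show "L * real CARD('d) * \<bar>sig x v u w * v u j c\<bar> \<le> P u ^ ?n / fact ?n * h u" if "u \<in> {0..t}" for u j
    proof -
      have u: "u \<in> {0..T}" using that snoc.prems by auto
      have "\<bar>sig x v u w\<bar> * (L * real CARD('d) * \<bar>v u j c\<bar>) \<le> P u ^ ?n / fact ?n * h u"
        using snoc.IH[OF u] vh[OF u, of j c] P0[OF u] L_nonneg by (intro mult_mono) auto
      then show ?thesis by (simp add: abs_mult ac_simps)
    qed
  qed (use snoc.prems in auto)
  moreover have "0 \<le> ?Q 0" using P0[of 0] T by simp
  ultimately show ?case by (simp add: sig_snoc rsint_0[OF c])
qed simp

lemma sig_bound_linear:
  assumes v: "cont v" and A: "0 \<le> A"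
    and vA: "\<And>u j c. u \<in> {0..T} \<Longrightarrow> L * real CARD('d) * \<bar>v u j c\<bar> \<le> A" and t: "t \<in> {0..T}"
  shows "\<bar>sig x v t w\<bar> \<le> (A * t) ^ length w / fact (length w)"
proof (rule sig_bound[OF v _ _ vA t])
  show "((*) A has_real_derivative A) (at u within {0..T})" for u
    by (rule derivative_eq_intros refl | simp)+
qed (use A in auto)

text \<open>The integrand splits into (sig v - sig v') v and sig v' (v - v'). With E_n = (2 (1 + A
  t))^n/n!, the derivative of D E_(n+1) is \<psi> E_(n+1) + 2 A D E_n, which dominates both parts.
  The base 2 (1 + A t) is chosen so that the plain bound (A t)^n/n! for sig v' is at most
  E_(n+1).\<close>

lemma sig_diff_bound:
  assumes v: "cont v" and v': "cont v'" and A: "0 \<le> A"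
    and vA: "\<And>u j c. u \<in> {0..T} \<Longrightarrow> L * real CARD('d) * \<bar>v u j c\<bar> \<le> A"
    and v'A: "\<And>u j c. u \<in> {0..T} \<Longrightarrow> L * real CARD('d) * \<bar>v' u j c\<bar> \<le> A"
    and D: "\<And>u. u \<in> {0..T} \<Longrightarrow> (D has_real_derivative \<psi> u) (at u within {0..T})"
    and D0: "\<And>u. u \<in> {0..T} \<Longrightarrow> 0 \<le> D u"
    and vv': "\<And>u j c. u \<in> {0..T} \<Longrightarrow> L * real CARD('d) * \<bar>v u j c - v' u j c\<bar> \<le> \<psi> u"
    and t: "t \<in> {0..T}"
  shows "\<bar>sig x v t w - sig x v' t w\<bar> \<le> D t * ((2 * (1 + A * t)) ^ length w / fact (length w))"
  using t
proof (induction w arbitrary: t rule: rev_induct)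
  case (snoc c w)
  let ?n = "length w"
  let ?E = "\<lambda>n u. (2 * (1 + A * u)) ^ n / fact n"
  let ?Q = "\<lambda>u. D u * ?E (Suc ?n) u"
  let ?g = "\<lambda>j u. sig x v u w * v u j c" and ?g' = "\<lambda>j u. sig x v' u w * v' u j c"
  have c: "continuous_on {0..T} (?g j)" and c': "continuous_on {0..T} (?g' j)" for j
    by (rule sig_integrand_continuous, fact)+
  have cc: "continuous_on {0..T} (\<lambda>u. ?g j u - ?g' j u)" for j
    by (intro continuous_on_diff c c')
  have lin: "rsint (\<lambda>u. ?g j u - ?g' j u) (\<lambda>u. x u $ j) t = rsint (?g j) (\<lambda>u. x u $ j) t - rsint (?g' j) (\<lambda>u. x u $ j) t" for j
    using has_RS_integral_add[OF rsint[OF c snoc.prems] has_RS_integral_cmult[OF rsint[OF c' snoc.prems], where c = "-1"]]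
    by (intro rsint_eq) simp
  have "\<bar>\<Sum>j\<in>UNIV. rsint (\<lambda>u. ?g j u - ?g' j u) (\<lambda>u. x u $ j) t
      - rsint (\<lambda>u. ?g j u - ?g' j u) (\<lambda>u. x u $ j) 0\<bar> \<le> ?Q t - ?Q 0"
  proof (rule sum_rsint_bound[OF cc])
    show "(?Q has_real_derivative (\<psi> u * ?E (Suc ?n) u + D u * (2 * A * ?E ?n u))) (at u within {0..T})"
      if "u \<in> {0..T}" for u
      by (rule derivative_eq_intros D that refl | simp)+
    show "L * real CARD('d) * \<bar>?g j u - ?g' j u\<bar> \<le> \<psi> u * ?E (Suc ?n) u + D u * (2 * A * ?E ?n u)"
      if "u \<in> {0..t}" for u j
    proof -
      have u: "u \<in> {0..T}" using that snoc.prems by auto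
      have Au: "0 \<le> A * u" using A u by simp
      let ?K = "L * real CARD('d)"
      have K: "0 \<le> ?K" using L_nonneg by simp
      have E: "0 \<le> ?E ?n u" using Au by simp
      have expand: "(A * u) ^ ?n / fact ?n \<le> ?E (Suc ?n) u"
        using mult_power_fact_le[of 1 "1 + A * u" "A * u" ?n] Au by simp
      have \<psi>: "0 \<le> \<psi> u" using vv'[OF u, of undefined undefined] K by (meson abs_ge_zero mult_nonneg_nonneg order_trans)
      have "?g j u - ?g' j u = (sig x v u w - sig x v' u w) * v u j c + sig x v' u w * (v u j c - v' u j c)"
        by (simp add: algebra_simps)
      then have "?K * \<bar>?g j u - ?g' j u\<bar> \<le> \<bar>sig x v u w - sig x v' u w\<bar> * (?K * \<bar>v u j c\<bar>) + \<bar>sig x v' u w\<bar> * (?K * \<bar>v u j c - v' u j c\<bar>)"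
        using mult_left_mono[OF abs_triangle_ineq[of "(sig x v u w - sig x v' u w) * v u j c" "sig x v' u w * (v u j c - v' u j c)"] K]
        by (simp add: abs_mult distrib_left ac_simps)
      moreover have "\<bar>sig x v u w - sig x v' u w\<bar> * (?K * \<bar>v u j c\<bar>) \<le> (D u * ?E ?n u) * A"
        using snoc.IH[OF u] vA[OF u, of j c] D0[OF u] E K by (intro mult_mono) auto
      moreover have "0 \<le> D u * ?E ?n u * A"
        by (intro mult_nonneg_nonneg D0[OF u] E A)
      moreover have "D u * (2 * A * ?E ?n u) = 2 * (D u * ?E ?n u * A)"
        by (simp only: ac_simps)
      moreover have "\<bar>sig x v' u w\<bar> * (?K * \<bar>v u j c - v' u j c\<bar>) \<le> ?E (Suc ?n) u * \<psi> u"
        using order_trans[OF sig_bound_linear[OF v' A v'A u] expand] vv'[OF u, of j c] \<psi> K Au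
        by (intro mult_mono) auto
      ultimately show ?thesis
        by (simp only: mult.commute[of "\<psi> u"])
    qed
  qed (use snoc.prems in auto)
  moreover have "0 \<le> ?Q 0" using D0[of 0] T by simp
  ultimately show ?case by (simp add: sig_snoc rsint_0[OF cc] lin sum_subtractf)
qed (use D0 in simp)

text \<open>The outermost integrand at a word of length n + 1 is at most A (A T)^n/n!, so a factor t
  - s comes out and the factorial decay remains. (A + 1)(T + 1) dominates both A and A T; the 2
  stems from \<open>mult_power_fact_le\<close>.\<close>

lemma sig_time_bound:
  assumes v: "cont v" and A: "0 \<le> A"
    and vA: "\<And>u j c. u \<in> {0..T} \<Longrightarrow> L * real CARD('d) * \<bar>v u j c\<bar> \<le> A"
    and st: "0 \<le> s" "s \<le> t" "t \<le> T"
  shows "\<bar>sig x v t w - sig x v s w\<bar> \<le> expseq (t - s) (2 * ((A + 1) * (T + 1))) (length w)"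
proof (cases w rule: rev_cases)
  case Nil
  then show ?thesis using st by (simp add: expseq_def)
next
  case (snoc w' c)
  let ?n = "length w'"
  define K where "K = A * ((A * T) ^ ?n / fact ?n)"
  have c: "continuous_on {0..T} (\<lambda>u. sig x v u w' * v u j c)" for j
    by (rule sig_integrand_continuous[OF v])
  have AT: "0 \<le> A * T" using A T by simp
  have "\<bar>\<Sum>j\<in>UNIV. rsint (\<lambda>u. sig x v u w' * v u j c) (\<lambda>u. x u $ j) t
      - rsint (\<lambda>u. sig x v u w' * v u j c) (\<lambda>u. x u $ j) s\<bar> \<le> K * t - K * s"
  proof (rule sum_rsint_bound[OF c st])
    show "((*) K has_real_derivative K) (at u within {0..T})" for u
      by (rule derivative_eq_intros refl | simp)+
    show "L * real CARD('d) * \<bar>sig x v u w' * v u j c\<bar> \<le> K" if "u \<in> {s..t}" for u j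
    proof -
      have u: "u \<in> {0..T}" using that st by auto
      have "\<bar>sig x v u w'\<bar> \<le> (A * u) ^ ?n / fact ?n" by (rule sig_bound_linear[OF v A vA u])
      also have "\<dots> \<le> (A * T) ^ ?n / fact ?n"
        using u A by (intro divide_right_mono power_mono mult_left_mono) auto
      finally have "\<bar>sig x v u w'\<bar> * (L * real CARD('d) * \<bar>v u j c\<bar>) \<le> (A * T) ^ ?n / fact ?n * A"
        using vA[OF u, of j c] AT L_nonneg by (intro mult_mono) auto
      then show ?thesis by (simp add: K_def abs_mult ac_simps)
    qed
  qed
  then have "\<bar>sig x v t w - sig x v s w\<bar> \<le> (t - s) * K"
    unfolding snoc sig_snoc by (simp only: sum_subtractf mult.commute[of _ K] right_diff_distrib)
  also have "\<dots> \<le> (t - s) * ((2 * ((A + 1) * (T + 1))) ^ Suc ?n / fact (Suc ?n))"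
    unfolding K_def using st A T by (intro mult_left_mono mult_power_fact_le) (auto simp: algebra_simps)
  finally show ?thesis by (simp only: snoc expseq_def length_append_singleton)
qed

lemma tprod_sig_RS:
  assumes v: "cont v" and t: "t \<in> {0..T}"
  shows "has_RS_integral (\<lambda>u. (a \<otimes>\<^sub>t sig x v u) w * v u j c) (\<lambda>u. x u $ j) 0 t
    (\<Sum>i\<le>length w. a (take i w) * rsint (\<lambda>u. sig x v u (drop i w) * v u j c) (\<lambda>u. x u $ j) t)"
proof -
  have "has_RS_integral (\<lambda>u. \<Sum>i\<le>length w. a (take i w) * (sig x v u (drop i w) * v u j c)) (\<lambda>u. x u $ j) 0 t
    (\<Sum>i\<le>length w. a (take i w) * rsint (\<lambda>u. sig x v u (drop i w) * v u j c) (\<lambda>u. x u $ j) t)"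
    by (intro has_RS_integral_sum has_RS_integral_cmult rsint sig_integrand_continuous v t) simp
  then show ?thesis
    by (rule has_RS_integral_cong) (simp add: tprod_def sum_distrib_right mult.assoc)
qed

lemma tprod_sig_snoc:
  "(a \<otimes>\<^sub>t sig x v t) (w @ [c]) = a (w @ [c]) + (\<Sum>j\<in>UNIV. \<Sum>i\<le>length w.
     a (take i w) * rsint (\<lambda>u. sig x v u (drop i w) * v u j c) (\<lambda>u. x u $ j) t)"
  unfolding tprod_snoc sig_snoc sum_distrib_left by (subst sum.swap) simp

text \<open>For a given velocity the system is triangular: the coefficient at \<open>w @ [c]\<close>
  is an integral of the coefficient at \<open>w\<close>. Induction on the word and uniqueness of the
  integral suffice, with no Gronwall argument and no norm.\<close>

lemma linear_equation_unique:
  assumes v: "cont v" and Nil: "\<And>t. t \<in> {0..T} \<Longrightarrow> S t [] = a []"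
    and eq: "\<And>t w c. t \<in> {0..T} \<Longrightarrow> \<exists>I. (\<forall>j. has_RS_integral (\<lambda>u. S u w * v u j c) (\<lambda>u. x u $ j) 0 t (I j))
        \<and> S t (w @ [c]) = a (w @ [c]) + (\<Sum>j\<in>UNIV. I j)"
    and t: "t \<in> {0..T}"
  shows "S t w = (a \<otimes>\<^sub>t sig x v t) w"
  using t
proof (induction w arbitrary: t rule: rev_induct)
  case Nil
  then show ?case using assms(2) by (simp add: tprod_def)
next
  case (snoc c w)
  obtain I where I: "\<And>j. has_RS_integral (\<lambda>u. S u w * v u j c) (\<lambda>u. x u $ j) 0 t (I j)"
    "S t (w @ [c]) = a (w @ [c]) + (\<Sum>j\<in>UNIV. I j)"
    using eq[OF snoc.prems, of w c] by blast
  have "has_RS_integral (\<lambda>u. (a \<otimes>\<^sub>t sig x v u) w * v u j c) (\<lambda>u. x u $ j) 0 t (I j)" for j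
    by (rule has_RS_integral_cong[OF I(1)]) (use snoc in auto)
  from has_RS_integral_unique[OF this tprod_sig_RS[OF v snoc.prems]]
  show ?case unfolding I(2) tprod_sig_snoc by simp
qed

end

section \<open>Stability of the flow map\<close>

locale controlled_rde = tensor_rde lam p M F + lipschitz_control x T L
  for lam :: "nat \<Rightarrow> real" and p :: real and M :: nat
    and F :: "'m::finite tseries \<Rightarrow> real ^ 'd::finite \<Rightarrow> 'm tseries"
    and x :: "real \<Rightarrow> real ^ 'd" and T L :: real
begin

text \<open>By \<open>F_first_level\<close> these coordinates determine the columns of
  \<open>F\<close> on its domain.\<close>

definition vel :: "'m tseries \<Rightarrow> 'd \<Rightarrow> 'm \<Rightarrow> real" where
  "vel a j c = F a (axis j 1) [c]"

definition flow :: "'m tseries \<Rightarrow> (real \<Rightarrow> 'd \<Rightarrow> 'm \<Rightarrow> real) \<Rightarrow> real \<Rightarrow> 'm tseries" where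
  "flow a v t = a \<otimes>\<^sub>t sig x v t"

definition bounded_by :: "real \<Rightarrow> (real \<Rightarrow> 'd \<Rightarrow> 'm \<Rightarrow> real) \<Rightarrow> bool" where
  "bounded_by K v \<longleftrightarrow> cont v \<and> (\<forall>u\<in>{0..T}. \<forall>j c. \<bar>v u j c\<bar> \<le> K)"

definition rate :: "real \<Rightarrow> real" where
  "rate K = L * real CARD('d) * K"

lemma bounded_byD:
  assumes "bounded_by K v"
  shows "cont v" "\<And>u j c. u \<in> {0..T} \<Longrightarrow> \<bar>v u j c\<bar> \<le> K"
    "\<And>u j c. u \<in> {0..T} \<Longrightarrow> L * real CARD('d) * \<bar>v u j c\<bar> \<le> rate K"
  using assms L_nonneg by (auto simp: bounded_by_def rate_def intro!: mult_left_mono)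

lemma rate_nonneg: "0 \<le> K \<Longrightarrow> 0 \<le> rate K"
  using L_nonneg by (simp add: rate_def)

lemma bounded_by_bound_nonneg: "bounded_by K v \<Longrightarrow> 0 \<le> K"
  using bounded_byD(2)[of K v 0 undefined undefined] T abs_ge_zero[of "v 0 undefined undefined"]
  by (auto intro: order_trans)

lemma flow_Nil [simp]: "flow a v t [] = a []"
  by (simp add: flow_def tprod_def)

lemma sig_bounded:
  assumes "bounded_by K v" "t \<in> {0..T}"
  shows "\<bar>sig x v t w\<bar> \<le> expseq 1 (rate K * T) (length w)"
proof -
  have A: "0 \<le> rate K" by (rule rate_nonneg[OF bounded_by_bound_nonneg[OF assms(1)]])
  have "\<bar>sig x v t w\<bar> \<le> (rate K * t) ^ length w / fact (length w)"
    by (rule sig_bound_linear[OF bounded_byD(1)[OF assms(1)] A bounded_byD(3)[OF assms(1)] assms(2)])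
  also have "\<dots> \<le> expseq 1 (rate K * T) (length w)"
    unfolding expseq_def mult_1 using A assms(2)
    by (intro divide_right_mono power_mono mult_left_mono) auto
  finally show ?thesis .
qed

text \<open>A single sequence that majorizes, at all times in [0,T], every flow with initial datum
  below \<open>s\<close> and velocity bounded by \<open>K\<close>.\<close>

definition maj :: "real \<Rightarrow> (nat \<Rightarrow> real) \<Rightarrow> nat \<Rightarrow> real" where
  "maj K s = conv s (expseq 1 (real CARD('m) * (rate K * T)))"

lemma flow_majorant:
  assumes "bounded_by K v" "t \<in> {0..T}" "\<And>n. level_norm a n \<le> s n"
  shows "level_norm (flow a v t) n \<le> maj K s n"
  unfolding flow_def maj_def
  by (rule level_norm_tprod_expseq[OF assms(3) sig_bounded[OF assms(1,2)]])

lemma majorant_nonneg: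
  assumes "\<And>n. level_norm a n \<le> s n"
  shows "0 \<le> s n"
  using order_trans[OF level_norm_nonneg assms] .

lemma maj_finite:
  assumes l: "1 < l" "l < l'" and s: "\<And>n. 0 \<le> s n" "seqnorm lam l s < \<infinity>" and K: "0 \<le> K"
  shows "seqnorm lam l' (maj K s) < \<infinity>"
proof -
  have "0 \<le> real CARD('m) * (rate K * T)" using rate_nonneg[OF K] T by simp
  then obtain C where C: "\<And>s c. (\<And>n. 0 \<le> s n) \<Longrightarrow> 0 \<le> c \<Longrightarrow>
       seqnorm lam l' (conv s (expseq c (real CARD('m) * (rate K * T)))) \<le> ennreal (C * c) * seqnorm lam l s"
    using seqnorm_conv_expseq[OF l] by metis
  have "seqnorm lam l' (maj K s) \<le> ennreal (C * 1) * seqnorm lam l s"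
    unfolding maj_def by (rule C[OF s(1)]) auto
  also have "\<dots> < \<infinity>" using s(2) by (simp add: ennreal_mult_less_top)
  finally show ?thesis .
qed

lemma flow_Tl:
  assumes "1 < l" "l < l'" "a \<in> Tl lam l" "bounded_by K v" "t \<in> {0..T}"
  shows "flow a v t \<in> Tl lam l'"
proof (rule Tl_of_majorant[OF maj_finite[OF assms(1,2)]])
  show "level_norm (flow a v t) n \<le> maj K (level_norm a) n" for n
    by (rule flow_majorant[OF assms(4,5)]) simp
qed (use assms bounded_by_bound_nonneg in \<open>auto simp: Tl_iff tnorm_eq_seqnorm\<close>)

lemma tdist_tprod_le:
  assumes l: "1 < l" "l < l'" and Q: "0 \<le> Q" and s: "seqnorm lam l s < \<infinity>"
  obtains C where "0 \<le> C"
    "\<And>a b b' c. \<lbrakk>\<And>n. level_norm a n \<le> s n; 0 \<le> c; \<And>w. \<bar>b w - b' w\<bar> \<le> expseq c Q (length w)\<rbrakk> \<Longrightarrow>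
       tnorm lam l' ((a::'m tseries) \<otimes>\<^sub>t b - a \<otimes>\<^sub>t b') \<le> ennreal (C * c)"
proof -
  have "0 \<le> real CARD('m) * Q" using Q by simp
  then obtain C where C: "0 \<le> C" "\<And>s c. (\<And>n. 0 \<le> s n) \<Longrightarrow> 0 \<le> c \<Longrightarrow>
       seqnorm lam l' (conv s (expseq c (real CARD('m) * Q))) \<le> ennreal (C * c) * seqnorm lam l s"
    using seqnorm_conv_expseq[OF l] by metis
  show thesis
  proof (rule that[of "C * enn2real (seqnorm lam l s)"])
    fix a b b' :: "'m tseries" and c
    assume a: "\<And>n. level_norm a n \<le> s n" and c: "0 \<le> c"
      and b: "\<And>w. \<bar>b w - b' w\<bar> \<le> expseq c Q (length w)"
    have "tnorm lam l' (a \<otimes>\<^sub>t b - a \<otimes>\<^sub>t b') \<le> seqnorm lam l' (conv s (expseq c (real CARD('m) * Q)))"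
      unfolding tnorm_eq_seqnorm tprod_diff_right[symmetric]
    proof (rule seqnorm_mono[OF lam_nonneg level_norm_tprod_expseq[OF a]])
      show "\<bar>(b - b') w\<bar> \<le> expseq c Q (length w)" for w using b by simp
    qed
    also have "\<dots> \<le> ennreal (C * c) * seqnorm lam l s"
      by (rule C(2)[OF majorant_nonneg[OF a] c])
    also have "seqnorm lam l s = ennreal (enn2real (seqnorm lam l s))" using s by simp
    also have "ennreal (C * c) * \<dots> = ennreal (C * enn2real (seqnorm lam l s) * c)"
      using C(1) c by (subst ennreal_mult[symmetric]) (auto simp: ac_simps)
    finally show "tnorm lam l' (a \<otimes>\<^sub>t b - a \<otimes>\<^sub>t b') \<le> ennreal (C * enn2real (seqnorm lam l s) * c)" .
  qed (use C(1) in simp)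
qed

text \<open>The difference splits into (a - a') \<otimes> sig v and a' \<otimes> (sig v - sig v'),
  two products with factorial majorants. \<open>D\<close> accumulates the velocity difference in
  time and is left free so that exponential weights can be inserted; \<open>C\<close> is fixed
  before the initial data and velocities.\<close>

lemma flow_diff:
  assumes l: "1 < l" "l < l'" and s: "\<And>n. 0 \<le> s n" "seqnorm lam l s < \<infinity>" and K: "0 \<le> K"
  obtains C where "0 \<le> C"
    "\<And>a a' v v' D \<psi> t. \<lbrakk>\<And>n. level_norm a n \<le> s n; \<And>n. level_norm a' n \<le> s n; bounded_by K v; bounded_by K v';
      \<And>u. u \<in> {0..T} \<Longrightarrow> (D has_real_derivative \<psi> u) (at u within {0..T});
      \<And>u. u \<in> {0..T} \<Longrightarrow> 0 \<le> D u;
      \<And>u j c. u \<in> {0..T} \<Longrightarrow> L * real CARD('d) * \<bar>v u j c - v' u j c\<bar> \<le> \<psi> u; t \<in> {0..T}\<rbrakk> \<Longrightarrow>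
      tdist lam l' (flow a v t) (flow a' v' t) \<le> C * (tdist lam l a a' + D t)"
proof -
  let ?A = "rate K"
  have A: "0 \<le> ?A" by (rule rate_nonneg[OF K])
  define Q1 where "Q1 = real CARD('m) * (?A * T)"
  have Q1: "0 \<le> Q1" using A T by (simp add: Q1_def)
  define Q2 where "Q2 = 2 * (1 + ?A * T)"
  have Q2: "0 \<le> Q2" using A T by (simp add: Q2_def)
  obtain C1 where C1: "0 \<le> C1" "\<And>s c. (\<And>n. 0 \<le> s n) \<Longrightarrow> 0 \<le> c \<Longrightarrow>
       seqnorm lam l' (conv s (expseq c Q1)) \<le> ennreal (C1 * c) * seqnorm lam l s"
    using seqnorm_conv_expseq[OF l Q1] by metis
  obtain C2 where C2: "0 \<le> C2"
    "\<And>a b b' c. \<lbrakk>\<And>n. level_norm a n \<le> s n; 0 \<le> c; \<And>w. \<bar>b w - b' w\<bar> \<le> expseq c Q2 (length w)\<rbrakk> \<Longrightarrow>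
       tnorm lam l' ((a::'m tseries) \<otimes>\<^sub>t b - a \<otimes>\<^sub>t b') \<le> ennreal (C2 * c)"
    using tdist_tprod_le[OF l Q2 s(2)] by metis
  show thesis
  proof (rule that[of "C1 + C2"])
    show "0 \<le> C1 + C2" using C1 C2 by simp
    fix a a' :: "'m tseries" and v v' D \<psi> t
    assume a: "\<And>n. level_norm a n \<le> s n" and a': "\<And>n. level_norm a' n \<le> s n"
      and v: "bounded_by K v" and v': "bounded_by K v'"
      and D: "\<And>u. u \<in> {0..T} \<Longrightarrow> (D has_real_derivative \<psi> u) (at u within {0..T})"
      and D0: "\<And>u. u \<in> {0..T} \<Longrightarrow> 0 \<le> D u"
      and vv': "\<And>u j c. u \<in> {0..T} \<Longrightarrow> L * real CARD('d) * \<bar>v u j c - v' u j c\<bar> \<le> \<psi> u"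
      and t: "t \<in> {0..T}"
    have aT: "a \<in> Tl lam l" "a' \<in> Tl lam l"
      using Tl_of_majorant[OF s(2)] a a' by blast+
    have "tnorm lam l' ((a - a') \<otimes>\<^sub>t sig x v t) \<le> seqnorm lam l' (conv (level_norm (a - a')) (expseq 1 Q1))"
      unfolding tnorm_eq_seqnorm Q1_def
      by (rule seqnorm_mono[OF lam_nonneg level_norm_tprod_expseq[OF order_refl sig_bounded[OF v t]]])
    also have "\<dots> \<le> ennreal (C1 * 1) * seqnorm lam l (level_norm (a - a'))"
      by (rule C1(2)) auto
    also have "\<dots> = ennreal (C1 * tdist lam l a a')"
      using C1(1) by (simp add: ennreal_mult ennreal_tdist[OF aT] tnorm_eq_seqnorm)
    finally have 1: "tnorm lam l' ((a - a') \<otimes>\<^sub>t sig x v t) \<le> ennreal (C1 * tdist lam l a a')" .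
    have 2: "tnorm lam l' (a' \<otimes>\<^sub>t sig x v t - a' \<otimes>\<^sub>t sig x v' t) \<le> ennreal (C2 * D t)"
    proof (rule C2(2)[OF a' D0[OF t]])
      fix w
      have "\<bar>sig x v t w - sig x v' t w\<bar> \<le> D t * ((2 * (1 + ?A * t)) ^ length w / fact (length w))"
        by (rule sig_diff_bound[OF bounded_byD(1)[OF v] bounded_byD(1)[OF v'] A bounded_byD(3)[OF v]
          bounded_byD(3)[OF v'] D D0 vv' t])
      also have "\<dots> \<le> expseq (D t) Q2 (length w)"
        unfolding expseq_def Q2_def using A t D0[OF t]
        by (intro mult_left_mono divide_right_mono power_mono add_left_mono) auto
      finally show "\<bar>sig x v t w - sig x v' t w\<bar> \<le> expseq (D t) Q2 (length w)" .
    qed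
    have eq: "flow a v t - flow a' v' t - (a - a') \<otimes>\<^sub>t sig x v t = a' \<otimes>\<^sub>t sig x v t - a' \<otimes>\<^sub>t sig x v' t"
      by (simp add: flow_def tprod_diff_left fun_eq_iff)
    have "tnorm lam l' (flow a v t - flow a' v' t) \<le> ennreal (C1 * tdist lam l a a') + ennreal (C2 * D t)"
      using tnorm_triangle'[of l' "flow a v t - flow a' v' t" "(a - a') \<otimes>\<^sub>t sig x v t"] add_mono[OF 1 2]
      unfolding eq by (rule order_trans)
    also have "\<dots> = ennreal (C1 * tdist lam l a a' + C2 * D t)"
      using C1(1) C2(1) D0[OF t] by (intro ennreal_plus[symmetric]) auto
    finally have "tdist lam l' (flow a v t) (flow a' v' t) \<le> C1 * tdist lam l a a' + C2 * D t"
      using C1(1) C2(1) D0[OF t] by (intro tdist_le) auto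
    also have "\<dots> \<le> (C1 + C2) * (tdist lam l a a' + D t)"
      using C1(1) C2(1) D0[OF t] by (simp add: algebra_simps)
    finally show "tdist lam l' (flow a v t) (flow a' v' t) \<le> (C1 + C2) * (tdist lam l a a' + D t)" .
  qed
qed

lemma flow_time_lipschitz:
  assumes l: "1 < l" "l < l'" and a: "a \<in> Tl lam l" and v: "bounded_by K v"
  obtains C where "0 \<le> C"
    "\<And>s t. s \<in> {0..T} \<Longrightarrow> t \<in> {0..T} \<Longrightarrow> tdist lam l' (flow a v s) (flow a v t) \<le> C * \<bar>s - t\<bar>"
proof -
  have A: "0 \<le> rate K" by (rule rate_nonneg[OF bounded_by_bound_nonneg[OF v]])
  define Q where "Q = 2 * ((rate K + 1) * (T + 1))"
  have Q: "0 \<le> Q" using A T by (simp add: Q_def)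
  have fin: "seqnorm lam l (level_norm a) < \<infinity>" using a by (simp add: Tl_iff tnorm_eq_seqnorm)
  obtain C where C: "0 \<le> C"
    "\<And>a' b b' c. \<lbrakk>\<And>n. level_norm a' n \<le> level_norm a n; 0 \<le> c; \<And>w. \<bar>b w - b' w\<bar> \<le> expseq c Q (length w)\<rbrakk> \<Longrightarrow>
       tnorm lam l' ((a'::'m tseries) \<otimes>\<^sub>t b - a' \<otimes>\<^sub>t b') \<le> ennreal (C * c)"
    using tdist_tprod_le[OF l Q fin] by metis
  have *: "tdist lam l' (flow a v t) (flow a v s) \<le> C * (t - s)" if "0 \<le> s" "s \<le> t" "t \<le> T" for s t
    unfolding flow_def
  proof (intro tdist_le C(2) order_refl)
    show "\<bar>sig x v t w - sig x v s w\<bar> \<le> expseq (t - s) Q (length w)" for w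
      unfolding Q_def by (rule sig_time_bound[OF bounded_byD(1)[OF v] A bounded_byD(3)[OF v] that])
  qed (use C that in auto)
  show thesis
  proof (rule that[OF C(1)])
    fix s t assume "s \<in> {0..T}" "t \<in> {0..T}"
    then show "tdist lam l' (flow a v s) (flow a v t) \<le> C * \<bar>s - t\<bar>"
      using *[of s t] *[of t s] tdist_commute[of l' "flow a v s" "flow a v t"] by (cases "s \<le> t") auto
  qed
qed

lemma Tl1_iff: "a \<in> Tl1 lam l \<longleftrightarrow> a \<in> Tl lam l \<and> a [] = 1"
  by (simp add: Tl1_def)

lemma vel_continuous:
  assumes S: "\<And>u. u \<in> {0..T} \<Longrightarrow> S u \<in> Tl1 lam p"
    and cont: "\<And>u e. u \<in> {0..T} \<Longrightarrow> 0 < e \<Longrightarrow> \<exists>d>0. \<forall>t\<in>{0..T}. \<bar>t - u\<bar> < d \<longrightarrow> tdist lam p (S t) (S u) < e"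
  shows "cont (\<lambda>u. vel (S u))"
  unfolding cont_def continuous_on_sequentially
proof (intro allI ballI impI, elim conjE)
  fix j c q u assume u: "u \<in> {0..T}" and q: "\<forall>n. q n \<in> {0..T}" "q \<longlonglongrightarrow> u"
  have "(\<lambda>i. tdist lam p (S (q i)) (S u)) \<longlonglongrightarrow> 0"
  proof (rule LIMSEQ_I)
    fix e :: real assume "0 < e"
    then obtain d where d: "d > 0" "\<And>t. t \<in> {0..T} \<Longrightarrow> \<bar>t - u\<bar> < d \<Longrightarrow> tdist lam p (S t) (S u) < e"
      using cont[OF u] by blast
    obtain N where "\<And>n. n \<ge> N \<Longrightarrow> \<bar>q n - u\<bar> < d"
      using LIMSEQ_D[OF q(2) d(1)] by (auto simp: real_norm_def)
    then show "\<exists>N. \<forall>n\<ge>N. norm (tdist lam p (S (q n)) (S u) - 0) < e"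
      using d(2) q(1) by auto
  qed
  then have "(\<lambda>i. F (S (q i)) (axis j 1) [c]) \<longlonglongrightarrow> F (S u) (axis j 1) [c]"
    using S u q(1) by (intro F_tendsto) auto
  then show "((\<lambda>u. vel (S u) j c) \<circ> q) \<longlonglongrightarrow> vel (S u) j c"
    by (simp add: vel_def o_def)
qed

lemma flow_vel_cont:
  assumes l: "1 < l" "l < p" and a: "a \<in> Tl1 lam l" and v: "bounded_by K v"
  shows "cont (\<lambda>u. vel (flow a v u))"
proof (rule vel_continuous)
  show "flow a v u \<in> Tl1 lam p" if "u \<in> {0..T}" for u
    using flow_Tl[OF l _ v that, of a] a by (simp add: Tl1_iff)
  fix u e assume u: "u \<in> {0..T}" and e: "0 < (e::real)"
  obtain C where C: "0 \<le> C"
    "\<And>s t. s \<in> {0..T} \<Longrightarrow> t \<in> {0..T} \<Longrightarrow> tdist lam p (flow a v s) (flow a v t) \<le> C * \<bar>s - t\<bar>"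
    using flow_time_lipschitz[OF l _ v, of a] a by (metis Tl1_iff)
  have "tdist lam p (flow a v t) (flow a v u) < e" if "t \<in> {0..T}" "\<bar>t - u\<bar> < e / (C + 1)" for t
  proof -
    have "tdist lam p (flow a v t) (flow a v u) \<le> C * \<bar>t - u\<bar>" by (rule C(2)[OF that(1) u])
    also have "\<dots> \<le> (C + 1) * \<bar>t - u\<bar>" by (rule mult_right_mono) auto
    also have "\<dots> < e" using that(2) C(1) by (simp add: pos_less_divide_eq mult.commute)
    finally show ?thesis .
  qed
  then show "\<exists>d>0. \<forall>t\<in>{0..T}. \<bar>t - u\<bar> < d \<longrightarrow> tdist lam p (flow a v t) (flow a v u) < e"
    using C(1) e by (intro exI[of _ "e / (C + 1)"]) auto
qed

lemma vel_lipschitz: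
  assumes s: "seqnorm lam p s < \<infinity>"
  obtains B where "0 < B"
    "\<And>a b j c. \<lbrakk>a [] = 1; b [] = 1; \<And>n. level_norm a n \<le> s n; \<And>n. level_norm b n \<le> s n\<rbrakk> \<Longrightarrow>
      \<bar>vel a j c - vel b j c\<bar> \<le> B * tdist lam p a b"
proof -
  have "\<exists>B>0. \<forall>a b. a [] = 1 \<longrightarrow> b [] = 1 \<longrightarrow> (\<forall>n. level_norm a n \<le> s n) \<longrightarrow> (\<forall>n. level_norm b n \<le> s n) \<longrightarrow>
      \<bar>vel a j c - vel b j c\<bar> \<le> B * tdist lam p a b" for j c
    using F_lipschitz_on_majorized[OF s, where j = j and w = "[c]"] unfolding vel_def by metis
  then obtain B where B: "\<And>j c. B j c > 0" "\<And>j c a b. a [] = 1 \<Longrightarrow> b [] = 1 \<Longrightarrow> (\<forall>n. level_norm a n \<le> s n) \<Longrightarrow>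
      (\<forall>n. level_norm b n \<le> s n) \<Longrightarrow> \<bar>vel a j c - vel b j c\<bar> \<le> B j c * tdist lam p a b"
    by metis
  let ?B = "\<Sum>j\<in>UNIV. \<Sum>c\<in>UNIV. B j c"
  have B': "B j c \<le> ?B" for j c
  proof -
    have "B j c \<le> (\<Sum>c\<in>UNIV. B j c)" using B(1) by (intro member_le_sum) (auto simp: less_imp_le)
    also have "\<dots> \<le> ?B" using B(1) by (intro member_le_sum) (auto intro!: sum_nonneg simp: less_imp_le)
    finally show ?thesis .
  qed
  show thesis
  proof (rule that[of ?B])
    show "0 < ?B" using B(1) by (intro sum_pos) auto
    fix a b :: "'m tseries" and j c assume *: "a [] = 1" "b [] = 1" "\<And>n. level_norm a n \<le> s n" "\<And>n. level_norm b n \<le> s n"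
    have "\<bar>vel a j c - vel b j c\<bar> \<le> B j c * tdist lam p a b" using B(2) * by blast
    also have "\<dots> \<le> ?B * tdist lam p a b" by (rule mult_right_mono[OF B']) simp
    finally show "\<bar>vel a j c - vel b j c\<bar> \<le> ?B * tdist lam p a b" .
  qed
qed

text \<open>Integrating exp(\<beta> u) gains a factor 1/\<beta>, so a large \<beta> turns the
  Lipschitz constant into the contraction factor 1/2 on all of [0,T]; the interval need not be
  subdivided.\<close>

lemma vel_flow_contraction:
  assumes l: "1 < l" "l < p" and s: "\<And>n. 0 \<le> s n" "seqnorm lam l s < \<infinity>" and K: "0 \<le> K"
  obtains C \<beta> where "0 \<le> C" "0 < \<beta>"
    "\<And>a a' v v' N t j c. \<lbrakk>a [] = 1; a' [] = 1; \<And>n. level_norm a n \<le> s n; \<And>n. level_norm a' n \<le> s n;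
      bounded_by K v; bounded_by K v'; 0 \<le> N;
      \<And>u j c. u \<in> {0..T} \<Longrightarrow> \<bar>v u j c - v' u j c\<bar> \<le> N * exp (\<beta> * u); t \<in> {0..T}\<rbrakk> \<Longrightarrow>
      \<bar>vel (flow a v t) j c - vel (flow a' v' t) j c\<bar> \<le> (C * tdist lam l a a' + N / 2) * exp (\<beta> * t)"
proof -
  obtain C where C: "0 \<le> C"
    "\<And>a a' v v' D \<psi> t. \<lbrakk>\<And>n. level_norm a n \<le> s n; \<And>n. level_norm a' n \<le> s n; bounded_by K v; bounded_by K v';
      \<And>u. u \<in> {0..T} \<Longrightarrow> (D has_real_derivative \<psi> u) (at u within {0..T});
      \<And>u. u \<in> {0..T} \<Longrightarrow> 0 \<le> D u;
      \<And>u j c. u \<in> {0..T} \<Longrightarrow> L * real CARD('d) * \<bar>v u j c - v' u j c\<bar> \<le> \<psi> u; t \<in> {0..T}\<rbrakk> \<Longrightarrow>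
      tdist lam p (flow a v t) (flow a' v' t) \<le> C * (tdist lam l a a' + D t)"
    using flow_diff[OF l s K] by blast
  obtain B where B: "0 < B"
    "\<And>a b j c. \<lbrakk>a [] = 1; b [] = 1; \<And>n. level_norm a n \<le> maj K s n; \<And>n. level_norm b n \<le> maj K s n\<rbrakk> \<Longrightarrow>
      \<bar>vel a j c - vel b j c\<bar> \<le> B * tdist lam p a b"
    using vel_lipschitz[OF maj_finite[OF l s K]] by blast
  define R where "R = L * real CARD('d)"
  have R: "0 \<le> R" using L_nonneg by (simp add: R_def)
  \<comment> \<open>Chosen for B C R/\<beta> <= 1/2; the summand 1 keeps \<beta> positive.\<close>
  define \<beta> where "\<beta> = 2 * B * C * R + 1"
  have \<beta>: "0 < \<beta>" using B(1) C(1) R by (simp add: \<beta>_def add_nonneg_pos)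
  show thesis
  proof (rule that[of "B * C" \<beta>])
    show "0 \<le> B * C" using B(1) C(1) by simp
    show "0 < \<beta>" by (rule \<beta>)
    fix a a' :: "'m tseries" and v v' N t j c
    assume a1: "a [] = 1" "a' [] = 1" and a: "\<And>n. level_norm a n \<le> s n" "\<And>n. level_norm a' n \<le> s n"
      and v: "bounded_by K v" "bounded_by K v'" and N: "0 \<le> N"
      and vv': "\<And>u j c. u \<in> {0..T} \<Longrightarrow> \<bar>v u j c - v' u j c\<bar> \<le> N * exp (\<beta> * u)" and t: "t \<in> {0..T}"
    \<comment> \<open>A primitive of R N exp(\<beta> u) that need not vanish at 0, since only
      nonnegativity of \<open>D\<close> is required.\<close>
    define D where "D u = R * N / \<beta> * exp (\<beta> * u)" for u
    have "tdist lam p (flow a v t) (flow a' v' t) \<le> C * (tdist lam l a a' + D t)"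
    proof (rule C(2)[OF a v _ _ _ t])
      show "(D has_real_derivative R * (N * exp (\<beta> * u))) (at u within {0..T})" for u
        unfolding D_def by (rule derivative_eq_intros refl | simp)+ (use \<beta> in simp)
      show "0 \<le> D u" for u using R N \<beta> by (simp add: D_def)
      show "L * real CARD('d) * \<bar>v u j c - v' u j c\<bar> \<le> R * (N * exp (\<beta> * u))" if "u \<in> {0..T}" for u j c
        unfolding R_def[symmetric] by (rule mult_left_mono[OF vv'[OF that] R])
    qed
    then have "B * tdist lam p (flow a v t) (flow a' v' t) \<le> B * (C * (tdist lam l a a' + D t))"
      using B(1) by (intro mult_left_mono) auto
    moreover have "\<bar>vel (flow a v t) j c - vel (flow a' v' t) j c\<bar> \<le> B * tdist lam p (flow a v t) (flow a' v' t)"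
      using a1 by (intro B(2) flow_majorant[OF v(1) t a(1)] flow_majorant[OF v(2) t a(2)]) auto
    moreover have "B * (C * (tdist lam l a a' + D t)) = B * C * tdist lam l a a' + B * C * R / \<beta> * (N * exp (\<beta> * t))"
      by (simp add: D_def algebra_simps)
    moreover have "B * C * R / \<beta> * (N * exp (\<beta> * t)) \<le> 1 / 2 * (N * exp (\<beta> * t))"
      using \<beta> N by (intro mult_right_mono) (auto simp: \<beta>_def field_simps)
    moreover have "B * C * tdist lam l a a' * 1 \<le> B * C * tdist lam l a a' * exp (\<beta> * t)"
      using B(1) C(1) \<beta> t by (intro mult_left_mono) auto
    moreover have "(B * C * tdist lam l a a' + N / 2) * exp (\<beta> * t)
        = B * C * tdist lam l a a' * exp (\<beta> * t) + 1 / 2 * (N * exp (\<beta> * t))"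
      by (simp add: distrib_right)
    ultimately show "\<bar>vel (flow a v t) j c - vel (flow a' v' t) j c\<bar> \<le> (B * C * tdist lam l a a' + N / 2) * exp (\<beta> * t)"
      by linarith
  qed
qed

end

section \<open>Fixed points\<close>

context controlled_rde
begin

definition sol :: "'m tseries \<Rightarrow> (real \<Rightarrow> 'd \<Rightarrow> 'm \<Rightarrow> real) \<Rightarrow> bool" where
  "sol a v \<longleftrightarrow> cont v \<and> (\<forall>u\<in>{0..T}. \<forall>j c. v u j c = vel (flow a v u) j c)"

lemma cont_bounded:
  assumes "cont v"
  obtains K where "bounded_by K v"
proof -
  have "\<exists>B. \<forall>u\<in>{0..T}. \<bar>v u j c\<bar> \<le> B" for j c
  proof -
    have "continuous_on {0..T} (\<lambda>u. v u j c)" using assms by (simp add: cont_def)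
    from compact_imp_bounded[OF compact_continuous_image[OF this compact_Icc]]
    show ?thesis by (auto simp: bounded_iff)
  qed
  then obtain B where B: "\<And>j c u. u \<in> {0..T} \<Longrightarrow> \<bar>v u j c\<bar> \<le> B j c" by metis
  have B0: "0 \<le> B j c" for j c using B[of 0 j c] T by auto
  have "\<bar>v u j c\<bar> \<le> (\<Sum>j\<in>UNIV. \<Sum>c\<in>UNIV. B j c)" if "u \<in> {0..T}" for u j c
  proof -
    have "\<bar>v u j c\<bar> \<le> B j c" by (rule B[OF that])
    also have "\<dots> \<le> (\<Sum>c\<in>UNIV. B j c)" using B0 by (intro member_le_sum) auto
    also have "\<dots> \<le> (\<Sum>j\<in>UNIV. \<Sum>c\<in>UNIV. B j c)" using B0 by (intro member_le_sum) (auto intro!: sum_nonneg)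
    finally show ?thesis .
  qed
  then show thesis using assms that[of "\<Sum>j\<in>UNIV. \<Sum>c\<in>UNIV. B j c"] by (auto simp: bounded_by_def)
qed

text \<open>The contraction is applied again and again to the same pair of solutions, starting from
  the trivial bound 2 K. The contribution of the start halves each time, and twice the initial
  discrepancy remains.\<close>

lemma sol_stability:
  assumes l: "1 < l" "l < p" and s: "\<And>n. 0 \<le> s n" "seqnorm lam l s < \<infinity>" and K: "0 \<le> K"
  obtains C \<beta> where "0 \<le> C" "0 < \<beta>"
    "\<And>a a' v v' u j c. \<lbrakk>a [] = 1; a' [] = 1; \<And>n. level_norm a n \<le> s n; \<And>n. level_norm a' n \<le> s n;
      bounded_by K v; bounded_by K v'; sol a v; sol a' v'; u \<in> {0..T}\<rbrakk> \<Longrightarrow>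
      \<bar>v u j c - v' u j c\<bar> \<le> C * tdist lam l a a' * exp (\<beta> * u)"
proof -
  obtain C \<beta> where C: "0 \<le> C" and \<beta>: "0 < \<beta>" and contr:
    "\<And>a a' v v' N t j c. \<lbrakk>a [] = 1; a' [] = 1; \<And>n. level_norm a n \<le> s n; \<And>n. level_norm a' n \<le> s n;
      bounded_by K v; bounded_by K v'; 0 \<le> N;
      \<And>u j c. u \<in> {0..T} \<Longrightarrow> \<bar>v u j c - v' u j c\<bar> \<le> N * exp (\<beta> * u); t \<in> {0..T}\<rbrakk> \<Longrightarrow>
      \<bar>vel (flow a v t) j c - vel (flow a' v' t) j c\<bar> \<le> (C * tdist lam l a a' + N / 2) * exp (\<beta> * t)"
    using vel_flow_contraction[OF l s K] by blast
  show thesis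
  proof (rule that[of "2 * C" \<beta>])
    fix a a' :: "'m tseries" and v v' u j c
    assume a1: "a [] = 1" "a' [] = 1" and a: "\<And>n. level_norm a n \<le> s n" "\<And>n. level_norm a' n \<le> s n"
      and v: "bounded_by K v" "bounded_by K v'" and sol: "sol a v" "sol a' v'" and u: "u \<in> {0..T}"
    let ?d = "C * tdist lam l a a'"
    have d: "0 \<le> ?d" using C by simp
    \<comment> \<open>With d = \<open>?d\<close> the bounds N_i = 2 d + 2 K/2^i satisfy N_(i+1) = d
      + N_i/2.\<close>
    have approx: "\<bar>v u j c - v' u j c\<bar> \<le> (2 * ?d + 2 * K / 2 ^ i) * exp (\<beta> * u)" if "u \<in> {0..T}" for i u j c
      using that
    proof (induction i arbitrary: u j c)
      case 0
      have "\<bar>v u j c - v' u j c\<bar> \<le> 2 * K"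
        using bounded_byD(2)[OF v(1) 0, of j c] bounded_byD(2)[OF v(2) 0, of j c] by linarith
      also have "\<dots> \<le> (2 * ?d + 2 * K) * 1"
        using d by simp
      also have "\<dots> \<le> (2 * ?d + 2 * K) * exp (\<beta> * u)"
        using d K \<beta> 0 by (intro mult_left_mono) auto
      finally show ?case by simp
    next
      case (Suc i)
      have "\<bar>vel (flow a v u) j c - vel (flow a' v' u) j c\<bar> \<le> (?d + (2 * ?d + 2 * K / 2 ^ i) / 2) * exp (\<beta> * u)"
        using d K by (intro contr[OF a1 a v _ Suc.IH Suc.prems]) auto
      then show ?case using sol Suc.prems by (simp add: sol_def field_simps)
    qed
    have "(\<lambda>i. (2 * ?d + 2 * K * (1 / 2) ^ i) * exp (\<beta> * u)) \<longlonglongrightarrow> (2 * ?d + 2 * K * 0) * exp (\<beta> * u)"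
      by (intro tendsto_intros LIMSEQ_power_zero) auto
    then have "\<bar>v u j c - v' u j c\<bar> \<le> (2 * ?d + 2 * K * 0) * exp (\<beta> * u)"
      by (rule LIMSEQ_le_const) (use approx[OF u] in \<open>simp add: power_divide\<close>)
    then show "\<bar>v u j c - v' u j c\<bar> \<le> 2 * C * tdist lam l a a' * exp (\<beta> * u)" by simp
  qed (use C \<beta> in auto)
qed

text \<open>Closeness of the velocities is obtained through the exponent \<open>p\<close>, where
  \<open>F\<close> is Lipschitz, and then fed into the flow estimate for an arbitrary output
  exponent above \<open>l\<close>.\<close>

lemma sol_flow_stability:
  assumes l: "1 < l" "l < p" "l < l'" and s: "\<And>n. 0 \<le> s n" "seqnorm lam l s < \<infinity>" and K: "0 \<le> K"
  obtains C where "0 \<le> C"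
    "\<And>a a' v v' t. \<lbrakk>a [] = 1; a' [] = 1; \<And>n. level_norm a n \<le> s n; \<And>n. level_norm a' n \<le> s n;
      bounded_by K v; bounded_by K v'; sol a v; sol a' v'; t \<in> {0..T}\<rbrakk> \<Longrightarrow>
      tdist lam l' (flow a v t) (flow a' v' t) \<le> C * tdist lam l a a'"
proof -
  obtain C1 \<beta> where C1: "0 \<le> C1" and \<beta>: "0 < \<beta>" and stab:
    "\<And>a a' v v' u j c. \<lbrakk>a [] = 1; a' [] = 1; \<And>n. level_norm a n \<le> s n; \<And>n. level_norm a' n \<le> s n;
      bounded_by K v; bounded_by K v'; sol a v; sol a' v'; u \<in> {0..T}\<rbrakk> \<Longrightarrow>
      \<bar>v u j c - v' u j c\<bar> \<le> C1 * tdist lam l a a' * exp (\<beta> * u)"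
    using sol_stability[OF l(1,2) s K] by blast
  obtain C2 where C2: "0 \<le> C2"
    "\<And>a a' v v' D \<psi> t. \<lbrakk>\<And>n. level_norm a n \<le> s n; \<And>n. level_norm a' n \<le> s n; bounded_by K v; bounded_by K v';
      \<And>u. u \<in> {0..T} \<Longrightarrow> (D has_real_derivative \<psi> u) (at u within {0..T});
      \<And>u. u \<in> {0..T} \<Longrightarrow> 0 \<le> D u;
      \<And>u j c. u \<in> {0..T} \<Longrightarrow> L * real CARD('d) * \<bar>v u j c - v' u j c\<bar> \<le> \<psi> u; t \<in> {0..T}\<rbrakk> \<Longrightarrow>
      tdist lam l' (flow a v t) (flow a' v' t) \<le> C2 * (tdist lam l a a' + D t)"
    using flow_diff[OF l(1,3) s K] by blast
  define R where "R = L * real CARD('d)"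
  have R: "0 \<le> R" using L_nonneg by (simp add: R_def)
  let ?C3 = "R * C1 / \<beta> * exp (\<beta> * T)"
  have C3: "0 \<le> ?C3" using R C1 \<beta> by simp
  show thesis
  proof (rule that[of "C2 * (1 + ?C3)"])
    show "0 \<le> C2 * (1 + ?C3)" using C2(1) C3 by simp
    fix a a' :: "'m tseries" and v v' t
    assume a1: "a [] = 1" "a' [] = 1" and a: "\<And>n. level_norm a n \<le> s n" "\<And>n. level_norm a' n \<le> s n"
      and v: "bounded_by K v" "bounded_by K v'" and sol: "sol a v" "sol a' v'" and t: "t \<in> {0..T}"
    let ?d = "tdist lam l a a'"
    define D where "D u = R * C1 / \<beta> * exp (\<beta> * u) * ?d" for u
    have "tdist lam l' (flow a v t) (flow a' v' t) \<le> C2 * (?d + D t)"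
    proof (rule C2(2)[OF a v _ _ _ t])
      show "(D has_real_derivative R * (C1 * ?d * exp (\<beta> * u))) (at u within {0..T})" for u
        unfolding D_def by (rule derivative_eq_intros refl | simp)+ (use \<beta> in simp)
      show "0 \<le> D u" for u using R C1 \<beta> by (simp add: D_def)
      show "L * real CARD('d) * \<bar>v u j c - v' u j c\<bar> \<le> R * (C1 * ?d * exp (\<beta> * u))" if "u \<in> {0..T}" for u j c
        unfolding R_def[symmetric] by (rule mult_left_mono[OF stab[OF a1 a v sol that] R])
    qed
    also have "\<dots> \<le> C2 * (?d + ?C3 * ?d)"
      unfolding D_def using C1 C2(1) R \<beta> t
      by (intro mult_left_mono add_left_mono mult_right_mono divide_right_mono) auto
    finally show "tdist lam l' (flow a v t) (flow a' v' t) \<le> C2 * (1 + ?C3) * ?d"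
      by (simp add: algebra_simps)
  qed
qed

text \<open>Equal initial data make the stability bound zero. Each velocity is bounded because it is
  continuous on a compact interval, so the growth condition supplies no bound here; the larger of
  the two bounds serves both.\<close>

lemma sol_unique:
  assumes l: "1 < l" "l < p" and a: "a \<in> Tl1 lam l" and sol: "sol a v" "sol a v'" and t: "t \<in> {0..T}"
  shows "flow a v t = flow a v' t"
proof -
  obtain K1 where K1: "bounded_by K1 v" using cont_bounded sol(1) by (auto simp: sol_def)
  obtain K2 where K2: "bounded_by K2 v'" using cont_bounded sol(2) by (auto simp: sol_def)
  let ?K = "max K1 K2"
  have v: "bounded_by ?K v" "bounded_by ?K v'"
    using K1 K2 by (auto simp: bounded_by_def le_max_iff_disj)
  have K: "0 \<le> ?K" using bounded_by_bound_nonneg[OF v(1)] .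
  have fin: "seqnorm lam l (level_norm a) < \<infinity>" using a by (simp add: Tl1_iff Tl_iff tnorm_eq_seqnorm)
  obtain C where "\<And>a' a'' v v' t. \<lbrakk>a' [] = 1; a'' [] = 1; \<And>n. level_norm a' n \<le> level_norm a n; \<And>n. level_norm a'' n \<le> level_norm a n;
      bounded_by ?K v; bounded_by ?K v'; sol a' v; sol a'' v'; t \<in> {0..T}\<rbrakk> \<Longrightarrow>
      tdist lam p (flow a' v t) (flow a'' v' t) \<le> C * tdist lam l a' a''"
    using sol_flow_stability[OF l l(2) level_norm_nonneg fin K] by metis
  from this[of a a v v' t] have "tdist lam p (flow a v t) (flow a v' t) \<le> 0"
    using a v sol t by (simp add: Tl1_iff)
  then have "tdist lam p (flow a v t) (flow a v' t) = 0"
    using tdist_nonneg[of p "flow a v t" "flow a v' t"] by linarith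
  then show ?thesis
    using a by (intro tdist_eq_0[OF p] flow_Tl[OF l _ v(1) t] flow_Tl[OF l _ v(2) t]) (auto simp: Tl1_iff)
qed

text \<open>
  The a priori bound: if $|v(u)|\le g(u)=2Ce^{\kappa u}$ then $S_t=\delta_r b$ with
  $r=1+P(t)$, $P(t)=2(e^{\kappa t}-1)$, and $\|b-\mathbf 1\|_{(p)}\le R$ independently of $v$,
  so (ii) returns the bound $C(1+r)=g(t)$.
\<close>

lemma vel_growth_invariant:
  assumes l: "1 < l" "l < p" and s: "\<And>n. 0 \<le> s n" "seqnorm lam l s < \<infinity>"
  obtains C \<kappa> where "0 < C" "0 \<le> \<kappa>"
    "\<And>a v t j c. \<lbrakk>a [] = 1; \<And>n. level_norm a n \<le> s n; cont v;
      \<And>u j c. u \<in> {0..T} \<Longrightarrow> \<bar>v u j c\<bar> \<le> C * exp (\<kappa> * u); t \<in> {0..T}\<rbrakk> \<Longrightarrow>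
      \<bar>vel (flow a v t) j c\<bar> \<le> C * exp (\<kappa> * t)"
proof -
  have "0 \<le> real CARD('m) * 1" by simp
  then obtain C1 where C1: "0 \<le> C1" "\<And>s c. (\<And>n. 0 \<le> s n) \<Longrightarrow> 0 \<le> c \<Longrightarrow>
       seqnorm lam p (conv s (expseq c (real CARD('m) * 1))) \<le> ennreal (C1 * c) * seqnorm lam l s"
    using seqnorm_conv_expseq[OF l] by metis
  \<comment> \<open>A bound for the rescaled series \<open>b\<close> below: its two factors are
    controlled by \<open>s\<close> and by \<open>expseq 1 1\<close>, whatever the velocity. The
    summand 1 makes \<open>R\<close> positive.\<close>
  define R where "R = C1 * enn2real (seqnorm lam l s) + 1"
  have R: "0 < R" using C1(1) by (simp add: R_def add_nonneg_pos)
  obtain CF where CF: "CF > 0"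
    "\<And>b r j c. \<lbrakk>0 \<le> r; dil r b \<in> Tl1 lam p; b [] = 1; tnorm lam p (b - tone) \<le> ennreal R\<rbrakk>
      \<Longrightarrow> \<bar>F (dil r b) (axis j 1) [c]\<bar> \<le> CF * (1 + r)"
    using F_linear_growth[OF R] by metis
  \<comment> \<open>This makes L d times the assumed bound 2 CF exp(\<kappa> u) equal to 2 \<kappa>
    exp(\<kappa> u), the derivative of \<open>P\<close>.\<close>
  define \<kappa> where "\<kappa> = CF * (L * real CARD('d))"
  have \<kappa>: "0 \<le> \<kappa>" using CF(1) L_nonneg by (simp add: \<kappa>_def)
  show thesis
  proof (rule that[of "2 * CF" \<kappa>])
    fix a :: "'m tseries" and v :: "real \<Rightarrow> 'd \<Rightarrow> 'm \<Rightarrow> real" and t j c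
    assume a1: "a [] = 1" and a: "\<And>n. level_norm a n \<le> s n" and v: "cont v"
      and vg: "\<And>u j c. u \<in> {0..T} \<Longrightarrow> \<bar>v u j c\<bar> \<le> 2 * CF * exp (\<kappa> * u)" and t: "t \<in> {0..T}"
    define P where "P u = 2 * (exp (\<kappa> * u) - 1)" for u
    have P0: "0 \<le> P u" if "u \<in> {0..T}" for u using that \<kappa> by (simp add: P_def)
    have sigP: "\<bar>sig x v t w\<bar> \<le> P t ^ length w / fact (length w)" for w
    proof (rule sig_bound[OF v _ P0 _ t])
      show "(P has_real_derivative 2 * (\<kappa> * exp (\<kappa> * u))) (at u within {0..T})" for u
        unfolding P_def by (rule derivative_eq_intros refl | simp)+
      show "L * real CARD('d) * \<bar>v u j c\<bar> \<le> 2 * (\<kappa> * exp (\<kappa> * u))" if "u \<in> {0..T}" for u j c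
        using mult_left_mono[OF vg[OF that], of "L * real CARD('d)" j c] L_nonneg by (simp add: \<kappa>_def ac_simps)
    qed
    \<comment> \<open>r >= 1 keeps the rescaled initial datum below \<open>s\<close>, and r >= P t
      brings the rescaled signature below 1/n!.\<close>
    define r where "r = 1 + P t"
    have r: "1 \<le> r" "P t \<le> r" using P0[OF t] by (auto simp: r_def)
    define b where "b = dil (1 / r) a \<otimes>\<^sub>t dil (1 / r) (sig x v t)"
    have dil_inv: "dil r (dil (1 / r) c) = c" for c :: "'m tseries"
      using r by (auto simp: dil_def fun_eq_iff power_one_over field_simps)
    have rb: "dil r b = flow a v t"
      by (simp add: b_def dil_tprod dil_inv flow_def)
    have b1: "b [] = 1" using a1 by (simp add: b_def tprod_def dil_def)
    have la: "level_norm (dil (1 / r) a) n \<le> s n" for n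
    proof -
      have "level_norm (dil (1 / r) a) n \<le> level_norm a n"
        unfolding level_norm_L2
      proof -
        have "(1 / r) ^ length w * \<bar>a w\<bar> \<le> \<bar>a w\<bar>" for w
          using r by (intro mult_left_le_one_le power_le_one) auto
        then show "L2_set (dil (1 / r) a) {w. length w = n} \<le> L2_set a {w. length w = n}"
          unfolding L2_set_def using r
          by (intro real_sqrt_le_mono sum_mono) (auto simp: dil_def abs_mult power_abs intro!: power2_le_iff_abs_le[THEN iffD2] abs_le_square_iff[THEN iffD1])
      qed
      also have "\<dots> \<le> s n" by (rule a)
      finally show ?thesis .
    qed
    have lsig: "\<bar>dil (1 / r) (sig x v t) w\<bar> \<le> expseq 1 1 (length w)" for w
    proof -
      let ?n = "length w"
      have "\<bar>dil (1 / r) (sig x v t) w\<bar> = (1 / r) ^ ?n * \<bar>sig x v t w\<bar>"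
        using r by (simp add: dil_def abs_mult power_abs)
      also have "\<dots> \<le> (1 / r) ^ ?n * (P t ^ ?n / fact ?n)"
        using r by (intro mult_left_mono sigP) auto
      also have "\<dots> = (P t / r) ^ ?n / fact ?n" by (simp add: power_divide)
      also have "\<dots> \<le> 1 ^ ?n / fact ?n"
        using r P0[OF t] by (intro divide_right_mono power_mono) auto
      finally show ?thesis by (simp add: expseq_def)
    qed
    have "tnorm lam p (b - tone) \<le> tnorm lam p b"
    proof (rule tnorm_mono[OF lam_nonneg])
      show "level_norm (b - tone) n \<le> level_norm b n" for n
        unfolding level_norm_def using b1
        by (intro real_sqrt_le_mono sum_mono) (auto simp: tone_def)
    qed
    also have "\<dots> \<le> seqnorm lam p (conv s (expseq 1 (real CARD('m) * 1)))"
      unfolding tnorm_eq_seqnorm b_def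
      by (rule seqnorm_mono[OF lam_nonneg level_norm_tprod_expseq[OF la lsig]])
    also have "\<dots> \<le> ennreal (C1 * 1) * seqnorm lam l s"
      by (rule C1(2)[OF s(1)]) simp
    also have "seqnorm lam l s = ennreal (enn2real (seqnorm lam l s))" using s(2) by simp
    also have "ennreal (C1 * 1) * \<dots> \<le> ennreal R"
      using C1(1) by (subst ennreal_mult[symmetric]) (auto simp: R_def intro!: ennreal_leI)
    finally have bR: "tnorm lam p (b - tone) \<le> ennreal R" .
    have "bounded_by (2 * CF * exp (\<kappa> * T)) v"
      unfolding bounded_by_def
    proof (intro conjI ballI allI v)
      fix u j c assume u: "u \<in> {0..T}"
      have "2 * CF * exp (\<kappa> * u) \<le> 2 * CF * exp (\<kappa> * T)"
        using u \<kappa> CF(1) by (intro mult_left_mono) (auto intro: mult_left_mono)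
      with vg[OF u, of j c] show "\<bar>v u j c\<bar> \<le> 2 * CF * exp (\<kappa> * T)" by linarith
    qed
    then have "flow a v t \<in> Tl1 lam p"
      using flow_Tl[OF l Tl_of_majorant[OF s(2) a] _ t] a1 by (simp add: Tl1_iff)
    then have "\<bar>F (dil r b) (axis j 1) [c]\<bar> \<le> CF * (1 + r)"
      using r by (intro CF(2) bR b1) (auto simp: rb)
    then show "\<bar>vel (flow a v t) j c\<bar> \<le> 2 * CF * exp (\<kappa> * t)"
      unfolding rb by (simp add: vel_def r_def P_def algebra_simps)
  qed (use CF(1) \<kappa> in auto)
qed

text \<open>Picard iteration from the zero velocity inside the invariant set. \<open>K\<close> is
  fixed before \<open>a\<close>, so one bound serves all initial data below \<open>s\<close>;
  continuity in the initial datum depends on this uniformity.\<close>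

lemma sol_exists:
  assumes l: "1 < l" "l < p" and s: "\<And>n. 0 \<le> s n" "seqnorm lam l s < \<infinity>"
  obtains K where "0 \<le> K"
    "\<And>a. a [] = 1 \<Longrightarrow> (\<And>n. level_norm a n \<le> s n) \<Longrightarrow> \<exists>v. sol a v \<and> bounded_by K v"
proof -
  obtain C \<kappa> where C: "0 < C" and \<kappa>: "0 \<le> \<kappa>" and inv:
    "\<And>a v t j c. \<lbrakk>a [] = 1; \<And>n. level_norm a n \<le> s n; cont v;
      \<And>u j c. u \<in> {0..T} \<Longrightarrow> \<bar>v u j c\<bar> \<le> C * exp (\<kappa> * u); t \<in> {0..T}\<rbrakk> \<Longrightarrow>
      \<bar>vel (flow a v t) j c\<bar> \<le> C * exp (\<kappa> * t)"
    using vel_growth_invariant[OF l s] by blast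
  define K where "K = C * exp (\<kappa> * T)"
  have K: "0 \<le> K" using C by (simp add: K_def)
  have gK: "bounded_by K v" if "cont v" "\<And>u j c. u \<in> {0..T} \<Longrightarrow> \<bar>v u j c\<bar> \<le> C * exp (\<kappa> * u)" for v
    unfolding bounded_by_def
  proof (intro conjI ballI allI that(1))
    fix u j c assume u: "u \<in> {0..T}"
    have "C * exp (\<kappa> * u) \<le> K"
      unfolding K_def using u \<kappa> C by (intro mult_left_mono) (auto intro: mult_left_mono)
    with that(2)[OF u, of j c] show "\<bar>v u j c\<bar> \<le> K" by linarith
  qed
  obtain C' \<beta> where "0 \<le> C'" and \<beta>: "0 < \<beta>" and contr:
    "\<And>a a' v v' N t j c. \<lbrakk>a [] = 1; a' [] = 1; \<And>n. level_norm a n \<le> s n; \<And>n. level_norm a' n \<le> s n;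
      bounded_by K v; bounded_by K v'; 0 \<le> N;
      \<And>u j c. u \<in> {0..T} \<Longrightarrow> \<bar>v u j c - v' u j c\<bar> \<le> N * exp (\<beta> * u); t \<in> {0..T}\<rbrakk> \<Longrightarrow>
      \<bar>vel (flow a v t) j c - vel (flow a' v' t) j c\<bar> \<le> (C' * tdist lam l a a' + N / 2) * exp (\<beta> * t)"
    using vel_flow_contraction[OF l s K] by blast
  show thesis
  proof (rule that[OF K])
    fix a :: "'m tseries" assume a1: "a [] = 1" and a: "\<And>n. level_norm a n \<le> s n"
    have aT: "a \<in> Tl1 lam l" using Tl_of_majorant[OF s(2) a] a1 by (simp add: Tl1_iff)
    define V where "V i = ((\<lambda>v u. vel (flow a v u)) ^^ i) (\<lambda>_ _ _. 0)" for i
    have V0: "V 0 u j c = 0" and VS: "V (Suc i) u j c = vel (flow a (V i) u) j c" for i u j c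
      by (simp_all add: V_def)
    have Vg: "cont (V i) \<and> (\<forall>u\<in>{0..T}. \<forall>j c. \<bar>V i u j c\<bar> \<le> C * exp (\<kappa> * u))" for i
    proof (induction i)
      case 0
      then show ?case using C by (simp add: V0 cont_def)
    next
      case (Suc i)
      have "cont (V (Suc i))"
        using flow_vel_cont[OF l aT gK[of "V i"]] Suc.IH by (simp add: V_def)
      moreover have "\<bar>V (Suc i) u j c\<bar> \<le> C * exp (\<kappa> * u)" if "u \<in> {0..T}" for u j c
        using inv[OF a1 a, of "V i"] Suc.IH that by (simp add: VS)
      ultimately show ?case by blast
    qed
    then have VK: "bounded_by K (V i)" for i using gK[of "V i"] by blast
    \<comment> \<open>Equal initial data leave only the contraction factor 1/2, starting from |V 1 -
      V 0| <= K.\<close>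
    have step: "\<bar>V (Suc i) u j c - V i u j c\<bar> \<le> K / 2 ^ i * exp (\<beta> * u)" if "u \<in> {0..T}" for i u j c
      using that
    proof (induction i arbitrary: u j c)
      case 0
      have "\<bar>V (Suc 0) u j c - V 0 u j c\<bar> \<le> K * 1"
        using bounded_byD(2)[OF VK[of "Suc 0"] 0, of j c] by (simp add: V0)
      also have "\<dots> \<le> K * exp (\<beta> * u)" using K \<beta> 0 by (intro mult_left_mono) auto
      finally show ?case by simp
    next
      case (Suc i)
      have "\<bar>vel (flow a (V (Suc i)) u) j c - vel (flow a (V i) u) j c\<bar> \<le> (C' * tdist lam l a a + K / 2 ^ i / 2) * exp (\<beta> * u)"
        using K by (intro contr[OF a1 a1 a a VK VK _ Suc.IH Suc.prems]) auto
      then show ?case by (simp add: VS mult.commute)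
    qed
    define v where "v u j c = (\<Sum>i. V (Suc i) u j c - V i u j c)" for u j c
    have lim: "uniform_limit {0..T} (\<lambda>n u. V n u j c) (\<lambda>u. v u j c) sequentially" for j c
    proof -
      have "uniform_limit {0..T} (\<lambda>n u. \<Sum>i<n. V (Suc i) u j c - V i u j c)
          (\<lambda>u. \<Sum>i. V (Suc i) u j c - V i u j c) sequentially"
      proof (rule Weierstrass_m_test)
        show "norm (V (Suc i) u j c - V i u j c) \<le> K * exp (\<beta> * T) * (1 / 2) ^ i" if "u \<in> {0..T}" for i u
        proof -
          have "K / 2 ^ i * exp (\<beta> * u) \<le> K / 2 ^ i * exp (\<beta> * T)"
            using K \<beta> that by (intro mult_left_mono) auto
          then show ?thesis using step[OF that, of i j c] by (simp add: power_divide)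
        qed
        show "summable (\<lambda>i. K * exp (\<beta> * T) * (1 / 2) ^ i)"
          by (intro summable_mult summable_geometric) simp
      qed
      moreover have "(\<Sum>i<n. V (Suc i) u j c - V i u j c) = V n u j c" for n u
        using sum_lessThan_telescope[of "\<lambda>i. V i u j c" n] by (simp add: V0)
      ultimately show ?thesis by (simp add: v_def)
    qed
    have vcont: "cont v"
      unfolding cont_def
    proof (intro allI)
      fix j c
      have "\<forall>\<^sub>F n in sequentially. continuous_on {0..T} (\<lambda>u. V n u j c)"
        using Vg by (simp add: cont_def)
      from uniform_limit_theorem[OF this lim] show "continuous_on {0..T} (\<lambda>u. v u j c)" by simp
    qed
    have vg: "\<bar>v u j c\<bar> \<le> C * exp (\<kappa> * u)" if "u \<in> {0..T}" for u j c
      using tendsto_rabs[OF tendsto_uniform_limitI[OF lim that, of j c]] Vg that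
      by (intro LIMSEQ_le_const2) auto
    have vK: "bounded_by K v" by (rule gK[OF vcont vg])
    \<comment> \<open>The image of \<open>V N\<close> is V (N + 1), which is uniformly close to
      \<open>v\<close>; the contraction compares this image with the image of
      \<open>v\<close>.\<close>
    have "v t j c = vel (flow a v t) j c" if t: "t \<in> {0..T}" for t j c
    proof -
      have "\<bar>vel (flow a v t) j c - v t j c\<bar> \<le> 0"
      proof (rule field_le_epsilon)
        fix e0 :: real assume "0 < e0"
        \<comment> \<open>The two errors are e exp(\<beta> t) and e, and should add up to
          \<open>e0\<close>.\<close>
        define e where "e = e0 / (1 + exp (\<beta> * t))"
        have e: "0 < e" "e * (1 + exp (\<beta> * t)) = e0"
        proof -
          have pos: "0 < 1 + exp (\<beta> * t)" by (simp add: add_pos_pos)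
          show "0 < e" using \<open>0 < e0\<close> pos by (simp add: e_def)
          show "e * (1 + exp (\<beta> * t)) = e0" using pos by (simp add: e_def)
        qed
        have "\<forall>\<^sub>F n in sequentially. \<forall>j c. \<forall>u\<in>{0..T}. dist (V n u j c) (v u j c) < e"
          using uniform_limitD[OF lim e(1)] by (intro eventually_all_finite)
        then obtain N where "\<forall>n\<ge>N. \<forall>j c. \<forall>u\<in>{0..T}. dist (V n u j c) (v u j c) < e"
          unfolding eventually_sequentially by blast
        then have N: "\<bar>v u j c - V n u j c\<bar> < e" if "n \<ge> N" "u \<in> {0..T}" for n j c u
          using that by (simp add: dist_real_def abs_minus_commute)
        have "\<bar>vel (flow a v t) j c - vel (flow a (V N) t) j c\<bar> \<le> (C' * tdist lam l a a + e / 2) * exp (\<beta> * t)"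
        proof (rule contr[OF a1 a1 a a vK VK _ _ t])
          fix u j c assume u: "u \<in> {0..T}"
          have "\<bar>v u j c - V N u j c\<bar> \<le> e * 1" using N[of N u j c] u by simp
          also have "\<dots> \<le> e * exp (\<beta> * u)" using e \<beta> u by (intro mult_left_mono) auto
          finally show "\<bar>v u j c - V N u j c\<bar> \<le> e * exp (\<beta> * u)" .
        qed (use e in simp)
        also have "\<dots> \<le> e * exp (\<beta> * t)" using e by (simp add: mult_right_mono)
        finally have "\<bar>vel (flow a v t) j c - vel (flow a (V N) t) j c\<bar> \<le> e * exp (\<beta> * t)" .
        moreover have "\<bar>v t j c - vel (flow a (V N) t) j c\<bar> < e"
          using N[of "Suc N" t j c] t by (simp add: VS)
        ultimately have "\<bar>vel (flow a v t) j c - v t j c\<bar> \<le> e * exp (\<beta> * t) + e" by linarith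
        then show "\<bar>vel (flow a v t) j c - v t j c\<bar> \<le> 0 + e0" using e(2) by (simp add: distrib_left)
      qed
      then show ?thesis by simp
    qed
    then show "\<exists>v. sol a v \<and> bounded_by K v"
      using vcont vK unfolding sol_def by blast
  qed
qed

end

section \<open>Topologies and the flow\<close>

context weights
begin

text \<open>As 0^0 = 1, the sequence \<open>expseq 1 0\<close> is the unit of the Cauchy product, so
  the exponent loss estimate with Q = 0 specialises to the inclusion.\<close>

lemma Tl_mono:
  assumes "1 < l" "l \<le> l'" "a \<in> Tl lam l"
  shows "a \<in> Tl lam l'"
proof (cases "l = l'")
  case False
  then have l: "1 < l" "l < l'" using assms by auto
  obtain C where C: "\<And>s c. (\<And>n. 0 \<le> s n) \<Longrightarrow> 0 \<le> c \<Longrightarrow>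
       seqnorm lam l' (conv s (expseq c 0)) \<le> ennreal (C * c) * seqnorm lam l s"
    using seqnorm_conv_expseq[OF l order_refl] by metis
  have "conv s (expseq 1 0) n = s n" for s n
  proof -
    have "conv s (expseq 1 0) n = (\<Sum>i\<in>{n}. s i * expseq 1 0 (n - i))"
      unfolding conv_def by (rule sum.mono_neutral_right) (auto simp: expseq_def power_0_left)
    then show ?thesis by (simp add: expseq_def)
  qed
  then have eq: "conv s (expseq 1 0) = s" for s by (simp add: fun_eq_iff)
  have "tnorm lam l' a \<le> ennreal (C * 1) * tnorm lam l a"
    unfolding tnorm_eq_seqnorm using C[of "level_norm a" 1] by (simp add: eq)
  also have "\<dots> < \<infinity>" using assms(3) by (simp add: Tl_iff ennreal_mult_less_top)
  finally show ?thesis by (simp add: Tl_iff)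
qed (use assms in simp)

lemma exponent_below:
  assumes "1 < (q::real)"
  obtains k :: nat where "1 \<le> k" "1 + 1 / real k < q"
proof -
  obtain n :: nat where n: "1 / (q - 1) < real n" using reals_Archimedean2 by blast
  have "0 < 1 / (q - 1)" using assms by simp
  then have n0: "0 < real n" using n by linarith
  have "1 / real n < q - 1" using n n0 assms by (simp add: field_simps)
  then show thesis using n0 by (intro that[of n]) auto
qed

text \<open>The exponents 1 + 1/k decrease to 1 and the spaces grow with the exponent, so every l >
  1 lies above a member of the defining family.\<close>

lemma Tinf_iff: "a \<in> Tinf lam \<longleftrightarrow> (\<forall>l>1. a \<in> Tl lam l)"
proof
  assume a: "a \<in> Tinf lam"
  show "\<forall>l>1. a \<in> Tl lam l"
  proof (intro allI impI)
    fix l :: real assume "1 < l"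
    then obtain k :: nat where k: "1 \<le> k" "1 + 1 / real k < l" using exponent_below by blast
    then have "a \<in> Tl lam (1 + 1 / real k)" using a by (auto simp: Tinf_def)
    then show "a \<in> Tl lam l" using k by (intro Tl_mono[of "1 + 1 / real k" l]) auto
  qed
next
  assume "\<forall>l>1. a \<in> Tl lam l"
  then show "a \<in> Tinf lam" by (auto simp: Tinf_def)
qed

lemma Tinf1_iff: "a \<in> Tinf1 lam \<longleftrightarrow> (\<forall>l>1. a \<in> Tl1 lam l)"
proof
  assume "\<forall>l>1. a \<in> Tl1 lam l"
  moreover from this have "a \<in> Tl1 lam 2" by simp
  ultimately show "a \<in> Tinf1 lam" by (simp add: Tinf1_def Tl1_def Tinf_iff)
qed (simp add: Tinf1_def Tl1_def Tinf_iff)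

lemma topspace_Tl_top: "1 < l \<Longrightarrow> topspace (Tl_top lam l) = Tl lam l"
  unfolding Tl_top_def by (simp add: Metric_space.topspace_mtopology[OF metric_Tl])

lemma continuous_map_Tl1_top_iff:
  fixes S :: "'b \<Rightarrow> 'm::finite tseries"
  assumes l: "1 < l"
  shows "continuous_map X (Tl1_top lam l) S \<longleftrightarrow> (\<forall>u\<in>topspace X. S u \<in> Tl1 lam l) \<and>
    (\<forall>u\<in>topspace X. \<forall>e>0. \<exists>U. openin X U \<and> u \<in> U \<and> (\<forall>t\<in>U. tdist lam l (S u) (S t) < e))"
proof -
  interpret Metric_space "Tl lam l :: 'm tseries set" "tdist lam l" by (rule metric_Tl[OF l])
  have "continuous_map X (Tl1_top lam l) S \<longleftrightarrow> (\<forall>u\<in>topspace X. S u \<in> Tl1 lam l) \<and> continuous_map X mtopology S"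
    unfolding Tl1_top_def Tl_top_def continuous_map_in_subtopology by auto
  moreover have "continuous_map X mtopology S \<longleftrightarrow>
      (\<forall>u\<in>topspace X. \<forall>e>0. \<exists>U. openin X U \<and> u \<in> U \<and> (\<forall>t\<in>U. tdist lam l (S u) (S t) < e))"
    if S: "\<forall>u\<in>topspace X. S u \<in> Tl1 lam l"
  proof -
    have "S t \<in> mball (S u) e \<longleftrightarrow> tdist lam l (S u) (S t) < e" if "openin X U" "u \<in> U" "t \<in> U" for U u t e
      using that openin_subset[OF that(1)] S by (auto simp: Tl1_def)
    then have "(openin X U \<and> u \<in> U \<and> (\<forall>t\<in>U. S t \<in> mball (S u) e)) \<longleftrightarrow>
        (openin X U \<and> u \<in> U \<and> (\<forall>t\<in>U. tdist lam l (S u) (S t) < e))" for U u e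
      by blast
    then show ?thesis unfolding continuous_map_to_metric by simp
  qed
  ultimately show ?thesis by blast
qed

lemma topspace_Tinf_top: "topspace (Tinf_top lam) = Tinf lam"
  unfolding Tinf_top_def topology_generated_by_topspace
proof (intro equalityI subsetI)
  fix a :: "'a tseries" assume a: "a \<in> Tinf lam"
  have "a \<in> topspace (Tl_top lam (1 + 1 / real 1))"
    using a by (subst topspace_Tl_top) (auto simp: Tinf_iff)
  with a have "a \<in> Tinf lam \<inter> topspace (Tl_top lam (1 + 1 / real 1))" by (rule IntI)
  then show "a \<in> \<Union> {Tinf lam \<inter> U | k U. k \<ge> 1 \<and> openin (Tl_top lam (1 + 1 / real (k::nat))) U}"
    by (rule UnionI[rotated])
      (rule CollectI, rule exI[of _ 1], rule exI[of _ "topspace (Tl_top lam (1 + 1 / real 1))"], simp)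
qed auto

lemma topspace_Tinf1_top: "topspace (Tinf1_top lam) = Tinf1 lam"
  unfolding Tinf1_top_def by (auto simp: topspace_Tinf_top Tinf1_def)

lemma openin_Tinf1_top_ball:
  assumes k: "1 \<le> (k::nat)" and a: "a \<in> Tinf1 lam"
  shows "openin (Tinf1_top lam) {b \<in> Tinf1 lam. tdist lam (1 + 1 / real k) a b < e}"
proof -
  let ?l = "1 + 1 / real k"
  have l: "1 < ?l" using k by simp
  interpret Metric_space "Tl lam ?l :: 'a tseries set" "tdist lam ?l" by (rule metric_Tl[OF l])
  have "openin (Tl_top lam ?l) (mball a e)" unfolding Tl_top_def by (rule openin_mball)
  then have "openin (Tinf_top lam) (Tinf lam \<inter> mball a e)"
    unfolding Tinf_top_def using k
    by (intro topology_generated_by_Basis CollectI exI[of _ k] exI[of _ "mball a e"] conjI refl)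
  moreover have "{b \<in> Tinf1 lam. tdist lam ?l a b < e} = (Tinf lam \<inter> mball a e) \<inter> Tinf1 lam"
    using a l by (auto simp: Tinf1_def Tinf_iff)
  ultimately show ?thesis
    unfolding Tinf1_top_def openin_subtopology by (intro exI[of _ "Tinf lam \<inter> mball a e"] conjI)
qed

text \<open>The majorant is the level norm of \<open>a\<close> plus \<open>G\<close>, the sum over i
  of the level norms of b_i - a. The norm is countably additive on nonnegative sequences, so
  \<open>G\<close> has norm at most the sum of (1/2)^i; the geometric rate is what makes this
  finite.\<close>

lemma convergent_majorant:
  assumes l: "1 < l" and a: "a \<in> Tl lam l" and b: "\<And>i. b i \<in> Tl lam l"
    and ab: "\<And>i. tdist lam l a (b i) \<le> (1 / 2) ^ i"
  obtains s where "seqnorm lam l s < \<infinity>" "\<And>n. level_norm a n \<le> s n" "\<And>i n. level_norm (b i) n \<le> s n"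
proof -
  define g where "g i n = level_norm (b i - a) n" for i n
  have tn: "tnorm lam l (b i - a) \<le> ennreal ((1 / 2) ^ i)" for i
    using ab[of i] ennreal_tdist[OF b a, of i] tdist_commute[of l a "b i"] by (metis ennreal_leI)
  obtain z where z: "Zl l = ennreal z" "0 < z"
    using Zl_pos[of l] Zl_finite[OF l] by (cases "Zl l") (auto simp: less_le)
  \<comment> \<open>The k = 0 term of the norm alone controls each level, which makes the series
    defining \<open>G\<close> converge at every level.\<close>
  have gb: "g i n \<le> z / lam 0 ^ n * (1 / 2) ^ i" for i n
  proof -
    have "ennreal (lam 0 ^ n * g i n) \<le> Zl l * seqnorm lam l (g i)"
      by (rule seqnorm_coord[OF l])
    also have "\<dots> \<le> ennreal z * ennreal ((1 / 2) ^ i)"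
      unfolding z using tn[of i] by (intro mult_left_mono) (simp_all add: tnorm_eq_seqnorm g_def[abs_def])
    also have "\<dots> = ennreal (z * (1 / 2) ^ i)" using z(2) by (simp add: ennreal_mult)
    finally have "lam 0 ^ n * g i n \<le> z * (1 / 2) ^ i" using z(2) by (subst (asm) ennreal_le_iff) auto
    then show ?thesis using lam_pos[of 0] by (simp add: field_simps)
  qed
  have g0: "0 \<le> g i n" for i n by (simp add: g_def)
  have sm: "summable (\<lambda>i. g i n)" for n
  proof (rule summable_comparison_test'[of "\<lambda>i. z / lam 0 ^ n * (1 / 2) ^ i" 0])
    show "summable (\<lambda>i. z / lam 0 ^ n * (1 / 2) ^ i)" by (intro summable_mult summable_geometric) simp
    show "norm (g i n) \<le> z / lam 0 ^ n * (1 / 2) ^ i" for i using gb[of i n] g0[of i n] by simp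
  qed
  define G where "G n = (\<Sum>i. g i n)" for n
  have G0: "0 \<le> G n" for n unfolding G_def by (rule suminf_nonneg[OF sm g0])
  have gG: "g i n \<le> G n" for i n
    unfolding G_def using sum_le_suminf[OF sm[of n], of "{i}"] g0 by simp
  have "seqnorm lam l G = (\<Sum>i. seqnorm lam l (g i))"
    using sm by (intro seqnorm_suminf lam_nonneg g0) (simp add: G_def summable_sums)
  also have "\<dots> \<le> (\<Sum>i. ennreal ((1 / 2) ^ i))"
    using tn by (intro suminf_le) (auto simp: tnorm_eq_seqnorm g_def[abs_def])
  also have "\<dots> = ennreal (1 / (1 - 1 / 2))"
    by (intro suminf_ennreal_eq geometric_sums) auto
  finally have "seqnorm lam l G < \<infinity>" by (simp add: order.strict_trans1)
  then have fin: "seqnorm lam l (\<lambda>n. level_norm a n + G n) < \<infinity>"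
    using a G0 seqnorm_add[of lam "level_norm a" G l] by (simp add: lam_nonneg Tl_iff tnorm_eq_seqnorm)
  show thesis
  proof (rule that[OF fin])
    show "level_norm a n \<le> level_norm a n + G n" for n using G0 by simp
    show "level_norm (b i) n \<le> level_norm a n + G n" for i n
      using level_norm_triangle'[of "b i" n a] gG[of i n] by (simp add: g_def)
  qed
qed

end

section \<open>Correspondence with the integral equation, and continuity of the flow\<close>

context controlled_rde
begin

lemma sol_solves_eq:
  assumes a: "a \<in> Tinf1 lam" and sol: "sol a v"
  shows "solves_eq F x T a (flow a v)"
  unfolding solves_eq_def
proof (intro ballI)
  fix t assume t: "t \<in> {0..T}"
  have v: "cont v" using sol by (simp add: sol_def)
  obtain K where K: "bounded_by K v" using cont_bounded[OF v] by blast
  define l where "l = (1 + p) / 2"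
  have l: "1 < l" "l < p" using p by (auto simp: l_def)
  have S: "flow a v u \<in> Tl1 lam p" if "u \<in> {0..T}" for u
    using flow_Tl[OF l _ K that, of a] a l by (auto simp: Tl1_iff Tinf1_iff)
  define J where "J w c j = (\<Sum>i\<le>length w. a (take i w) * rsint (\<lambda>u. sig x v u (drop i w) * v u j c) (\<lambda>u. x u $ j) t)" for w c j
  define I where "I j w = (if w = [] then 0 else J (butlast w) (last w) j)" for j w
  have "has_RS_integral (\<lambda>u. (flow a v u \<otimes>\<^sub>t F (flow a v u) (axis j 1)) w) (\<lambda>u. x u $ j) 0 t (I j w)" for j w
  proof (cases w rule: rev_cases)
    case Nil
    show ?thesis unfolding Nil I_def if_P[OF refl]
      by (rule has_RS_integral_cong[OF has_RS_integral_zero]) (use S t in \<open>simp add: tprod_F\<close>)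
  next
    case (snoc w' c)
    have "has_RS_integral (\<lambda>u. flow a v u w' * v u j c) (\<lambda>u. x u $ j) 0 t (J w' c j)"
      unfolding J_def flow_def by (rule tprod_sig_RS[OF v t])
    then have "has_RS_integral (\<lambda>u. (flow a v u \<otimes>\<^sub>t F (flow a v u) (axis j 1)) (w' @ [c])) (\<lambda>u. x u $ j) 0 t (J w' c j)"
      by (rule has_RS_integral_cong) (use S t sol in \<open>simp add: tprod_F sol_def vel_def\<close>)
    then show ?thesis by (simp add: snoc I_def)
  qed
  moreover have "flow a v t w = a w + (\<Sum>j\<in>UNIV. I j w)" for w
  proof (cases w rule: rev_cases)
    case (snoc w' c)
    then show ?thesis by (simp add: I_def J_def flow_def tprod_sig_snoc)
  qed (simp add: I_def)
  ultimately show "\<exists>I. (\<forall>j w. has_RS_integral (\<lambda>u. (flow a v u \<otimes>\<^sub>t F (flow a v u) (axis j 1)) w) (\<lambda>u. x u $ j) 0 t (I j w)) \<and>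
      (\<forall>w. flow a v t w = a w + (\<Sum>j\<in>UNIV. I j w))" by blast
qed

text \<open>Once the velocity of \<open>S\<close> is frozen, the equation is linear in
  \<open>S\<close> and has only the flow of that velocity as solution; the velocity is then a fixed
  point.\<close>

lemma solves_eq_imp_sol:
  assumes a: "a [] = 1" and S: "\<And>u. u \<in> {0..T} \<Longrightarrow> S u \<in> Tl1 lam p"
    and c: "cont (\<lambda>u. vel (S u))" and eq: "solves_eq F x T a S"
  shows "sol a (\<lambda>u. vel (S u))" "\<And>t. t \<in> {0..T} \<Longrightarrow> S t = flow a (\<lambda>u. vel (S u)) t"
proof -
  show *: "S t = flow a (\<lambda>u. vel (S u)) t" if t: "t \<in> {0..T}" for t
  proof
    fix w
    show "S t w = flow a (\<lambda>u. vel (S u)) t w"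
      unfolding flow_def
    proof (rule linear_equation_unique[OF c _ _ t])
      show "S u [] = a []" if "u \<in> {0..T}" for u using S[OF that] a by (simp add: Tl1_iff)
      fix u w c assume u: "u \<in> {0..T}"
      obtain I where I: "\<And>j w. has_RS_integral (\<lambda>r. (S r \<otimes>\<^sub>t F (S r) (axis j 1)) w) (\<lambda>r. x r $ j) 0 u (I j w)"
        "\<And>w. S u w = a w + (\<Sum>j\<in>UNIV. I j w)"
        using eq u unfolding solves_eq_def by blast
      have "has_RS_integral (\<lambda>r. S r w * vel (S r) j c) (\<lambda>r. x r $ j) 0 u (I j (w @ [c]))" for j
        by (rule has_RS_integral_cong[OF I(1)]) (use S u in \<open>simp add: tprod_F vel_def\<close>)
      then show "\<exists>I. (\<forall>j. has_RS_integral (\<lambda>r. S r w * vel (S r) j c) (\<lambda>r. x r $ j) 0 u (I j)) \<and>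
          S u (w @ [c]) = a (w @ [c]) + (\<Sum>j\<in>UNIV. I j)"
        using I(2) by (intro exI[of _ "\<lambda>j. I j (w @ [c])"]) auto
    qed
  qed
  then show "sol a (\<lambda>u. vel (S u))"
    using c unfolding sol_def by (metis (no_types, lifting))
qed

lemma C0_all_vel_cont:
  assumes "C0_all lam T S"
  shows "\<And>u. u \<in> {0..T} \<Longrightarrow> S u \<in> Tl1 lam p" "cont (\<lambda>u. vel (S u))"
proof -
  have c: "continuous_map (top_of_set {0..T}) (Tl1_top lam p) S"
    using assms p by (simp add: C0_all_def)
  show S: "S u \<in> Tl1 lam p" if "u \<in> {0..T}" for u
    using c that unfolding continuous_map_Tl1_top_iff[OF p] by simp
  show "cont (\<lambda>u. vel (S u))"
  proof (rule vel_continuous[OF S])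
    fix u e assume u: "u \<in> {0..T}" and e: "0 < (e::real)"
    obtain U where U: "openin (top_of_set {0..T}) U" "u \<in> U" "\<forall>t\<in>U. tdist lam p (S u) (S t) < e"
      using c u e unfolding continuous_map_Tl1_top_iff[OF p] topspace_euclidean_subtopology by blast
    obtain d where "d > 0" "\<And>t. t \<in> {0..T} \<Longrightarrow> dist t u < d \<Longrightarrow> t \<in> U"
      using U(1,2) unfolding openin_euclidean_subtopology_iff by blast
    then show "\<exists>d>0. \<forall>t\<in>{0..T}. \<bar>t - u\<bar> < d \<longrightarrow> tdist lam p (S t) (S u) < e"
      using U(3) by (auto simp: dist_real_def tdist_commute[of p "S u"] intro!: exI[of _ d])
  qed
qed

lemma flow_Tinf1:
  assumes "a \<in> Tinf1 lam" "cont v" "t \<in> {0..T}"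
  shows "flow a v t \<in> Tinf1 lam"
proof -
  obtain K where K: "bounded_by K v" using cont_bounded[OF assms(2)] by blast
  have "flow a v t \<in> Tl1 lam l" if "1 < l" for l
    using flow_Tl[of "(1 + l) / 2" l a K v t] K assms that by (auto simp: Tinf1_iff Tl1_iff)
  then show ?thesis by (simp add: Tinf1_iff)
qed

lemma flow_time_continuous:
  assumes a: "a \<in> Tinf1 lam" and v: "cont v" and l: "1 < l" and u: "u \<in> {0..T}" and e: "0 < e"
  obtains d where "0 < d" "\<And>t. t \<in> {0..T} \<Longrightarrow> dist t u < d \<Longrightarrow> tdist lam l (flow a v u) (flow a v t) < e"
proof -
  obtain K where K: "bounded_by K v" using cont_bounded[OF v] by blast
  have l': "1 < (1 + l) / 2" "(1 + l) / 2 < l" using l by auto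
  have "a \<in> Tl lam ((1 + l) / 2)" using a l' by (auto simp: Tinf1_iff Tl1_iff)
  then obtain C where C: "0 \<le> C"
    "\<And>s t. s \<in> {0..T} \<Longrightarrow> t \<in> {0..T} \<Longrightarrow> tdist lam l (flow a v s) (flow a v t) \<le> C * \<bar>s - t\<bar>"
    using flow_time_lipschitz[OF l' _ K] by metis
  show thesis
  proof (rule that[of "e / (C + 1)"])
    fix t assume t: "t \<in> {0..T}" "dist t u < e / (C + 1)"
    have "tdist lam l (flow a v u) (flow a v t) \<le> C * \<bar>u - t\<bar>" by (rule C(2)[OF u t(1)])
    also have "\<dots> \<le> (C + 1) * \<bar>t - u\<bar>" by (simp add: mult_right_mono abs_minus_commute)
    also have "\<dots> < e" using t(2) C(1) by (simp add: pos_less_divide_eq mult.commute dist_real_def)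
    finally show "tdist lam l (flow a v u) (flow a v t) < e" .
  qed (use C(1) e in simp)
qed

lemma flow_C0_all:
  assumes "a \<in> Tinf1 lam" "cont v"
  shows "C0_all lam T (flow a v)"
  unfolding C0_all_def
proof (intro allI impI)
  fix l :: real assume l: "1 < l"
  show "continuous_map (top_of_set {0..T}) (Tl1_top lam l) (flow a v)"
    unfolding continuous_map_Tl1_top_iff[OF l]
  proof (intro conjI ballI allI impI)
    show "flow a v u \<in> Tl1 lam l" if "u \<in> topspace (top_of_set {0..T})" for u
      using flow_Tinf1[OF assms, of u] that l by (simp add: Tinf1_iff)
    fix u e assume u: "u \<in> topspace (top_of_set {0..T})" and e: "0 < (e::real)"
    then have u': "u \<in> {0..T}" by simp
    obtain d where d: "0 < d" "\<And>t. t \<in> {0..T} \<Longrightarrow> dist t u < d \<Longrightarrow> tdist lam l (flow a v u) (flow a v t) < e"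
      using flow_time_continuous[OF assms l u' e] by blast
    show "\<exists>U. openin (top_of_set {0..T}) U \<and> u \<in> U \<and> (\<forall>t\<in>U. tdist lam l (flow a v u) (flow a v t) < e)"
      using d u' by (intro exI[of _ "{0..T} \<inter> ball u d"]) (auto simp: openin_open_Int dist_commute)
  qed
qed

lemma sol_exists_Tinf1:
  assumes "a \<in> Tinf1 lam"
  shows "\<exists>v. sol a v"
proof -
  define l where "l = (1 + p) / 2"
  have l: "1 < l" "l < p" using p by (auto simp: l_def)
  have a: "a \<in> Tl1 lam l" using assms l by (simp add: Tinf1_iff)
  then have fin: "seqnorm lam l (level_norm a) < \<infinity>" by (simp add: Tl1_iff Tl_iff tnorm_eq_seqnorm)
  obtain K where "\<And>b. b [] = 1 \<Longrightarrow> (\<And>n. level_norm b n \<le> level_norm a n) \<Longrightarrow> \<exists>v. sol b v \<and> bounded_by K v"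
    using sol_exists[OF l level_norm_nonneg fin] by blast
  from this[of a] a show ?thesis by (auto simp: Tl1_iff)
qed

text \<open>
  A ball around \<open>a\<close> need not have a summable majorant, but a fast convergent
  sequence does; so a failure of continuity is refuted along such a sequence.
\<close>

lemma sol_flow_continuous:
  assumes l: "1 < l" "l < p" "l < l'" and a: "a \<in> Tinf1 lam" and W: "\<And>b. b \<in> Tinf1 lam \<Longrightarrow> sol b (W b)"
    and e: "0 < e"
  obtains d where "0 < d"
    "\<And>b t. b \<in> Tinf1 lam \<Longrightarrow> tdist lam l a b < d \<Longrightarrow> t \<in> {0..T} \<Longrightarrow>
      tdist lam l' (flow a (W a) t) (flow b (W b) t) < e"
proof (rule ccontr)
  assume no: "\<not> thesis"
  have "\<exists>b t. b \<in> Tinf1 lam \<and> tdist lam l a b < (1 / 2) ^ i \<and> t \<in> {0..T} \<and>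
      \<not> tdist lam l' (flow a (W a) t) (flow b (W b) t) < e" for i :: nat
  proof (rule ccontr)
    assume "\<not> ?thesis"
    then have "thesis"
      by (intro that[of "(1 / 2) ^ i"]) (simp, blast)
    with no show False by contradiction
  qed
  then obtain b t where b: "\<And>i::nat. b i \<in> Tinf1 lam" and ab: "\<And>i. tdist lam l a (b i) < (1 / 2) ^ i"
    and t: "\<And>i. t i \<in> {0..T}" and far: "\<And>i. \<not> tdist lam l' (flow a (W a) (t i)) (flow (b i) (W (b i)) (t i)) < e"
    by metis
  have aT: "a \<in> Tl1 lam l" and bT: "b i \<in> Tl1 lam l" for i using a b l by (auto simp: Tinf1_iff)
  then have aT': "a \<in> Tl lam l" "b i \<in> Tl lam l" "a [] = 1" "b i [] = 1" for i by (auto simp: Tl1_iff)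
  obtain s where s: "seqnorm lam l s < \<infinity>" and as: "\<And>n. level_norm a n \<le> s n"
    and bs: "\<And>i n. level_norm (b i) n \<le> s n"
    using convergent_majorant[OF l(1) aT'(1,2) less_imp_le[OF ab]] by blast
  have s0: "0 \<le> s n" for n by (rule majorant_nonneg[OF as])
  obtain K where K: "0 \<le> K"
    "\<And>a. a [] = 1 \<Longrightarrow> (\<And>n. level_norm a n \<le> s n) \<Longrightarrow> \<exists>v. sol a v \<and> bounded_by K v"
    using sol_exists[OF l(1,2) s0 s] by blast
  obtain C where C: "0 \<le> C"
    "\<And>a a' v v' t. \<lbrakk>a [] = 1; a' [] = 1; \<And>n. level_norm a n \<le> s n; \<And>n. level_norm a' n \<le> s n;
      bounded_by K v; bounded_by K v'; sol a v; sol a' v'; t \<in> {0..T}\<rbrakk> \<Longrightarrow>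
      tdist lam l' (flow a v t) (flow a' v' t) \<le> C * tdist lam l a a'"
    using sol_flow_stability[OF l s0 s K(1)] by blast
  obtain v where v: "sol a v" "bounded_by K v" using K(2)[OF aT'(3) as] by blast
  have "tdist lam l' (flow a (W a) (t i)) (flow (b i) (W (b i)) (t i)) \<le> C * (1 / 2) ^ i" for i
  proof -
    \<comment> \<open>The bound of the chosen \<open>W (b i)\<close> may vary with i. By uniqueness
      its flow is also that of a velocity bounded by the common \<open>K\<close>.\<close>
    obtain v' where v': "sol (b i) v'" "bounded_by K v'" using K(2)[OF aT'(4) bs] by blast
    have eqs: "flow a (W a) (t i) = flow a v (t i)" "flow (b i) (W (b i)) (t i) = flow (b i) v' (t i)"
      using sol_unique[OF l(1,2) aT W[OF a] v(1) t] sol_unique[OF l(1,2) bT W[OF b] v'(1) t] by auto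
    have "tdist lam l' (flow a v (t i)) (flow (b i) v' (t i)) \<le> C * tdist lam l a (b i)"
      by (rule C(2)[OF aT'(3,4) as bs v(2) v'(2) v(1) v'(1) t])
    also have "\<dots> \<le> C * (1 / 2) ^ i" using ab[of i] C(1) by (intro mult_left_mono) auto
    finally show ?thesis by (simp only: eqs)
  qed
  then have "e \<le> C * (1 / 2) ^ i" for i using far[of i] by (meson not_less order_trans)
  moreover have "(\<lambda>i. C * (1 / 2) ^ i) \<longlonglongrightarrow> C * 0"
    by (intro tendsto_mult_left LIMSEQ_power_zero) simp
  ultimately have "e \<le> C * 0" by (intro LIMSEQ_le_const) auto
  then show False using e by simp
qed

text \<open>Generating open sets suffice. Within a neighbourhood, time is moved first at the fixed
  datum, then the datum is moved with an estimate uniform in time; each move costs r/2.\<close>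

lemma flow_map_continuous:
  assumes W: "\<And>b. b \<in> Tinf1 lam \<Longrightarrow> sol b (W b)"
  shows "continuous_map (prod_topology (Tinf1_top lam) (top_of_set {0..T})) (Tinf1_top lam)
    (\<lambda>(a, t). flow a (W a) t)"
proof -
  let ?X = "prod_topology (Tinf1_top lam) (top_of_set {0..T})"
  let ?f = "\<lambda>(a, t). flow a (W a) t"
  have WC: "cont (W a)" if "a \<in> Tinf1 lam" for a using W[OF that] by (simp add: sol_def)
  have top: "topspace ?X = Tinf1 lam \<times> {0..T}" by (simp add: topspace_Tinf1_top)
  have img: "?f z \<in> Tinf1 lam" if "z \<in> topspace ?X" for z
    using that WC flow_Tinf1 unfolding top by auto
  have "continuous_map ?X (Tinf_top lam) ?f"
    unfolding Tinf_top_def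
  proof (rule continuous_on_generated_topo)
    have "?f ` topspace ?X \<subseteq> topspace (Tinf_top lam)"
      using img by (auto simp: topspace_Tinf_top Tinf1_def)
    then show "?f ` topspace ?X \<subseteq> \<Union> {Tinf lam \<inter> U | k U. k \<ge> 1 \<and> openin (Tl_top lam (1 + 1 / real (k::nat))) U}"
      unfolding Tinf_top_def topology_generated_by_topspace .
    fix V assume "V \<in> {Tinf lam \<inter> U | k U. k \<ge> 1 \<and> openin (Tl_top lam (1 + 1 / real (k::nat))) (U :: 'm tseries set)}"
    then obtain k U where V: "V = Tinf lam \<inter> U" and k: "1 \<le> (k::nat)" and U: "openin (Tl_top lam (1 + 1 / real k)) U"
      by blast
    let ?l' = "1 + 1 / real k"
    have l': "1 < ?l'" using k by simp
    show "openin ?X (?f -` V \<inter> topspace ?X)"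
    proof (subst openin_subopen, rule ballI)
      fix z assume z: "z \<in> ?f -` V \<inter> topspace ?X"
      then obtain a t where zat: "z = (a, t)" and a: "a \<in> Tinf1 lam" and t: "t \<in> {0..T}" and aU: "flow a (W a) t \<in> U"
        unfolding top V by auto
      obtain r where r: "r > 0" "\<And>b. b \<in> Tl lam ?l' \<Longrightarrow> tdist lam ?l' (flow a (W a) t) b < r \<Longrightarrow> b \<in> U"
        using openin_Tl_top_ball[OF l' U aU] by blast
      \<comment> \<open>The neighbourhood of the datum is measured at an exponent of the generating
        family below the target exponent, to pay for the loss, and below \<open>p\<close>, to use
        the Lipschitz estimates.\<close>
      have "1 < min p ?l'" using p l' by simp
      then obtain q :: nat where q: "1 \<le> q" "1 + 1 / real q < min p ?l'" using exponent_below by blast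
      let ?l = "1 + 1 / real q"
      have l: "1 < ?l" "?l < p" "?l < ?l'" using q by auto
      have r2: "0 < r / 2" using r by simp
      obtain d1 where d1: "0 < d1" "\<And>b t. b \<in> Tinf1 lam \<Longrightarrow> tdist lam ?l a b < d1 \<Longrightarrow> t \<in> {0..T} \<Longrightarrow>
          tdist lam ?l' (flow a (W a) t) (flow b (W b) t) < r / 2"
        using sol_flow_continuous[OF l a W r2] by blast
      obtain d2 where d2: "0 < d2" "\<And>s. s \<in> {0..T} \<Longrightarrow> dist s t < d2 \<Longrightarrow> tdist lam ?l' (flow a (W a) t) (flow a (W a) s) < r / 2"
        using flow_time_continuous[OF a WC[OF a] l' t r2] by blast
      let ?B = "{b \<in> Tinf1 lam. tdist lam ?l a b < d1}"
      let ?N = "?B \<times> ({0..T} \<inter> ball t d2)"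
      have "openin ?X ?N"
        unfolding openin_prod_Times_iff using openin_Tinf1_top_ball[OF q(1) a]
        by (auto simp: openin_open_Int)
      moreover have "z \<in> ?N" using a t d1(1) d2(1) by (simp add: zat)
      moreover have "?N \<subseteq> ?f -` V \<inter> topspace ?X"
      proof
        fix y assume "y \<in> ?N"
        then obtain b s where y: "y = (b, s)" and b: "b \<in> Tinf1 lam" "tdist lam ?l a b < d1"
          and s: "s \<in> {0..T}" "dist s t < d2" by (auto simp: dist_commute)
        have Tl: "flow a (W a) t \<in> Tl lam ?l'" "flow a (W a) s \<in> Tl lam ?l'" "flow b (W b) s \<in> Tl lam ?l'"
          using flow_Tinf1[OF a WC[OF a] t] flow_Tinf1[OF a WC[OF a] s(1)] flow_Tinf1[OF b(1) WC[OF b(1)] s(1)] l'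
          by (auto simp: Tinf1_iff Tl1_iff)
        have "tdist lam ?l' (flow a (W a) t) (flow b (W b) s) < r"
          using tdist_triangle[OF l' Tl] d1(2)[OF b s(1)] d2(2)[OF s] by linarith
        then have "flow b (W b) s \<in> U" by (rule r(2)[OF Tl(3)])
        moreover have "flow b (W b) s \<in> Tinf lam"
          using flow_Tinf1[OF b(1) WC[OF b(1)] s(1)] by (simp add: Tinf1_def)
        ultimately show "y \<in> ?f -` V \<inter> topspace ?X" using b s unfolding top V y by simp
      qed
      ultimately show "\<exists>N. openin ?X N \<and> z \<in> N \<and> N \<subseteq> ?f -` V \<inter> topspace ?X" by blast
    qed
  qed
  then show ?thesis
    unfolding Tinf1_top_def continuous_map_in_subtopology
    using img unfolding Tinf1_top_def by blast
qed

end

theorem theorem4p16: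
  fixes p :: real and lam :: "nat \<Rightarrow> real" and M :: nat
    and F :: "'m::finite tseries \<Rightarrow> real ^ 'd::finite \<Rightarrow> 'm tseries"
  assumes p: "p > 1"
    and lam_pos: "\<And>k. lam k > 0"
    and lam_lim: "filterlim lam at_top sequentially"
    and lam_growth: "\<And>q. q > 1 \<Longrightarrow> lam \<in> o(\<lambda>k. real k powr q)"
    and F_lin: "\<And>a. a \<in> Tl1 lam p \<Longrightarrow> F a \<in> lin_tM M"
    and F_lip: "\<And>j a. a \<in> Tl1 lam p \<Longrightarrow>
        \<exists>U L. openin (Tl1_top lam p) U \<and> a \<in> U \<and> L > 0 \<and>
          (\<forall>a1\<in>U. \<forall>a2\<in>U.
             tM_norm M (F a1 (axis j 1) - F a2 (axis j 1)) \<le> L * tdist lam p a1 a2)"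
    and F_growth: "\<And>j R. R > 0 \<Longrightarrow>
        \<exists>C>0. \<forall>a\<in>tpolys. a [] = 1 \<and> tnorm lam p (a - tone) \<le> ennreal R \<longrightarrow>
          (\<forall>\<alpha>\<ge>0. \<forall>r\<ge>0.
             norm1 (dil (\<alpha> / (1 + r)) (F (dil r a) (axis j 1))) \<le> ennreal (C * \<alpha>))"
  shows "\<forall>T>0. \<forall>x :: real \<Rightarrow> real ^ 'd. (\<exists>L. L-lipschitz_on {0..T} x) \<longrightarrow>
    (\<exists>\<Phi> :: 'm tseries \<Rightarrow> real \<Rightarrow> 'm tseries.
       (\<forall>S0\<in>Tinf1 lam.
          solves_eq F x T S0 (\<Phi> S0) \<and> C0_all lam T (\<Phi> S0) \<and>
          (\<forall>S. solves_eq F x T S0 S \<and> C0_all lam T S \<longrightarrow> (\<forall>t\<in>{0..T}. S t = \<Phi> S0 t)) \<and>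
          (\<forall>t\<in>{0..T}. \<Phi> S0 t \<in> Tinf1 lam)) \<and>
       continuous_map (prod_topology (Tinf1_top lam) (top_of_set {0..T})) (Tinf1_top lam)
         (\<lambda>(S0, t). \<Phi> S0 t))"
proof (intro allI impI)
  fix T :: real and x :: "real \<Rightarrow> real ^ 'd"
  assume T: "0 < T" and "\<exists>L. L-lipschitz_on {0..T} x"
  then obtain L where x: "L-lipschitz_on {0..T} x" by blast
  interpret controlled_rde lam p M F x T L
    by unfold_locales (fact lam_pos lam_growth p F_lin F_lip F_growth T x)+
  obtain W where W: "\<And>a. a \<in> Tinf1 lam \<Longrightarrow> sol a (W a)" using sol_exists_Tinf1 by metis
  show "\<exists>\<Phi> :: 'm tseries \<Rightarrow> real \<Rightarrow> 'm tseries.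
       (\<forall>S0\<in>Tinf1 lam.
          solves_eq F x T S0 (\<Phi> S0) \<and> C0_all lam T (\<Phi> S0) \<and>
          (\<forall>S. solves_eq F x T S0 S \<and> C0_all lam T S \<longrightarrow> (\<forall>t\<in>{0..T}. S t = \<Phi> S0 t)) \<and>
          (\<forall>t\<in>{0..T}. \<Phi> S0 t \<in> Tinf1 lam)) \<and>
       continuous_map (prod_topology (Tinf1_top lam) (top_of_set {0..T})) (Tinf1_top lam)
         (\<lambda>(S0, t). \<Phi> S0 t)"
  \<comment> \<open>One velocity is chosen per initial datum; by \<open>sol_unique\<close> the flow
    on [0,T] does not depend on the choice.\<close>
  proof (rule exI[of _ "\<lambda>a. flow a (W a)"], intro conjI ballI allI impI flow_map_continuous W)
    fix a :: "'m tseries" assume a: "a \<in> Tinf1 lam"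
    have c: "cont (W a)" using W[OF a] by (simp add: sol_def)
    show "solves_eq F x T a (flow a (W a))" by (rule sol_solves_eq[OF a W[OF a]])
    show "C0_all lam T (flow a (W a))" by (rule flow_C0_all[OF a c])
    show "flow a (W a) t \<in> Tinf1 lam" if "t \<in> {0..T}" for t by (rule flow_Tinf1[OF a c that])
    fix S t assume S: "solves_eq F x T a S \<and> C0_all lam T S" and t: "t \<in> {0..T}"
    have a1: "a [] = 1" using a by (simp add: Tinf1_def)
    define l where "l = (1 + p) / 2"
    have l: "1 < l" "l < p" using p by (auto simp: l_def)
    have al: "a \<in> Tl1 lam l" using a l by (simp add: Tinf1_iff)
    have ST: "\<And>u. u \<in> {0..T} \<Longrightarrow> S u \<in> Tl1 lam p" and cS: "cont (\<lambda>u. vel (S u))"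
      using C0_all_vel_cont[OF conjunct2[OF S]] by auto
    \<comment> \<open>A competing solution is the flow of its own velocity, and two fixed points
      with the same initial datum have the same flow.\<close>
    have "S t = flow a (\<lambda>u. vel (S u)) t"
      by (rule solves_eq_imp_sol(2)[OF a1 ST cS conjunct1[OF S] t])
    also have "\<dots> = flow a (W a) t"
      by (rule sol_unique[OF l al solves_eq_imp_sol(1)[OF a1 ST cS conjunct1[OF S]] W[OF a] t])
    finally show "S t = flow a (W a) t" .
  qed
qed

end
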